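(* Let $n\geq2$ and let $f$ be a smooth, symmetric, increasing and homogeneous of degree one function on $\Gamma_+=\{\lambda\in\mathbb{R}^n:\lambda_i>0\ \forall i\}$ such that either (i) $f$ is concave and approaches zero on the boundary of $\Gamma_+$; or (ii) $f$ is concave and inverse concave; or (iii) $f$ is inverse concave and its dual function $f_*$ approaches zero on the boundary of $\Gamma_+$; or (iv) $n=2$. Let $M$ be a smooth, closed and strictly h-convex hypersurface in $\mathbb{H}^{n+1}$ with principal curvatures $\kappa=(\kappa_1,\dots,\kappa_n)$ satisfying $$f(\lambda)=C$$ for some constant $C>0$, where $\lambda=(\lambda_1,\dots,\lambda_n)$ with $\lambda_i=\kappa_i-1$. Then $M$ is a geodesic sphere.
   Context: $\mathbb{H}^{n+1}$ is hyperbolic space of constant sectional curvature $-1$. Hypersurfaces are connected and embedded; closed means compact without boundary. Principal curvatures are with respect to the outward normal (geodesic spheres of radius $r$ have $\kappa_i=\coth r$). Strictly h-convex (strictly horospherically convex) means $\kappa_i>1$ for all $i$ everywhere. "Increasing" means $\partial f/\partial\lambda_i>0$ for each $i$. The dual function is $f_*(z_1,\dots,z_n)=f(z_1^{-1},\dots,z_n^{-1})^{-1}$ on $\Gamma_+$, and $f$ is inverse concave if $f_*$ is concave. "Approaches zero on the boundary" means tending to $0$ at every boundary point of $\Gamma_+$. *)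

theory Defs
  imports "HOL-Analysis.Analysis"
begin

section \<open>Smooth maps\<close>

text \<open>On an open subset of a finite-dimensional space, being \<open>C\<^sup>k\<^sup>+\<^sup>1\<close> is the same as being
  differentiable with every directional derivative of class \<open>C\<^sup>k\<close>.  The predicates below are only
  used on open sets.\<close>

primrec Ck_on ::
  "nat \<Rightarrow> 'a set \<Rightarrow> ('a::euclidean_space \<Rightarrow> 'b::euclidean_space) \<Rightarrow> bool" where
  "Ck_on 0 S = (\<lambda>f. continuous_on S f)"
| "Ck_on (Suc k) S = (\<lambda>f. (\<forall>x\<in>S. f differentiable (at x)) \<and>
     (\<forall>v. Ck_on k S (\<lambda>x. frechet_derivative f (at x) v)))"

definition smooth_on ::
  "'a set \<Rightarrow> ('a::euclidean_space \<Rightarrow> 'b::euclidean_space) \<Rightarrow> bool" where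
  "smooth_on S f \<longleftrightarrow> (\<forall>k. Ck_on k S f)"

section \<open>Hyperbolic space\<close>

text \<open>With \<open>n = CARD('n)\<close>, the type \<open>'n minkowski\<close> is \<open>\<real>\<^sup>n\<^sup>+\<^sup>1 \<times> \<real>\<close> (space, time), and
  hyperbolic space \<open>H\<^sup>n\<^sup>+\<^sup>1\<close> of curvature \<open>-1\<close> is the upper sheet of the hyperboloid
  \<open>\<langle>x,x\<rangle> = -1\<close>, with the metric induced by the Minkowski form.\<close>

type_synonym 'n minkowski = "((real ^ 'n) \<times> real) \<times> real"

definition mink :: "'n::finite minkowski \<Rightarrow> 'n minkowski \<Rightarrow> real" where
  "mink x y = fst x \<bullet> fst y - snd x * snd y"

definition hyp_space :: "'n::finite minkowski set" where
  "hyp_space = {x. mink x x = -1 \<and> 0 < snd x}"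

definition hyp_tangent :: "'n::finite minkowski \<Rightarrow> 'n minkowski set" where
  "hyp_tangent x = {v. mink x v = 0}"

text \<open>Minkowski-orthogonal projection onto the tangent space at \<open>x\<close>; the sign is due to
  \<open>\<langle>x,x\<rangle> = -1\<close>.\<close>

definition hyp_proj :: "'n::finite minkowski \<Rightarrow> 'n minkowski \<Rightarrow> 'n minkowski" where
  "hyp_proj x w = w + mink x w *\<^sub>R x"

definition hyp_dist :: "'n::finite minkowski \<Rightarrow> 'n minkowski \<Rightarrow> real" where
  "hyp_dist x y = arcosh (- mink x y)"

definition hyp_bounded :: "'n::finite minkowski set \<Rightarrow> bool" where
  "hyp_bounded S \<longleftrightarrow> (\<exists>c\<in>hyp_space. \<exists>R. \<forall>x\<in>S. hyp_dist c x \<le> R)"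

definition geodesic_sphere :: "'n::finite minkowski set \<Rightarrow> bool" where
  "geodesic_sphere S \<longleftrightarrow>
     (\<exists>c\<in>hyp_space. \<exists>r>0. S = {x \<in> hyp_space. hyp_dist c x = r})"

text \<open>The exponential map applied to \<open>t v\<close>, for a \<^emph>\<open>unit\<close> tangent vector \<open>v\<close> at \<open>x\<close>.\<close>

definition hyp_geodesic :: "'n::finite minkowski \<Rightarrow> 'n minkowski \<Rightarrow> real \<Rightarrow> 'n minkowski" where
  "hyp_geodesic x v t = cosh t *\<^sub>R x + sinh t *\<^sub>R v"

section \<open>Hypersurfaces\<close>

text \<open>A connected embedded smooth hypersurface without boundary: a nonempty connected subset of
  hyperbolic space that is locally the zero set of a smooth function whose differential does not
  vanish on the tangent spaces of hyperbolic space.\<close>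

definition smooth_hypersurface :: "'n::finite minkowski set \<Rightarrow> bool" where
  "smooth_hypersurface M \<longleftrightarrow> M \<subseteq> hyp_space \<and> M \<noteq> {} \<and> connected M \<and>
     (\<forall>p\<in>M. \<exists>U (\<phi> :: 'n minkowski \<Rightarrow> real). open U \<and> p \<in> U \<and> smooth_on U \<phi> \<and>
        M \<inter> U = {x \<in> hyp_space \<inter> U. \<phi> x = 0} \<and>
        (\<forall>x\<in>M \<inter> U. \<exists>v\<in>hyp_tangent x. frechet_derivative \<phi> (at x) v \<noteq> 0))"

definition tangent_space :: "'n::finite minkowski set \<Rightarrow> 'n minkowski \<Rightarrow> 'n minkowski set" where
  "tangent_space M p = {v. \<exists>\<gamma> \<epsilon>. 0 < \<epsilon> \<and> smooth_on {-\<epsilon><..<\<epsilon>} \<gamma> \<and> \<gamma> ` {-\<epsilon><..<\<epsilon>} \<subseteq> M \<and>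
     \<gamma> (0::real) = p \<and> (\<gamma> has_vector_derivative v) (at 0)}"

text \<open>For closed \<open>M\<close>, the side of \<open>M\<close> that the outward normal points to.\<close>

definition exterior_region :: "'n::finite minkowski set \<Rightarrow> 'n minkowski set" where
  "exterior_region M =
     {x \<in> hyp_space - M. \<not> hyp_bounded (connected_component_set (hyp_space - M) x)}"

definition outward_unit_normal ::
  "'n::finite minkowski set \<Rightarrow> 'n minkowski \<Rightarrow> 'n minkowski \<Rightarrow> bool" where
  "outward_unit_normal M p \<nu> \<longleftrightarrow>
     \<nu> \<in> hyp_tangent p \<and> mink \<nu> \<nu> = 1 \<and> (\<forall>v\<in>tangent_space M p. mink \<nu> v = 0) \<and>
     (\<forall>\<^sub>F t in at_right 0. hyp_geodesic p \<nu> t \<in> exterior_region M)"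

text \<open>\<open>\<kappa>\<close> lists, in some order and with multiplicity, the eigenvalues of the shape operator
  \<open>v \<mapsto> \<nabla>\<^sub>v \<nu>\<close> at \<open>p\<close>, where \<open>\<nu>\<close> is the outward unit normal field, \<open>\<nabla>\<close> is the Levi-Civita
  connection of hyperbolic space (the tangential part of the ambient derivative) and \<open>e\<close> is an
  orthonormal basis of principal directions.  The field \<open>\<nu>\<close> matters only on \<open>M\<close>; its derivative
  \<open>D\<close> within \<open>M\<close> is uniquely determined on vectors tangent to \<open>M\<close>.  With this sign, geodesic
  spheres of radius \<open>r\<close> have \<open>\<kappa>\<^sub>i = coth r\<close>.\<close>

definition principal_curvatures ::
  "'n::finite minkowski set \<Rightarrow> 'n minkowski \<Rightarrow> real ^ 'n \<Rightarrow> bool" where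
  "principal_curvatures M p \<kappa> \<longleftrightarrow>
     (\<exists>\<nu> D (e :: 'n \<Rightarrow> 'n minkowski).
        (\<forall>q\<in>M. outward_unit_normal M q (\<nu> q)) \<and>
        (\<nu> has_derivative D) (at p within M) \<and>
        (\<forall>i. e i \<in> tangent_space M p) \<and>
        (\<forall>i j. mink (e i) (e j) = (if i = j then 1 else 0)) \<and>
        (\<forall>i. hyp_proj p (D (e i)) = (\<kappa> $ i) *\<^sub>R e i))"

definition strictly_h_convex :: "'n::finite minkowski set \<Rightarrow> bool" where
  "strictly_h_convex M \<longleftrightarrow> (\<forall>p\<in>M. \<forall>\<kappa>. principal_curvatures M p \<kappa> \<longrightarrow> (\<forall>i. 1 < \<kappa> $ i))"

section \<open>Curvature functions\<close>

definition pos_cone :: "(real ^ 'n::finite) set" where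
  "pos_cone = {z. \<forall>i. 0 < z $ i}"

definition symmetric_fun :: "(real ^ 'n::finite \<Rightarrow> real) \<Rightarrow> bool" where
  "symmetric_fun f \<longleftrightarrow>
     (\<forall>z\<in>pos_cone. \<forall>\<sigma>. \<sigma> permutes UNIV \<longrightarrow> f (\<chi> i. z $ \<sigma> i) = f z)"

definition increasing_fun :: "(real ^ 'n::finite \<Rightarrow> real) \<Rightarrow> bool" where
  "increasing_fun f \<longleftrightarrow>
     (\<forall>z\<in>pos_cone. \<forall>i. 0 < frechet_derivative f (at z) (axis i 1))"

definition homogeneous_deg_one :: "(real ^ 'n::finite \<Rightarrow> real) \<Rightarrow> bool" where
  "homogeneous_deg_one f \<longleftrightarrow> (\<forall>z\<in>pos_cone. \<forall>t>0. f (t *\<^sub>R z) = t * f z)"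

definition dual_fun :: "(real ^ 'n::finite \<Rightarrow> real) \<Rightarrow> real ^ 'n \<Rightarrow> real" where
  "dual_fun f z = inverse (f (\<chi> i. inverse (z $ i)))"

definition inverse_concave :: "(real ^ 'n::finite \<Rightarrow> real) \<Rightarrow> bool" where
  "inverse_concave f \<longleftrightarrow> concave_on pos_cone (dual_fun f)"

definition zero_on_boundary :: "(real ^ 'n::finite \<Rightarrow> real) \<Rightarrow> bool" where
  "zero_on_boundary f \<longleftrightarrow> (\<forall>z\<in>frontier pos_cone. (f \<longlongrightarrow> 0) (at z within pos_cone))"

end

theory Submission
  imports Defs
begin

text \<open>The proof is Alexandrov's method of reflection.  The equation \<open>f(\<kappa> - 1) = C\<close> is elliptic because
\<open>f\<close> is increasing and strict horospherical convexity keeps \<open>\<kappa> - 1\<close> inside the positive cone, so two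
pieces of solutions that touch from one side must agree.

In horospherical (half-space) coordinates around a point of \<open>M\<close> the hypersurface is
the graph of a function \<open>u\<close>, and \<open>\<kappa> - 1\<close> is the spectrum of an explicit symmetric form in
\<open>u, Du, D\<^sup>2u\<close> (\<open>graph_curvature\<close>).  The maximum principle is derived without differentiating
\<open>f\<close> as a function of matrices: Weyl's monotonicity of ordered eigenvalues and invariance of the
trace already show that \<open>f\<close> strictly grows when a form loses little in each direction but gains
much in the trace (\<open>spectral_comparison\<close>), and this is what the exponential barrier of Hopf
achieves (\<open>barrier_strict\<close>).  Hopf's boundary lemma and the strong maximum principle follow
(\<open>hopf_boundary_gradient\<close>, \<open>strong_maximum_principle\<close>).

Let \<open>K\<close> be the complement of the exterior region.  Near each point exactly one
side of \<open>M\<close> belongs to the exterior: otherwise, by connectedness, both sides would do so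
everywhere, the negated normal field would be outward as well, and both \<open>\<kappa>\<close> and \<open>-\<kappa>\<close> would
exceed 1 (\<open>two_sided_empty\<close>).  Hence \<open>K\<close> is a compact body with boundary \<open>M\<close> and the outward
normal is unique and continuous.

Fix a point \<open>c\<close> and a unit tangent vector \<open>w\<close> there.  The hyperplanes
orthogonal to the geodesic through \<open>c\<close> in direction \<open>w\<close> sweep hyperbolic space; move them in from
infinity as long as the reflected cap of \<open>K\<close> stays in \<open>K\<close>.  At the critical position
(\<open>critical_plane\<close>) there is a point \<open>p\<close> of \<open>M\<close> such that the reflection takes \<open>p\<close> to \<open>M\<close> and the
normal at \<open>p\<close> to the normal at the image (\<open>symmetric_point_exists\<close>).  Such points form a set that is
closed by continuity and open by the comparison results (\<open>local_reflection\<close>), so it is all of the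
connected set \<open>M\<close>, and \<open>M\<close> is symmetric in that hyperplane (\<open>reflection_symmetry\<close>).

Take for \<open>c\<close> the circumcentre of \<open>M\<close>.  It is unique, so every symmetry of \<open>M\<close>
fixes it, and every critical hyperplane passes through it.  Thus \<open>M\<close> is invariant under all
reflections in hyperplanes through \<open>c\<close>, hence is a union of spheres about \<open>c\<close>; it is a single one
since \<open>M\<close> is connected and has no interior (\<open>geodesic_sphere_M\<close>).\<close>

section \<open>Comparison of spectra\<close>

definition orthonormal_family :: "('n::finite \<Rightarrow> real ^ 'n) \<Rightarrow> bool" where
  "orthonormal_family \<xi> \<longleftrightarrow> (\<forall>i j. \<xi> i \<bullet> \<xi> j = (if i = j then 1 else 0))"

lemma orthonormal_expand:
  fixes \<xi> :: "'n::finite \<Rightarrow> real ^ 'n"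
  assumes "orthonormal_family \<xi>"
  shows "v = (\<Sum>i\<in>UNIV. (v \<bullet> \<xi> i) *\<^sub>R \<xi> i)"
proof -
  define S where "S = (\<lambda>c::real^'n. \<Sum>i\<in>UNIV. (c $ i) *\<^sub>R \<xi> i)"
  have lin: "linear S"
    unfolding S_def by (auto intro!: linearI simp: scaleR_left_distrib sum.distrib scaleR_sum_right)
  have coeff: "S c \<bullet> \<xi> j = c $ j" for c j
  proof -
    have "S c \<bullet> \<xi> j = (\<Sum>i\<in>UNIV. if i = j then c $ i else 0)"
      using assms unfolding S_def inner_sum_left orthonormal_family_def
      by (intro sum.cong) auto
    then show ?thesis by simp
  qed
  have "inj S"
    by (metis coeff injI vec_eq_iff)
  then have "surj S" using lin linear_injective_imp_surjective by blast
  then obtain c where "v = S c" by blast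
  then show ?thesis using coeff[of c] by (simp add: S_def)
qed

lemma orthonormal_parseval:
  fixes \<xi> :: "'n::finite \<Rightarrow> real ^ 'n"
  assumes "orthonormal_family \<xi>"
  shows "(\<Sum>i\<in>UNIV. (v \<bullet> \<xi> i)\<^sup>2) = v \<bullet> v"
proof -
  have "v \<bullet> v = v \<bullet> (\<Sum>i\<in>UNIV. (v \<bullet> \<xi> i) *\<^sub>R \<xi> i)"
    using orthonormal_expand[OF assms, of v] by simp
  also have "\<dots> = (\<Sum>i\<in>UNIV. (v \<bullet> \<xi> i)\<^sup>2)"
    by (simp add: inner_sum_right power2_eq_square)
  finally show ?thesis by simp
qed

definition diag_form :: "(real ^ 'n::finite \<Rightarrow> real) \<Rightarrow> real ^ 'n \<Rightarrow> bool" where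
  "diag_form Q l \<longleftrightarrow>
     (\<exists>\<xi>. orthonormal_family \<xi> \<and> (\<forall>v. Q v = (\<Sum>i\<in>UNIV. l $ i * (v \<bullet> \<xi> i)\<^sup>2)))"

lemma diag_form_trace:
  assumes "diag_form Q l"
  shows "(\<Sum>i\<in>UNIV. Q (axis i 1)) = (\<Sum>i\<in>UNIV. l $ i)"
proof -
  obtain \<xi> where \<xi>: "orthonormal_family \<xi>" "\<And>v. Q v = (\<Sum>i\<in>UNIV. l $ i * (v \<bullet> \<xi> i)\<^sup>2)"
    using assms unfolding diag_form_def by blast
  have "(\<Sum>i\<in>UNIV. Q (axis i 1)) = (\<Sum>j\<in>UNIV. \<Sum>i\<in>UNIV. l $ j * (\<xi> j $ i)\<^sup>2)"
    unfolding \<xi>(2) by (subst sum.swap) (simp add: inner_axis')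
  also have "\<dots> = (\<Sum>j\<in>UNIV. l $ j * (\<xi> j \<bullet> \<xi> j))"
    by (simp add: sum_distrib_left inner_vec_def power2_eq_square)
  finally show ?thesis using \<xi>(1) by (simp add: orthonormal_family_def)
qed

lemma sorted_enumeration:
  fixes l :: "'n::finite \<Rightarrow> real"
  obtains \<alpha> where "bij_betw \<alpha> {..<CARD('n)} UNIV"
    and "\<And>i j. i \<le> j \<Longrightarrow> j < CARD('n) \<Longrightarrow> l (\<alpha> i) \<le> l (\<alpha> j)"
proof -
  obtain xs :: "'n list" where xs: "set xs = UNIV" "distinct xs"
    using finite_distinct_list[OF finite] by blast
  define ys where "ys = sort_key l xs"
  have ys: "set ys = UNIV" "distinct ys" "sorted (map l ys)"
    using xs unfolding ys_def by auto
  then have len: "length ys = CARD('n)" by (metis distinct_card)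
  have "bij_betw ((!) ys) {..<CARD('n)} UNIV"
    using ys len by (metis bij_betw_nth)
  moreover have "l (ys ! i) \<le> l (ys ! j)" if "i \<le> j" "j < CARD('n)" for i j
    using ys(3) that len sorted_nth_mono[of "map l ys" i j] by simp
  ultimately show ?thesis using that by blast
qed

text \<open>Weyl's monotonicity principle.  List both spectra in increasing order.  For each \<open>k\<close> the \<open>n - 1\<close>
conditions of being orthogonal to the first \<open>k\<close> eigenvectors of one form and to the last
\<open>n - 1 - k\<close> of the other have a nonzero solution, and on it the two forms are bounded by the
\<open>k\<close>-th eigenvalues in the directions needed.\<close>

lemma eigenvalue_domination:
  fixes Q1 Q2 :: "real ^ 'n::finite \<Rightarrow> real"
  assumes Q1: "diag_form Q1 l" and Q2: "diag_form Q2 m"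
    and le: "\<And>v. Q1 v \<le> Q2 v + s * (v \<bullet> v)"
  obtains \<sigma> where "\<sigma> permutes UNIV" "\<And>i. l $ i - s \<le> m $ \<sigma> i"
proof -
  obtain \<xi> where \<xi>: "orthonormal_family \<xi>" "\<And>v. Q1 v = (\<Sum>i\<in>UNIV. l $ i * (v \<bullet> \<xi> i)\<^sup>2)"
    using Q1 unfolding diag_form_def by blast
  obtain \<eta> where \<eta>: "orthonormal_family \<eta>" "\<And>v. Q2 v = (\<Sum>i\<in>UNIV. m $ i * (v \<bullet> \<eta> i)\<^sup>2)"
    using Q2 unfolding diag_form_def by blast
  define n where "n = CARD('n)"
  obtain \<alpha> where \<alpha>: "bij_betw \<alpha> {..<n} UNIV"
      "\<And>i j. i \<le> j \<Longrightarrow> j < n \<Longrightarrow> l $ (\<alpha> i) \<le> l $ (\<alpha> j)"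
    using sorted_enumeration[of "\<lambda>i. l $ i"] unfolding n_def by blast
  obtain \<beta> where \<beta>: "bij_betw \<beta> {..<n} UNIV"
      "\<And>i j. i \<le> j \<Longrightarrow> j < n \<Longrightarrow> m $ (\<beta> i) \<le> m $ (\<beta> j)"
    using sorted_enumeration[of "\<lambda>i. m $ i"] unfolding n_def by blast
  have key: "l $ (\<alpha> k) - s \<le> m $ (\<beta> k)" if k: "k < n" for k
  proof -
    define T where "T = (\<lambda>j. \<xi> (\<alpha> j)) ` {..<k} \<union> (\<lambda>j. \<eta> (\<beta> j)) ` {k<..<n}"
    have "card T \<le> card {..<k} + card {k<..<n}"
      unfolding T_def by (intro order.trans[OF card_Un_le] add_mono card_image_le) auto
    then have "card T < n" using k by auto
    moreover have "dim T \<le> card T" by (rule dim_le_card') (simp add: T_def)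
    ultimately have "dim T < DIM(real ^ 'n)" by (simp add: n_def)
    then obtain v where v: "v \<noteq> 0" "\<And>y. y \<in> span T \<Longrightarrow> orthogonal v y"
      using orthogonal_to_subspace_exists by blast
    then have v1: "v \<bullet> \<xi> (\<alpha> j) = 0" if "j < k" for j
      using that span_base[of "\<xi> (\<alpha> j)" T] unfolding T_def orthogonal_def by auto
    from v have v2: "v \<bullet> \<eta> (\<beta> j) = 0" if "k < j" "j < n" for j
      using that span_base[of "\<eta> (\<beta> j)" T] unfolding T_def orthogonal_def by auto
    have "l $ (\<alpha> k) * (v \<bullet> v) = (\<Sum>i\<in>UNIV. l $ (\<alpha> k) * (v \<bullet> \<xi> i)\<^sup>2)"
      by (simp add: orthonormal_parseval[OF \<xi>(1), symmetric] sum_distrib_left)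
    also have "\<dots> \<le> Q1 v"
      unfolding \<xi>(2)
    proof (rule sum_mono)
      fix i :: 'n
      obtain j where j: "j < n" "i = \<alpha> j" using \<alpha>(1) unfolding bij_betw_def by blast
      show "l $ (\<alpha> k) * (v \<bullet> \<xi> i)\<^sup>2 \<le> l $ i * (v \<bullet> \<xi> i)\<^sup>2"
      proof (cases "j < k")
        case True then show ?thesis using v1 j by simp
      next
        case False then show ?thesis using \<alpha>(2)[of k j] j by (simp add: mult_right_mono)
      qed
    qed
    also have "\<dots> \<le> Q2 v + s * (v \<bullet> v)" by (rule le)
    also have "Q2 v \<le> (\<Sum>i\<in>UNIV. m $ (\<beta> k) * (v \<bullet> \<eta> i)\<^sup>2)"
      unfolding \<eta>(2)
    proof (rule sum_mono)
      fix i :: 'n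
      obtain j where j: "j < n" "i = \<beta> j" using \<beta>(1) unfolding bij_betw_def by blast
      show "m $ i * (v \<bullet> \<eta> i)\<^sup>2 \<le> m $ (\<beta> k) * (v \<bullet> \<eta> i)\<^sup>2"
      proof (cases "k < j")
        case True then show ?thesis using v2 j by simp
      next
        case False then show ?thesis using \<beta>(2)[of j k] j k by (simp add: mult_right_mono)
      qed
    qed
    also have "\<dots> = m $ (\<beta> k) * (v \<bullet> v)"
      by (simp add: orthonormal_parseval[OF \<eta>(1), symmetric] sum_distrib_left)
    finally have "(l $ (\<alpha> k) - s) * (v \<bullet> v) \<le> m $ (\<beta> k) * (v \<bullet> v)" by (simp add: algebra_simps)
    moreover have "v \<bullet> v > 0" using v(1) by simp
    ultimately show ?thesis by (simp add: mult_le_cancel_right)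
  qed
  define \<sigma> where "\<sigma> = \<beta> \<circ> inv_into {..<n} \<alpha>"
  have bij: "bij \<sigma>"
    unfolding \<sigma>_def using \<alpha>(1) \<beta>(1) by (metis bij_betw_inv_into bij_betw_trans)
  moreover have "l $ i - s \<le> m $ \<sigma> i" for i
  proof -
    obtain j where j: "j < n" "i = \<alpha> j" using \<alpha>(1) unfolding bij_betw_def by blast
    then have "\<sigma> i = \<beta> j" unfolding \<sigma>_def using \<alpha>(1) by (simp add: bij_betw_inv_into_left)
    then show ?thesis using key j by simp
  qed
  moreover have "\<sigma> permutes UNIV" using bij by (simp add: permutes_def bij_iff)
  ultimately show ?thesis using that by blast
qed

text \<open>The form of ellipticity used for the maximum principle.  After a permutation each eigenvalue drops
by at most \<open>s\<close>, while the sum of the eigenvalues rises by \<open>T\<close>; with all partial derivatives of \<open>f\<close>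
in \<open>[\<theta>, \<Theta>]\<close> the mean value theorem turns this into a gain of at least \<open>\<theta> T - n (\<Theta> - \<theta>) s\<close>.\<close>

lemma spectral_comparison:
  fixes f :: "real ^ 'n::finite \<Rightarrow> real"
  assumes sym: "symmetric_fun f"
    and m1: "0 < m1"
    and diff: "\<And>z. (\<forall>i. m1 \<le> z $ i \<and> z $ i \<le> m2) \<Longrightarrow> f differentiable (at z)"
    and bnd: "\<And>z i. (\<forall>i. m1 \<le> z $ i \<and> z $ i \<le> m2) \<Longrightarrow>
        \<theta> \<le> frechet_derivative f (at z) (axis i 1) \<and> frechet_derivative f (at z) (axis i 1) \<le> \<Theta>"
    and \<theta>: "0 < \<theta>" and s: "0 \<le> s"
    and Q1: "diag_form Q1 l" and Q2: "diag_form Q2 m"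
    and l: "\<And>i. m1 \<le> l $ i \<and> l $ i \<le> m2" and m: "\<And>i. m1 \<le> m $ i \<and> m $ i \<le> m2"
    and le: "\<And>v. Q1 v \<le> Q2 v + s * (v \<bullet> v)"
    and tr: "(\<Sum>i\<in>UNIV. Q1 (axis i 1)) + T \<le> (\<Sum>i\<in>UNIV. Q2 (axis i 1))"
    and gain: "real CARD('n) * \<Theta> * s < \<theta> * T"
  shows "f l < f m"
proof -
  obtain \<sigma> where \<sigma>: "\<sigma> permutes UNIV" "\<And>i. l $ i - s \<le> m $ \<sigma> i"
    using eigenvalue_domination[OF Q1 Q2 le] by blast
  define m' where "m' = (\<chi> i. m $ \<sigma> i)"
  have "m \<in> pos_cone" using m m1 unfolding pos_cone_def by (auto intro: less_le_trans)
  then have fm: "f m' = f m" using sym \<sigma>(1) unfolding symmetric_fun_def m'_def by blast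
  define D where "D = (\<lambda>z. frechet_derivative f (at z))"
  have seg: "\<forall>i. m1 \<le> (l + t *\<^sub>R (m' - l)) $ i \<and> (l + t *\<^sub>R (m' - l)) $ i \<le> m2"
    if t: "0 \<le> t" "t \<le> 1" for t
  proof
    fix i
    have "l $ i + t * (m' $ i - l $ i) = (1 - t) * l $ i + t * m' $ i" by (simp add: algebra_simps)
    moreover have "m1 \<le> m' $ i" "m' $ i \<le> m2" using m by (auto simp: m'_def)
    moreover have "(1 - t) * m1 + t * m1 = m1" "(1 - t) * m2 + t * m2 = m2" by (simp_all add: algebra_simps)
    moreover have "(1 - t) * m1 \<le> (1 - t) * l $ i" "t * m1 \<le> t * m' $ i"
        "(1 - t) * l $ i \<le> (1 - t) * m2" "t * m' $ i \<le> t * m2"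
      using t l[of i] calculation(2,3) by (auto intro!: mult_left_mono)
    ultimately show "m1 \<le> (l + t *\<^sub>R (m' - l)) $ i \<and> (l + t *\<^sub>R (m' - l)) $ i \<le> m2"
      by simp
  qed
  define g where "g = (\<lambda>t. f (l + t *\<^sub>R (m' - l)))"
  have dg: "(g has_real_derivative D (l + t *\<^sub>R (m' - l)) (m' - l)) (at t)"
    if t: "0 \<le> t" "t \<le> 1" for t
  proof -
    have "(f has_derivative D (l + t *\<^sub>R (m' - l))) (at (l + t *\<^sub>R (m' - l)))"
      unfolding D_def using diff[OF seg[OF t]] frechet_derivative_works by blast
    moreover have "((\<lambda>t. l + t *\<^sub>R (m' - l)) has_derivative (\<lambda>h. h *\<^sub>R (m' - l))) (at t)"
      by (auto intro!: derivative_eq_intros)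
    ultimately have gd: "(g has_derivative (\<lambda>h. D (l + t *\<^sub>R (m' - l)) (h *\<^sub>R (m' - l)))) (at t)"
      unfolding g_def
      using has_derivative_compose[of "\<lambda>t. l + t *\<^sub>R (m' - l)" "\<lambda>h. h *\<^sub>R (m' - l)" t UNIV f]
      by simp
    have "linear (D (l + t *\<^sub>R (m' - l)))"
      unfolding D_def using diff[OF seg[OF t]] linear_frechet_derivative by blast
    then have "(\<lambda>h. D (l + t *\<^sub>R (m' - l)) (h *\<^sub>R (m' - l))) = (*) (D (l + t *\<^sub>R (m' - l)) (m' - l))"
      by (auto simp: linear_cmul fun_eq_iff)
    then show ?thesis using gd unfolding has_field_derivative_def by simp
  qed
  have "\<exists>t. 0 < t \<and> t < 1 \<and> g 1 - g 0 = (1 - 0) * D (l + t *\<^sub>R (m' - l)) (m' - l)"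
    using dg by (intro MVT2) auto
  then obtain t where t: "0 < t" "t < 1" "g 1 - g 0 = D (l + t *\<^sub>R (m' - l)) (m' - l)"
    by auto
  define z where "z = l + t *\<^sub>R (m' - l)"
  have z: "\<forall>i. m1 \<le> z $ i \<and> z $ i \<le> m2" unfolding z_def using seg t by simp
  have lin: "linear (D z)" unfolding D_def using diff[OF z] linear_frechet_derivative by blast
  have "f m' - f l = D z (m' - l)" using t unfolding g_def z_def by simp
  also have "\<dots> = D z (\<Sum>i\<in>UNIV. (m' $ i - l $ i) *\<^sub>R axis i 1)"
    using basis_expansion[of "m' - l"] by (simp add: scalar_mult_eq_scaleR)
  also have "\<dots> = (\<Sum>i\<in>UNIV. (m' $ i - l $ i) * D z (axis i 1))"
    by (simp add: linear_sum[OF lin] linear_cmul[OF lin])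
  also have "\<dots> \<ge> (\<Sum>i\<in>UNIV. \<theta> * (m' $ i - l $ i) - (\<Theta> - \<theta>) * s)"
  proof (rule sum_mono)
    fix i
    define \<delta> where "\<delta> = m' $ i - l $ i"
    have d: "- s \<le> \<delta>" using \<sigma>(2)[of i] by (simp add: \<delta>_def m'_def)
    have b: "\<theta> \<le> D z (axis i 1)" "D z (axis i 1) \<le> \<Theta>" unfolding D_def using bnd[OF z] by auto
    have "\<theta> * \<delta> - (\<Theta> - \<theta>) * s \<le> \<delta> * D z (axis i 1)"
    proof (cases "\<delta> \<ge> 0")
      case True
      then have "\<theta> * \<delta> \<le> D z (axis i 1) * \<delta>" using b by (intro mult_right_mono)
      moreover have "(\<Theta> - \<theta>) * s \<ge> 0" using b s by simp
      ultimately show ?thesis by (simp add: mult.commute)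
    next
      case False
      have "(D z (axis i 1) - \<theta>) * (- \<delta>) \<le> (\<Theta> - \<theta>) * s"
        using b d False by (intro mult_mono) auto
      then show ?thesis by (simp add: algebra_simps)
    qed
    then show "\<theta> * (m' $ i - l $ i) - (\<Theta> - \<theta>) * s \<le> (m' $ i - l $ i) * D z (axis i 1)"
      by (simp add: \<delta>_def)
  qed
  finally have "(\<Sum>i\<in>UNIV. \<theta> * (m' $ i - l $ i) - (\<Theta> - \<theta>) * s) \<le> f m' - f l" .
  moreover have "(\<Sum>i\<in>UNIV. \<theta> * (m' $ i - l $ i) - (\<Theta> - \<theta>) * s)
      = \<theta> * ((\<Sum>i\<in>UNIV. m' $ i) - (\<Sum>i\<in>UNIV. l $ i)) - real CARD('n) * ((\<Theta> - \<theta>) * s)"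
    by (simp add: sum_subtractf sum_distrib_left right_diff_distrib)
  moreover have sum': "(\<Sum>i\<in>UNIV. m' $ i) = (\<Sum>i\<in>UNIV. m $ i)"
    unfolding m'_def using sum.permute[OF \<sigma>(1), of "\<lambda>i. m $ i"] by (simp add: o_def)
  moreover have "T \<le> (\<Sum>i\<in>UNIV. m $ i) - (\<Sum>i\<in>UNIV. l $ i)"
    using tr diag_form_trace[OF Q1] diag_form_trace[OF Q2] by simp
  then have "\<theta> * T \<le> \<theta> * ((\<Sum>i\<in>UNIV. m' $ i) - (\<Sum>i\<in>UNIV. l $ i))"
    using \<theta> sum' by (simp add: mult_left_mono)
  moreover have "real CARD('n) * ((\<Theta> - \<theta>) * s) \<le> real CARD('n) * \<Theta> * s"
    using \<theta> s by (simp add: algebra_simps)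
  ultimately show ?thesis using gain fm by linarith
qed

section \<open>The curvature form of a graph\<close>

text \<open>For the graph \<open>y = u(x)\<close> in the half-space model with outward normal pointing down and gradient
\<open>p\<close>, the map \<open>gframe p\<close> is the inverse square root of the Euclidean first fundamental form
\<open>I + p p\<^sup>T\<close>, and \<open>graph_form\<close> is the hyperbolic second fundamental form minus the metric,
written in the orthonormal frame that \<open>gframe p\<close> provides.  Its eigenvalues are therefore the
shifted curvatures \<open>\<kappa>\<^sub>i - 1\<close>; using one fixed inner product for all graphs is what makes two of
them comparable.\<close>

definition slope :: "'a::real_inner \<Rightarrow> real" where
  "slope p = sqrt (1 + p \<bullet> p)"

definition gframe :: "'a::real_inner \<Rightarrow> 'a \<Rightarrow> 'a" where
  "gframe p v = v - ((p \<bullet> v) / (slope p * (1 + slope p))) *\<^sub>R p"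

definition graph_form :: "real \<Rightarrow> 'a::real_inner \<Rightarrow> ('a \<Rightarrow> 'a) \<Rightarrow> 'a \<Rightarrow> real" where
  "graph_form y p X v =
     y / slope p * (X (gframe p v) \<bullet> gframe p v) + (1 / slope p - 1) * (v \<bullet> v)"

lemma slope_ge_1: "1 \<le> slope p"
  by (simp add: slope_def)

lemma slope_pos: "0 < slope p"
  using slope_ge_1[of p] by linarith

lemma slope_square: "(slope p)\<^sup>2 = 1 + p \<bullet> p"
  by (simp add: slope_def)

lemma slope_le: "slope p \<le> 1 + norm p"
proof -
  have "(slope p)\<^sup>2 \<le> (1 + norm p)\<^sup>2"
    unfolding slope_square power2_norm_eq_inner[symmetric] by (simp add: power2_eq_square algebra_simps)
  then show ?thesis by (rule power2_le_imp_le) simp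
qed

text \<open>The slope is the Euclidean norm of \<open>(p, 1)\<close>.\<close>

lemma slope_lipschitz: "\<bar>slope p - slope q\<bar> \<le> norm (p - q)"
proof -
  have "slope r = norm (r, 1::real)" for r :: 'a
    by (simp add: slope_def norm_prod_def power2_norm_eq_inner add.commute)
  moreover have "norm ((p, 1::real) - (q, 1::real)) = norm (p - q)"
    by (simp add: norm_prod_def)
  ultimately show ?thesis using norm_triangle_ineq3[of "(p, 1::real)" "(q, 1::real)"] by metis
qed

lemma inverse_slope_lipschitz:
  assumes k: "0 \<le> k"
  shows "\<bar>1 / (k + slope p) - 1 / (k + slope q)\<bar> \<le> norm (p - q)"
proof -
  have kp: "1 \<le> k + slope r" for r :: 'a using k slope_ge_1[of r] by linarith
  have "1 / (k + slope p) - 1 / (k + slope q) = (slope q - slope p) / ((k + slope p) * (k + slope q))"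
    using kp[of p] kp[of q] by (simp add: field_simps)
  moreover have "\<bar>(slope q - slope p) / ((k + slope p) * (k + slope q))\<bar> \<le> \<bar>slope q - slope p\<bar>"
  proof -
    have "1 \<le> (k + slope p) * (k + slope q)" 
      using mult_mono[of 1 "k + slope p" 1 "k + slope q"] kp[of p] kp[of q] by simp
    then have "\<bar>slope q - slope p\<bar> / ((k + slope p) * (k + slope q)) \<le> \<bar>slope q - slope p\<bar> / 1"
      by (intro divide_left_mono) auto
    then show ?thesis using \<open>1 \<le> (k + slope p) * (k + slope q)\<close> by simp
  qed
  ultimately show ?thesis using slope_lipschitz[of q p] by (simp add: norm_minus_commute)
qed

lemma linear_gframe: "linear (gframe p)"
  unfolding gframe_def
  by (rule linearI) (auto simp: inner_add_right add_divide_distrib algebra_simps)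

lemma gframe_symmetric: "gframe p v \<bullet> w = v \<bullet> gframe p w"
  by (simp add: gframe_def inner_diff_left inner_diff_right inner_commute)

lemma inner_gframe: "p \<bullet> gframe p v = (p \<bullet> v) / slope p"
proof -
  have pp: "p \<bullet> p = (slope p - 1) * (slope p + 1)"
    using slope_square[of p] by (simp add: power2_eq_square algebra_simps)
  have "p \<bullet> gframe p v = (p \<bullet> v) - (p \<bullet> v) / (slope p * (1 + slope p)) * (p \<bullet> p)"
    by (simp add: gframe_def inner_diff_right)
  also have "\<dots> = (p \<bullet> v) / slope p"
  proof -
    have "t - t / (S * (1 + S)) * ((S - 1) * (S + 1)) = t / S" if "0 < S" for t S :: real
      using that by (simp add: divide_simps) algebra
    then show ?thesis unfolding pp using slope_pos by blast
  qed
  finally show ?thesis .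
qed

lemma gframe_orthonormal:
  "gframe p v \<bullet> gframe p w + (p \<bullet> gframe p v) * (p \<bullet> gframe p w) = v \<bullet> w"
proof -
  have "gframe p v \<bullet> gframe p w
      = v \<bullet> gframe p w - (p \<bullet> v) / (slope p * (1 + slope p)) * (p \<bullet> gframe p w)"
    by (simp add: gframe_def[of p v] inner_diff_left)
  also have "v \<bullet> gframe p w = v \<bullet> w - (p \<bullet> w) / (slope p * (1 + slope p)) * (p \<bullet> v)"
    by (simp add: gframe_def inner_diff_right inner_commute)
  finally have "gframe p v \<bullet> gframe p w = v \<bullet> w - (p \<bullet> w) / (slope p * (1 + slope p)) * (p \<bullet> v)
      - (p \<bullet> v) / (slope p * (1 + slope p)) * ((p \<bullet> w) / slope p)"
    unfolding inner_gframe .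
  moreover have "c - b / (S * (1 + S)) * a - a / (S * (1 + S)) * (b / S) + (a / S) * (b / S) = c"
    if "0 < S" for a b c S :: real
    using that by (simp add: divide_simps) algebra
  ultimately show ?thesis
    unfolding inner_gframe using slope_pos[of p] by metis
qed

lemma norm_gframe_le: "norm (gframe p v) \<le> norm v"
proof -
  have "(norm (gframe p v))\<^sup>2 \<le> (norm v)\<^sup>2"
    unfolding power2_norm_eq_inner using gframe_orthonormal[of p v v]
    by (metis le_add_same_cancel1 zero_le_square)
  then show ?thesis by (rule power2_le_imp_le) simp
qed

lemma norm_gframe_ge: "norm v \<le> slope p * norm (gframe p v)"
proof -
  have "(p \<bullet> gframe p v)\<^sup>2 \<le> (p \<bullet> p) * (gframe p v \<bullet> gframe p v)" by (rule Cauchy_Schwarz_ineq)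
  then have "(norm v)\<^sup>2 \<le> (slope p * norm (gframe p v))\<^sup>2"
    unfolding power_mult_distrib slope_square power2_norm_eq_inner
    using gframe_orthonormal[of p v v] by (simp add: power2_eq_square algebra_simps)
  then show ?thesis by (rule power2_le_imp_le) (simp add: less_imp_le[OF slope_pos])
qed

lemma gframe_lipschitz:
  assumes "norm p \<le> B" "norm q \<le> B"
  shows "norm (gframe p v - gframe q v) \<le> (2 * B\<^sup>2 + 2 * B) * norm (p - q) * norm v"
proof -
  define c where "c = (\<lambda>r::'a. 1 / slope r - 1 / (1 + slope r))"
  have c: "1 / (slope r * (1 + slope r)) = c r" for r :: 'a
    using slope_pos[of r] by (simp add: c_def field_simps)
  have c01: "0 \<le> c r" "c r \<le> 1" for r :: 'a
  proof -
    show "0 \<le> c r" using slope_ge_1[of r] by (simp add: c_def field_simps)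
    have "1 / slope r \<le> 1" "0 \<le> 1 / (1 + slope r)" using slope_ge_1[of r] by simp_all
    then show "c r \<le> 1" unfolding c_def by linarith
  qed
  have cl: "\<bar>c q - c p\<bar> \<le> 2 * norm (p - q)"
    using inverse_slope_lipschitz[of 0 p q] inverse_slope_lipschitz[of 1 p q] unfolding c_def by simp
  have g: "gframe r v = v - (c r * (r \<bullet> v)) *\<^sub>R r" for r
    by (simp add: gframe_def c[symmetric])
  have B: "0 \<le> B" using assms norm_ge_zero order_trans by blast
  have "gframe p v - gframe q v
      = ((c q - c p) * (q \<bullet> v)) *\<^sub>R q + (c p * ((q - p) \<bullet> v)) *\<^sub>R q + (c p * (p \<bullet> v)) *\<^sub>R (q - p)"
    unfolding g by (simp add: algebra_simps inner_diff_left)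
  also have "norm \<dots> \<le> \<bar>c q - c p\<bar> * \<bar>q \<bullet> v\<bar> * norm q + c p * \<bar>(q - p) \<bullet> v\<bar> * norm q
      + c p * \<bar>p \<bullet> v\<bar> * norm (q - p)"
    using c01 by (intro order.trans[OF norm_triangle_ineq] add_mono)
      (auto simp: abs_mult)
  also have "\<dots> \<le> (2 * norm (p - q)) * (B * norm v) * B + 1 * (norm (p - q) * norm v) * B
      + 1 * (B * norm v) * norm (p - q)"
  proof (intro add_mono mult_mono)
    show "\<bar>q \<bullet> v\<bar> \<le> B * norm v" "\<bar>p \<bullet> v\<bar> \<le> B * norm v"
      using assms Cauchy_Schwarz_ineq2[of _ v] by (meson mult_right_mono norm_ge_zero order_trans)+
    show "\<bar>(q - p) \<bullet> v\<bar> \<le> norm (p - q) * norm v"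
      using Cauchy_Schwarz_ineq2[of "q - p" v] by (simp add: norm_minus_commute)
  qed (use assms c01 cl B in \<open>auto simp: norm_minus_commute\<close>)
  also have "\<dots> = (2 * B\<^sup>2 + 2 * B) * norm (p - q) * norm v"
    by (simp add: power2_eq_square algebra_simps)
  finally show ?thesis .
qed

lemma graph_form_lipschitz:
  assumes p: "norm p \<le> B" "norm q \<le> B" and y: "0 \<le> y" "0 \<le> z" "z \<le> B"
    and X: "linear X" "\<And>v. norm (X v) \<le> N * norm v" and N: "0 \<le> N"
  shows "\<bar>graph_form y p X v - graph_form z q X v\<bar>
      \<le> (N + B * N + 2 * B * N * (2 * B\<^sup>2 + 2 * B) + 1) * (\<bar>y - z\<bar> + norm (p - q)) * (v \<bullet> v)"
proof -
  have isl: "\<bar>1 / slope p - 1 / slope q\<bar> \<le> norm (p - q)" using inverse_slope_lipschitz[of 0 p q] by simp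
  define L where "L = 2 * B\<^sup>2 + 2 * B"
  define d where "d = \<bar>y - z\<bar> + norm (p - q)"
  define a where "a = gframe p v"
  define b where "b = gframe q v"
  define n where "n = norm v"
  have B: "0 \<le> B" using p norm_ge_zero order_trans by blast
  have n: "0 \<le> n" "n * n = v \<bullet> v" by (simp_all add: n_def power2_norm_eq_inner[symmetric] power2_eq_square)
  have an: "norm a \<le> n" "norm b \<le> n" unfolding a_def b_def n_def by (rule norm_gframe_le)+
  have L0: "0 \<le> L" unfolding L_def using B by simp
  have "norm (p - q) \<le> d" "0 \<le> d" unfolding d_def by auto
  then have ab: "norm (a - b) \<le> L * d * n"
    using gframe_lipschitz[OF p, of v] L0 n(1) unfolding a_def b_def L_def[symmetric] n_def
    by (meson mult_left_mono mult_right_mono order_trans norm_ge_zero)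
  have Xi: "\<bar>X r \<bullet> s\<bar> \<le> N * norm r * norm s" for r s
    using Cauchy_Schwarz_ineq2[of "X r" s] X(2)[of r] by (meson mult_right_mono norm_ge_zero order_trans)
  have s1: "\<bar>y / slope p - z / slope q\<bar> \<le> (1 + B) * d"
  proof -
    have "y / slope p - z / slope q = (y - z) * (1 / slope p) + z * (1 / slope p - 1 / slope q)"
      by (simp add: algebra_simps diff_divide_distrib)
    also have "\<bar>\<dots>\<bar> \<le> \<bar>y - z\<bar> * (1 / slope p) + z * \<bar>1 / slope p - 1 / slope q\<bar>"
      using y slope_pos[of p] by (intro order.trans[OF abs_triangle_ineq]) (simp add: abs_mult)
    also have "\<dots> \<le> \<bar>y - z\<bar> * 1 + B * norm (p - q)"
      using y isl slope_ge_1[of p] B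
      by (intro add_mono mult_mono) (auto simp: field_simps)
    also have "\<dots> \<le> (1 + B) * d"
      unfolding d_def using B by (simp add: algebra_simps)
    finally show ?thesis .
  qed
  have s2: "0 \<le> z / slope q" "z / slope q \<le> B"
  proof -
    show "0 \<le> z / slope q" using y slope_pos[of q] by simp
    have "z / slope q \<le> z / 1" using slope_ge_1[of q] y by (intro divide_left_mono) auto
    then show "z / slope q \<le> B" using y by simp
  qed
  have e: "X a \<bullet> a - X b \<bullet> b = X (a - b) \<bullet> a + X b \<bullet> (a - b)"
    by (simp add: linear_diff[OF X(1)] inner_diff_left inner_diff_right)
  have "graph_form y p X v - graph_form z q X v
      = (y / slope p - z / slope q) * (X a \<bullet> a) + z / slope q * (X a \<bullet> a - X b \<bullet> b)
        + (1 / slope p - 1 / slope q) * (v \<bullet> v)"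
    unfolding graph_form_def a_def[symmetric] b_def[symmetric] by (simp add: algebra_simps)
  also have "\<bar>\<dots>\<bar> \<le> \<bar>y / slope p - z / slope q\<bar> * \<bar>X a \<bullet> a\<bar>
      + z / slope q * \<bar>X (a - b) \<bullet> a + X b \<bullet> (a - b)\<bar> + \<bar>1 / slope p - 1 / slope q\<bar> * (v \<bullet> v)"
    unfolding e using s2(1) by (intro order.trans[OF abs_triangle_ineq] add_mono)
      (auto simp: abs_mult abs_of_nonneg[OF s2(1)] simp del: abs_divide times_divide_eq_left)
  also have "\<dots> \<le> ((1 + B) * d) * (N * n * n) + B * (N * (L * d * n) * n + N * n * (L * d * n))
      + d * (v \<bullet> v)"
  proof (intro add_mono mult_mono)
    have "N * norm a * norm a \<le> N * n * n" using an N n by (intro mult_mono) auto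
    then show "\<bar>X a \<bullet> a\<bar> \<le> N * n * n" using Xi[of a a] by linarith
    have "N * norm (a - b) * norm a \<le> N * (L * d * n) * n"
      "N * norm b * norm (a - b) \<le> N * n * (L * d * n)"
      using an ab N n L0 \<open>0 \<le> d\<close> by (auto intro!: mult_mono mult_nonneg_nonneg)
    then show "\<bar>X (a - b) \<bullet> a + X b \<bullet> (a - b)\<bar> \<le> N * (L * d * n) * n + N * n * (L * d * n)"
      using Xi[of "a - b" a] Xi[of b "a - b"] by linarith
    show "\<bar>1 / slope p - 1 / slope q\<bar> \<le> d"
      using isl unfolding d_def by linarith
    show "0 \<le> (1 + B) * d" unfolding d_def using B by simp
  qed (use s1 s2 B \<open>0 \<le> d\<close> in auto)
  also have "\<dots> = (N + B * N + 2 * B * N * L + 1) * d * (v \<bullet> v)"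
    unfolding n(2)[symmetric] by (simp add: algebra_simps)
  finally show ?thesis unfolding L_def d_def .
qed

text \<open>Along a line through the minimum the first derivative vanishes; were the second one negative, the
function would decrease to the right of the minimum.\<close>

lemma minimum_second_order:
  fixes g :: "'a::euclidean_space \<Rightarrow> real"
  assumes U: "open U" "x0 \<in> U"
    and dg: "\<And>x. x \<in> U \<Longrightarrow> (g has_derivative (\<lambda>h. G x \<bullet> h)) (at x)"
    and min: "\<And>x. x \<in> U \<Longrightarrow> g x0 \<le> g x"
  shows "G x0 = 0"
    and "(G has_derivative H) (at x0) \<Longrightarrow> 0 \<le> H v \<bullet> v"
proof -
  obtain e where e: "e > 0" "ball x0 e \<subseteq> U" using U openE by blast
  have "(\<lambda>h. G x0 \<bullet> h) = (\<lambda>h. 0)"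
  proof (rule differential_zero_maxmin[of x0 U g])
    show "(\<forall>y\<in>U. g y \<le> g x0) \<or> (\<forall>y\<in>U. g x0 \<le> g y)" using min by blast
  qed (use U dg in auto)
  then show G0: "G x0 = 0" by (metis inner_eq_zero_iff)
  assume H: "(G has_derivative H) (at x0)"
  define \<phi> where "\<phi> = (\<lambda>t. g (x0 + t *\<^sub>R v))"
  define d where "d = e / (norm v + 1)"
  have d: "d > 0" using e by (simp add: d_def add_nonneg_pos)
  have inU: "x0 + t *\<^sub>R v \<in> U" if "\<bar>t\<bar> < d" for t
  proof -
    have "\<bar>t\<bar> * norm v \<le> \<bar>t\<bar> * (norm v + 1)" by (simp add: mult_left_mono)
    also have "\<dots> < d * (norm v + 1)" using that by (intro mult_strict_right_mono) (auto simp: add_nonneg_pos)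
    also have "\<dots> = e" unfolding d_def by (smt (verit) nonzero_eq_divide_eq norm_ge_zero)
    finally show ?thesis using e by (auto simp: dist_norm subset_iff)
  qed
  have d\<phi>: "(\<phi> has_real_derivative G (x0 + t *\<^sub>R v) \<bullet> v) (at t)" if "\<bar>t\<bar> < d" for t
  proof -
    have "((\<lambda>t. x0 + t *\<^sub>R v) has_derivative (\<lambda>h. h *\<^sub>R v)) (at t)"
      by (auto intro!: derivative_eq_intros)
    from has_derivative_compose[OF this dg[OF inU[OF that]]]
    show ?thesis unfolding \<phi>_def has_field_derivative_def by (simp add: mult_commute_abs)
  qed
  have "((\<lambda>t. x0 + t *\<^sub>R v) has_derivative (\<lambda>h. h *\<^sub>R v)) (at 0)"
    by (auto intro!: derivative_eq_intros)
  moreover have "(G has_derivative H) (at (x0 + 0 *\<^sub>R v))" using H by simp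
  ultimately have "((\<lambda>t. G (x0 + t *\<^sub>R v)) has_derivative (\<lambda>h. H (h *\<^sub>R v))) (at 0)"
    by (rule has_derivative_compose)
  then have "((\<lambda>t. G (x0 + t *\<^sub>R v) \<bullet> v) has_derivative (\<lambda>h. H (h *\<^sub>R v) \<bullet> v)) (at 0)"
    by (rule has_derivative_inner_left)
  moreover have "(\<lambda>h. H (h *\<^sub>R v) \<bullet> v) = (*) (H v \<bullet> v)"
    using has_derivative_linear[OF H] by (auto simp: linear_cmul)
  ultimately have dd: "((\<lambda>t. G (x0 + t *\<^sub>R v) \<bullet> v) has_real_derivative (H v \<bullet> v)) (at 0)"
    unfolding has_field_derivative_def by simp
  show "0 \<le> H v \<bullet> v"
  proof (rule ccontr)
    assume "\<not> 0 \<le> H v \<bullet> v"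
    then obtain r where r: "r > 0" "\<And>h. 0 < h \<Longrightarrow> h < r \<Longrightarrow> G (x0 + h *\<^sub>R v) \<bullet> v < 0"
      using DERIV_neg_dec_right[OF dd] G0 by auto
    define t where "t = min d r / 2"
    have t: "0 < t" "t < d" "t < r" using d r by (auto simp: t_def)
    have "\<exists>z>0. z < t \<and> \<phi> t - \<phi> 0 = (t - 0) * (G (x0 + z *\<^sub>R v) \<bullet> v)"
      using t by (intro MVT2 d\<phi>) auto
    then obtain z where z: "0 < z" "z < t" "\<phi> t - \<phi> 0 = t * (G (x0 + z *\<^sub>R v) \<bullet> v)" by auto
    then have "t * (G (x0 + z *\<^sub>R v) \<bullet> v) < 0" using r(2)[of z] t by (simp add: mult_pos_neg)
    moreover have "\<phi> 0 \<le> \<phi> t" unfolding \<phi>_def using min[OF inU[of t]] t by simp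
    ultimately show False using z by linarith
  qed
qed

section \<open>Graphs of prescribed curvature\<close>

text \<open>The equation is stated pointwise through some eigenvalue vector in the positive cone, as this is
the form in which the principal curvatures deliver it.\<close>

definition graph_solution ::
  "(real ^ 'n::finite \<Rightarrow> real) \<Rightarrow> real \<Rightarrow> (real ^ 'n) set \<Rightarrow> (real ^ 'n \<Rightarrow> real) \<Rightarrow>
    (real ^ 'n \<Rightarrow> real ^ 'n) \<Rightarrow> (real ^ 'n \<Rightarrow> real ^ 'n \<Rightarrow> real ^ 'n) \<Rightarrow> bool" where
  "graph_solution f C U u G H \<longleftrightarrow> open U \<and>
     (\<forall>x\<in>U. (u has_derivative (\<lambda>h. G x \<bullet> h)) (at x) \<and> (G has_derivative H x) (at x) \<and> 0 < u x \<and>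
        (\<exists>l\<in>pos_cone. f l = C \<and> diag_form (graph_form (u x) (G x) (H x)) l)) \<and>
     (\<forall>v. continuous_on U (\<lambda>x. H x v))"

lemma graph_solutionD:
  assumes "graph_solution f C U u G H"
  shows "open U"
    and "x \<in> U \<Longrightarrow> (u has_derivative (\<lambda>h. G x \<bullet> h)) (at x)"
    and "x \<in> U \<Longrightarrow> (G has_derivative H x) (at x)"
    and "x \<in> U \<Longrightarrow> 0 < u x"
    and "x \<in> U \<Longrightarrow> \<exists>l\<in>pos_cone. f l = C \<and> diag_form (graph_form (u x) (G x) (H x)) l"
    and "continuous_on U u" and "continuous_on U G" and "continuous_on U (\<lambda>x. H x v)"
proof -
  have op: "open U" and ev: "\<forall>x\<in>U. (u has_derivative (\<lambda>h. G x \<bullet> h)) (at x) \<and>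
      (G has_derivative H x) (at x) \<and> 0 < u x \<and>
      (\<exists>l\<in>pos_cone. f l = C \<and> diag_form (graph_form (u x) (G x) (H x)) l)"
    and ct: "\<forall>v. continuous_on U (\<lambda>x. H x v)"
    using assms by (simp_all add: graph_solution_def)
  show "open U" by (rule op)
  show u: "(u has_derivative (\<lambda>h. G x \<bullet> h)) (at x)" if "x \<in> U" for x
    using bspec[OF ev that] by (rule conjunct1)
  have "(G has_derivative H x) (at x) \<and> 0 < u x \<and>
      (\<exists>l\<in>pos_cone. f l = C \<and> diag_form (graph_form (u x) (G x) (H x)) l)" if "x \<in> U" for x
    using bspec[OF ev that] by (rule conjunct2)
  note r = this
  show G: "(G has_derivative H x) (at x)" if "x \<in> U" for x using r[OF that] by (rule conjunct1)
  show "0 < u x" if "x \<in> U" using r[OF that] by simp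
  show "\<exists>l\<in>pos_cone. f l = C \<and> diag_form (graph_form (u x) (G x) (H x)) l" if "x \<in> U"
    using r[OF that] by simp
  show "continuous_on U (\<lambda>x. H x v)" using ct by simp
  show "continuous_on U u"
    by (intro continuous_at_imp_continuous_on ballI has_derivative_continuous[OF u])
  show "continuous_on U G"
    by (intro continuous_at_imp_continuous_on ballI has_derivative_continuous[OF G])
qed

lemma graph_solution_subset:
  assumes "graph_solution f C U u G H" "open V" "V \<subseteq> U"
  shows "graph_solution f C V u G H"
  using assms unfolding graph_solution_def by (auto intro: continuous_on_subset)

lemma hessian_continuous:
  assumes sol: "graph_solution f C U u G H"
  shows "continuous_on (U \<times> UNIV) (\<lambda>(x, v). H x v)"
proof -
  have "H x v = (\<Sum>b\<in>Basis. (v \<bullet> b) *\<^sub>R H x b)" if "x \<in> U" for x v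
  proof -
    have lin: "linear (H x)" using graph_solutionD(3)[OF sol that] by (rule has_derivative_linear)
    have "H x v = H x (\<Sum>b\<in>Basis. (v \<bullet> b) *\<^sub>R b)" by (simp only: euclidean_representation)
    then show ?thesis by (simp add: linear_sum[OF lin] linear_cmul[OF lin])
  qed
  moreover have "continuous_on (U \<times> UNIV) (\<lambda>z. \<Sum>b\<in>Basis. (snd z \<bullet> b) *\<^sub>R H (fst z) b)"
  proof (intro continuous_intros)
    fix b :: "real ^ 'a"
    show "continuous_on (U \<times> UNIV) (\<lambda>z. H (fst z) b)"
      by (rule continuous_on_compose2[OF graph_solutionD(8)[OF sol, of b] continuous_on_fst[OF continuous_on_id]]) auto
  qed
  ultimately show ?thesis
    by (subst continuous_on_cong[OF refl, where g = "\<lambda>z. \<Sum>b\<in>Basis. (snd z \<bullet> b) *\<^sub>R H (fst z) b"])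
      (auto simp: case_prod_unfold)
qed

lemma hessian_bounded:
  assumes sol: "graph_solution f C U u G H" and K: "compact K" "K \<subseteq> U"
  obtains N where "0 \<le> N" "\<And>x v. x \<in> K \<Longrightarrow> norm (H x v) \<le> N * norm v"
proof -
  have "continuous_on (K \<times> sphere 0 1) (\<lambda>(x, v). H x v)"
    by (rule continuous_on_subset[OF hessian_continuous[OF sol]]) (use K in auto)
  then have "compact ((\<lambda>(x, v). H x v) ` (K \<times> sphere 0 1))"
    using K by (intro compact_continuous_image compact_Times) auto
  then obtain N where N: "0 < N" "\<And>y. y \<in> (\<lambda>(x, v). H x v) ` (K \<times> sphere 0 1) \<Longrightarrow> norm y \<le> N"
    using compact_imp_bounded bounded_pos by metis
  have "norm (H x v) \<le> N * norm v" if x: "x \<in> K" for x v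
  proof (cases "v = 0")
    case True
    have "linear (H x)" using graph_solutionD(3)[OF sol] x K(2) has_derivative_linear by (metis subsetD)
    then show ?thesis using True linear_0 by auto
  next
    case False
    have lin: "linear (H x)" using graph_solutionD(3)[OF sol] x K(2) has_derivative_linear by (metis subsetD)
    have "(x, (1 / norm v) *\<^sub>R v) \<in> K \<times> sphere 0 1" using x False by simp
    then have "norm (H x ((1 / norm v) *\<^sub>R v)) \<le> N" using N(2) by fast
    then show ?thesis using False by (simp add: linear_cmul[OF lin] field_simps)
  qed
  then show ?thesis using that[of N] N(1) by simp
qed

text \<open>The eigenvalues are values of the form on unit vectors, and the form is continuous and positive
on the compact unit sphere bundle over \<open>K\<close>.\<close>

lemma eigenvalue_bounds:
  assumes sol: "graph_solution f C U u G H" and K: "compact K" "K \<subseteq> U"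
  obtains m1 m2 where "0 < m1"
    "\<And>x l i. x \<in> K \<Longrightarrow> diag_form (graph_form (u x) (G x) (H x)) l \<Longrightarrow> m1 \<le> l $ i \<and> l $ i \<le> m2"
proof -
  define q where "q = (\<lambda>(x, v). graph_form (u x) (G x) (H x) v)"
  let ?D = "K \<times> sphere (0 :: real ^ 'a) 1"
  note c = continuous_on_subset[OF graph_solutionD(6)[OF sol] K(2)]
    continuous_on_subset[OF graph_solutionD(7)[OF sol] K(2)]
  have fstD: "continuous_on ?D fst" "fst ` ?D \<subseteq> K" by (auto intro!: continuous_intros)
  have cu: "continuous_on ?D (\<lambda>z. u (fst z))" "continuous_on ?D (\<lambda>z. G (fst z))"
    using continuous_on_compose2[OF c(1) fstD] continuous_on_compose2[OF c(2) fstD] by auto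
  have sl: "continuous_on ?D (\<lambda>z. slope (G (fst z)))"
    unfolding slope_def by (intro continuous_intros cu)
  have nz: "slope p \<noteq> 0" "1 + slope p \<noteq> 0" for p :: "real ^ 'a"
    using slope_pos[of p] by auto
  have gf: "continuous_on ?D (\<lambda>z. gframe (G (fst z)) (snd z))"
    unfolding gframe_def by (intro continuous_intros cu sl ballI) (simp add: nz)
  have "continuous_on ?D (\<lambda>z. H (fst z) (gframe (G (fst z)) (snd z)))"
  proof -
    have "continuous_on ?D (\<lambda>z. (\<lambda>(x, v). H x v) (fst z, gframe (G (fst z)) (snd z)))"
      by (rule continuous_on_compose2[OF hessian_continuous[OF sol]])
        (use K in \<open>auto intro!: continuous_intros gf\<close>)
    then show ?thesis by simp
  qed
  then have cq: "continuous_on ?D q"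
    unfolding q_def graph_form_def case_prod_unfold
    by (intro continuous_intros cu sl gf ballI) (simp_all add: nz)
  have cD: "compact ?D" using K by (intro compact_Times) auto
  have unit: "\<xi> i \<in> sphere 0 1" "graph_form (u x) (G x) (H x) (\<xi> i) = l $ i"
    if "orthonormal_family \<xi>"
      "\<And>v. graph_form (u x) (G x) (H x) v = (\<Sum>i\<in>UNIV. l $ i * (v \<bullet> \<xi> i)\<^sup>2)" for \<xi> x l i
  proof -
    show "\<xi> i \<in> sphere 0 1" using that(1) by (simp add: orthonormal_family_def norm_eq_sqrt_inner)
    have "(\<Sum>j\<in>UNIV. l $ j * (\<xi> i \<bullet> \<xi> j)\<^sup>2) = (\<Sum>j\<in>UNIV. if i = j then l $ j else 0)"
      using that(1) by (intro sum.cong) (auto simp: orthonormal_family_def)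
    then show "graph_form (u x) (G x) (H x) (\<xi> i) = l $ i" unfolding that(2) by simp
  qed
  have qpos: "0 < q z" if z: "z \<in> ?D" for z
  proof -
    obtain x v where xv: "z = (x, v)" "x \<in> K" "norm v = 1" using z by auto
    obtain l \<xi> where l: "l \<in> pos_cone" "orthonormal_family \<xi>"
      "\<And>v. graph_form (u x) (G x) (H x) v = (\<Sum>i\<in>UNIV. l $ i * (v \<bullet> \<xi> i)\<^sup>2)"
      using graph_solutionD(5)[OF sol, of x] xv(2) K unfolding diag_form_def by blast
    have "(\<Sum>i\<in>UNIV. l $ i * (v \<bullet> \<xi> i)\<^sup>2) \<noteq> 0"
    proof
      assume "(\<Sum>i\<in>UNIV. l $ i * (v \<bullet> \<xi> i)\<^sup>2) = 0"
      then have "\<forall>i\<in>UNIV. l $ i * (v \<bullet> \<xi> i)\<^sup>2 = 0"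
        using l(1) by (subst (asm) sum_nonneg_eq_0_iff) (auto simp: pos_cone_def less_imp_le)
      then have "\<And>i. (v \<bullet> \<xi> i)\<^sup>2 = 0" using l(1) unfolding pos_cone_def by (metis UNIV_I less_irrefl mem_Collect_eq mult_eq_0_iff)
      then have "v \<bullet> v = 0" using orthonormal_parseval[OF l(2), of v] by simp
      then show False using xv(3) by simp
    qed
    moreover have "(\<Sum>i\<in>UNIV. l $ i * (v \<bullet> \<xi> i)\<^sup>2) \<ge> 0"
      using l(1) by (intro sum_nonneg) (auto simp: pos_cone_def less_imp_le)
    ultimately show ?thesis unfolding xv(1) q_def using l(3) by simp
  qed
  show ?thesis
  proof (cases "?D = {}")
    case True
    then have "K = {}" by (auto simp: sphere_eq_empty)
    then show ?thesis using that[of 1 0] by auto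
  next
    case False
    obtain z1 where z1: "z1 \<in> ?D" "\<And>z. z \<in> ?D \<Longrightarrow> q z1 \<le> q z"
      using continuous_attains_inf[OF cD False cq] by blast
    obtain z2 where z2: "z2 \<in> ?D" "\<And>z. z \<in> ?D \<Longrightarrow> q z \<le> q z2"
      using continuous_attains_sup[OF cD False cq] by blast
    show ?thesis
    proof (rule that[of "q z1" "q z2"])
      show "0 < q z1" using qpos z1 by blast
      fix x l i assume x: "x \<in> K" and "diag_form (graph_form (u x) (G x) (H x)) l"
      then obtain \<xi> where \<xi>: "orthonormal_family \<xi>"
        "\<And>v. graph_form (u x) (G x) (H x) v = (\<Sum>i\<in>UNIV. l $ i * (v \<bullet> \<xi> i)\<^sup>2)"
        unfolding diag_form_def by blast
      have "(x, \<xi> i) \<in> ?D" "q (x, \<xi> i) = l $ i" using unit[OF \<xi>] x by (auto simp: q_def)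
      then show "q z1 \<le> l $ i \<and> l $ i \<le> q z2" using z1 z2 by metis
    qed
  qed
qed

lemma curvature_function_bounds:
  fixes f :: "real ^ 'n::finite \<Rightarrow> real"
  assumes sm: "smooth_on pos_cone f" and inc: "increasing_fun f" and m1: "0 < m1"
  obtains \<theta> \<Theta> where "0 < \<theta>"
    "\<And>z. (\<forall>i. m1 \<le> z $ i \<and> z $ i \<le> m2) \<Longrightarrow> f differentiable (at z)"
    "\<And>z i. (\<forall>i. m1 \<le> z $ i \<and> z $ i \<le> m2) \<Longrightarrow>
        \<theta> \<le> frechet_derivative f (at z) (axis i 1) \<and> frechet_derivative f (at z) (axis i 1) \<le> \<Theta>"
proof -
  define B0 where "B0 = cbox (\<chi> i. m1) ((\<chi> i. m2) :: real ^ 'n)"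
  have memB: "z \<in> B0 \<longleftrightarrow> (\<forall>i. m1 \<le> z $ i \<and> z $ i \<le> m2)" for z
    by (simp add: B0_def mem_box_cart)
  have sub: "B0 \<subseteq> pos_cone" using m1 memB unfolding pos_cone_def by (auto intro: less_le_trans)
  have C1: "Ck_on (Suc 0) pos_cone f" using sm unfolding smooth_on_def by blast
  then have d: "f differentiable (at z)" if "z \<in> B0" for z using that sub by auto
  have ex: "\<exists>t T. 0 < t \<and> (\<forall>z\<in>B0. t \<le> frechet_derivative f (at z) (axis i 1) \<and>
      frechet_derivative f (at z) (axis i 1) \<le> T)" for i
  proof (cases "B0 = {}")
    case True then show ?thesis by (auto intro: exI[of _ 1])
  next
    case False
    have cont: "continuous_on B0 (\<lambda>z. frechet_derivative f (at z) (axis i 1))"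
      using C1 sub by (auto intro: continuous_on_subset)
    have comp: "compact B0" unfolding B0_def by simp
    obtain a where a: "a \<in> B0" "\<forall>z\<in>B0. frechet_derivative f (at a) (axis i 1) \<le> frechet_derivative f (at z) (axis i 1)"
      using continuous_attains_inf[OF comp False cont] by blast
    obtain b where b: "b \<in> B0" "\<forall>z\<in>B0. frechet_derivative f (at z) (axis i 1) \<le> frechet_derivative f (at b) (axis i 1)"
      using continuous_attains_sup[OF comp False cont] by blast
    have "0 < frechet_derivative f (at a) (axis i 1)" using a sub inc unfolding increasing_fun_def by blast
    then show ?thesis using a b by blast
  qed
  obtain t T where tT: "\<And>i. 0 < t i" "\<And>i z. z \<in> B0 \<Longrightarrow> t i \<le> frechet_derivative f (at z) (axis i 1) \<and>
      frechet_derivative f (at z) (axis i 1) \<le> T i"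
    using ex by metis
  show ?thesis
  proof (rule that[of "Min (range t)" "Max (range T)"])
    show "0 < Min (range t)" using tT(1) by (subst Min_gr_iff) auto
    show "f differentiable (at z)" if "\<forall>i. m1 \<le> z $ i \<and> z $ i \<le> m2" for z
      using that d memB by blast
    show "Min (range t) \<le> frechet_derivative f (at z) (axis i 1) \<and>
        frechet_derivative f (at z) (axis i 1) \<le> Max (range T)"
      if "\<forall>i. m1 \<le> z $ i \<and> z $ i \<le> m2" for z i
    proof -
      have "Min (range t) \<le> t i" "T i \<le> Max (range T)" by (auto intro: Min_le Max_ge)
      moreover have "t i \<le> frechet_derivative f (at z) (axis i 1) \<and>
          frechet_derivative f (at z) (axis i 1) \<le> T i"
        using tT(2) that memB by blast
      ultimately show ?thesis by linarith
    qed
  qed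
qed

section \<open>Hopf's lemma and the strong maximum principle\<close>

text \<open>Hopf's barrier: positive in the ball of radius \<open>R\<close> about \<open>z\<close>, zero on its boundary, and for large
\<open>\<alpha>\<close> strongly convex in the radial direction away from the centre.\<close>

definition barrier :: "real \<Rightarrow> real \<Rightarrow> 'a::real_inner \<Rightarrow> 'a \<Rightarrow> real" where
  "barrier \<alpha> R z x = exp (- \<alpha> * ((x - z) \<bullet> (x - z))) - exp (- \<alpha> * R\<^sup>2)"

definition barrier_grad :: "real \<Rightarrow> 'a::real_inner \<Rightarrow> 'a \<Rightarrow> 'a" where
  "barrier_grad \<alpha> z x = (- 2 * \<alpha> * exp (- \<alpha> * ((x - z) \<bullet> (x - z)))) *\<^sub>R (x - z)"

definition barrier_hess :: "real \<Rightarrow> 'a::real_inner \<Rightarrow> 'a \<Rightarrow> 'a \<Rightarrow> 'a" where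
  "barrier_hess \<alpha> z x v = exp (- \<alpha> * ((x - z) \<bullet> (x - z))) *\<^sub>R
     ((4 * \<alpha>\<^sup>2 * ((x - z) \<bullet> v)) *\<^sub>R (x - z) - (2 * \<alpha>) *\<^sub>R v)"

lemma barrier_derivative:
  "(barrier \<alpha> R z has_derivative (\<lambda>h. barrier_grad \<alpha> z x \<bullet> h)) (at x)"
proof -
  have "((\<lambda>x. exp (- \<alpha> * ((x - z) \<bullet> (x - z))) - exp (- \<alpha> * R\<^sup>2)) has_derivative
      (\<lambda>h. exp (- \<alpha> * ((x - z) \<bullet> (x - z))) * (- \<alpha> * ((x - z) \<bullet> h + h \<bullet> (x - z))))) (at x)"
    by (auto intro!: derivative_eq_intros)
  then show ?thesis
    unfolding barrier_def[abs_def] barrier_grad_def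
    by (rule has_derivative_eq_rhs) (auto simp: fun_eq_iff inner_commute algebra_simps)
qed

lemma barrier_grad_derivative:
  "(barrier_grad \<alpha> z has_derivative barrier_hess \<alpha> z x) (at x)"
proof -
  have "((\<lambda>x. (- 2 * \<alpha> * exp (- \<alpha> * ((x - z) \<bullet> (x - z)))) *\<^sub>R (x - z)) has_derivative
      (\<lambda>h. (- 2 * \<alpha> * exp (- \<alpha> * ((x - z) \<bullet> (x - z)))) *\<^sub>R h +
        (- 2 * \<alpha> * (exp (- \<alpha> * ((x - z) \<bullet> (x - z))) * (- \<alpha> * ((x - z) \<bullet> h + h \<bullet> (x - z))))) *\<^sub>R (x - z))) (at x)"
    by (auto intro!: derivative_eq_intros)
  then show ?thesis
    unfolding barrier_hess_def[abs_def] barrier_grad_def[abs_def]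
    by (rule has_derivative_eq_rhs) (auto simp: fun_eq_iff inner_commute algebra_simps power2_eq_square)
qed

lemma barrier_hess_inner:
  "barrier_hess \<alpha> z x v \<bullet> v =
     exp (- \<alpha> * ((x - z) \<bullet> (x - z))) * (4 * \<alpha>\<^sup>2 * ((x - z) \<bullet> v)\<^sup>2 - 2 * \<alpha> * (v \<bullet> v))"
proof -
  define d where "d = x - z"
  show ?thesis
    unfolding barrier_hess_def d_def[symmetric]
    by (simp add: inner_diff_left power2_eq_square algebra_simps)
qed

text \<open>At an interior minimum of \<open>u - u' - \<epsilon> h\<close>, with \<open>h\<close> the barrier, where this difference is not
positive, all first order differences between \<open>u\<close> and \<open>u'\<close> are of size \<open>\<epsilon> \<alpha> e\<close>, with \<open>e\<close> the exponential
factor of \<open>h\<close>, and so are the losses in the form of \<open>u\<close> against that of \<open>u'\<close>; but the trace gains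
a multiple of \<open>\<epsilon> \<alpha>\<^sup>2 e\<close> from the radial second derivative.  For large \<open>\<alpha>\<close> this contradicts equality
of the two values of \<open>f\<close>.  Everything is linear in \<open>\<epsilon>\<close>, so that \<open>\<alpha>\<close> can be chosen before \<open>\<epsilon>\<close>.\<close>

lemma barrier_strict:
  fixes f :: "real ^ 'n::finite \<Rightarrow> real"
  assumes sm: "smooth_on pos_cone f" and sym: "symmetric_fun f" and inc: "increasing_fun f"
    and sol: "graph_solution f C U u G H" and sol': "graph_solution f C U u' G' H'"
    and R: "0 < R" "cball z R \<subseteq> U"
  obtains \<alpha> where "0 < \<alpha>"
    "\<And>x \<epsilon>. \<lbrakk>0 < \<epsilon>; R / 2 \<le> norm (x - z); norm (x - z) \<le> R; u' x \<le> u x;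
        u x - u' x \<le> \<epsilon> * barrier \<alpha> R z x; G x - G' x = \<epsilon> *\<^sub>R barrier_grad \<alpha> z x;
        \<And>v. \<epsilon> * (barrier_hess \<alpha> z x v \<bullet> v) \<le> (H x v - H' x v) \<bullet> v\<rbrakk> \<Longrightarrow> False"
proof -
  define K where "K = cball z R"
  have K: "compact K" "K \<subseteq> U" "K \<noteq> {}" using R by (auto simp: K_def)
  obtain B1 where B1: "\<And>x. x \<in> K \<Longrightarrow> norm (G x) \<le> B1"
    using compact_imp_bounded[OF compact_continuous_image[OF continuous_on_subset[OF graph_solutionD(7)[OF sol] K(2)] K(1)]]
    unfolding bounded_iff by auto
  obtain B2 where B2: "\<And>x. x \<in> K \<Longrightarrow> norm (G' x) \<le> B2"
    using compact_imp_bounded[OF compact_continuous_image[OF continuous_on_subset[OF graph_solutionD(7)[OF sol'] K(2)] K(1)]]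
    unfolding bounded_iff by auto
  obtain B3 where B3: "\<And>x. x \<in> K \<Longrightarrow> norm (u x) \<le> B3"
    using compact_imp_bounded[OF compact_continuous_image[OF continuous_on_subset[OF graph_solutionD(6)[OF sol] K(2)] K(1)]]
    unfolding bounded_iff by auto
  obtain B4 where B4: "\<And>x. x \<in> K \<Longrightarrow> norm (u' x) \<le> B4"
    using compact_imp_bounded[OF compact_continuous_image[OF continuous_on_subset[OF graph_solutionD(6)[OF sol'] K(2)] K(1)]]
    unfolding bounded_iff by auto
  define B where "B = max 1 (max (max B1 B2) (max B3 B4))"
  have B: "1 \<le> B" "\<And>x. x \<in> K \<Longrightarrow> norm (G x) \<le> B" "\<And>x. x \<in> K \<Longrightarrow> norm (G' x) \<le> B"
    "\<And>x. x \<in> K \<Longrightarrow> u x \<le> B" "\<And>x. x \<in> K \<Longrightarrow> u' x \<le> B"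
    using B1 B2 B3 B4 unfolding B_def by fastforce+
  obtain x1 where x1: "x1 \<in> K" "\<And>x. x \<in> K \<Longrightarrow> u x1 \<le> u x"
    using continuous_attains_inf[OF K(1,3) continuous_on_subset[OF graph_solutionD(6)[OF sol] K(2)]] by blast
  define c0 where "c0 = u x1"
  have c0: "0 < c0" "\<And>x. x \<in> K \<Longrightarrow> c0 \<le> u x"
    using x1 graph_solutionD(4)[OF sol] K unfolding c0_def by blast+
  obtain N where N: "0 \<le> N" "\<And>x v. x \<in> K \<Longrightarrow> norm (H' x v) \<le> N * norm v"
    using hessian_bounded[OF sol' K(1,2)] by blast
  obtain a1 a2 where a: "0 < a1"
    "\<And>x l i. x \<in> K \<Longrightarrow> diag_form (graph_form (u x) (G x) (H x)) l \<Longrightarrow> a1 \<le> l $ i \<and> l $ i \<le> a2"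
    using eigenvalue_bounds[OF sol K(1,2)] by blast
  obtain b1 b2 where b: "0 < b1"
    "\<And>x l i. x \<in> K \<Longrightarrow> diag_form (graph_form (u' x) (G' x) (H' x)) l \<Longrightarrow> b1 \<le> l $ i \<and> l $ i \<le> b2"
    using eigenvalue_bounds[OF sol' K(1,2)] by blast
  define m1 where "m1 = min a1 b1"
  define m2 where "m2 = max a2 b2"
  have m1: "0 < m1" using a b by (simp add: m1_def)
  obtain \<theta> \<Theta> where \<theta>: "0 < \<theta>"
    and fd: "\<And>z. (\<forall>i. m1 \<le> z $ i \<and> z $ i \<le> m2) \<Longrightarrow> f differentiable (at z)"
    and fb: "\<And>z i. (\<forall>i. m1 \<le> z $ i \<and> z $ i \<le> m2) \<Longrightarrow>
        \<theta> \<le> frechet_derivative f (at z) (axis i 1) \<and> frechet_derivative f (at z) (axis i 1) \<le> \<Theta>"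
    using curvature_function_bounds[OF sm inc m1] by metis
  define L where "L = N + B * N + 2 * B * N * (2 * B\<^sup>2 + 2 * B) + 1"
  have L: "0 < L" unfolding L_def using N B(1) by (simp add: add_nonneg_pos)
  define W where "W = 2 * B + L + 2 * L * R"
  have W: "0 < W" unfolding W_def using B L R by (simp add: add_pos_pos)
  define k where "k = 4 * (c0 / (1 + B)) * (R / (2 * (1 + B)))\<^sup>2"
  have k: "0 < k" unfolding k_def using c0 B R by (simp add: zero_less_power)
  \<comment> \<open>any larger value serves as well; \<open>k\<close> bounds the radial gain, \<open>W\<close> the losses\<close>
  define \<alpha> where "\<alpha> = max 1 ((real CARD('n) * W * \<bar>\<Theta>\<bar> + real CARD('n) * W * \<theta> + 1) / (\<theta> * k))"
  have \<alpha>: "1 \<le> \<alpha>" unfolding \<alpha>_def by simp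
  have "(real CARD('n) * W * \<bar>\<Theta>\<bar> + real CARD('n) * W * \<theta> + 1) / (\<theta> * k) \<le> \<alpha>" unfolding \<alpha>_def by simp
  then have \<alpha>k: "real CARD('n) * W * \<bar>\<Theta>\<bar> + real CARD('n) * W * \<theta> < \<theta> * (\<alpha> * k)"
    using \<theta> k by (simp add: field_simps)
  show ?thesis
  proof (rule that[of \<alpha>])
    show "0 < \<alpha>" using \<alpha> by simp
    fix x \<epsilon>
    assume \<epsilon>: "0 < \<epsilon>" and x: "R / 2 \<le> norm (x - z)" "norm (x - z) \<le> R"
      and w: "u' x \<le> u x" "u x - u' x \<le> \<epsilon> * barrier \<alpha> R z x"
      and g: "G x - G' x = \<epsilon> *\<^sub>R barrier_grad \<alpha> z x"
      and h: "\<And>v. \<epsilon> * (barrier_hess \<alpha> z x v \<bullet> v) \<le> (H x v - H' x v) \<bullet> v"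
    have xK: "x \<in> K" using x by (simp add: K_def dist_norm norm_minus_commute)
    define E where "E = exp (- \<alpha> * ((x - z) \<bullet> (x - z)))"
    have E: "0 < E" by (simp add: E_def)
    have xU: "x \<in> U" using xK K by blast
    have lin: "linear (H x)" "linear (H' x)"
      using graph_solutionD(3)[OF sol xU] graph_solutionD(3)[OF sol' xU] has_derivative_linear by blast+
    have upos: "0 < u x" "0 < u' x" using graph_solutionD(4)[OF sol xU] graph_solutionD(4)[OF sol' xU] .
    define P where "P = gframe (G x)"
    define y where "y = P (x - z)"
    define c where "c = u x / slope (G x)"
    have sB: "slope (G x) \<le> 1 + B" using slope_le[of "G x"] B(2)[OF xK] by linarith
    have c1: "c0 / (1 + B) \<le> c"
      unfolding c_def using sB c0 c0(2)[OF xK] slope_pos[of "G x"] by (intro frac_le) auto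
    have c2: "c \<le> B"
    proof -
      have "c \<le> u x / 1" unfolding c_def using upos slope_ge_1[of "G x"] by (intro divide_left_mono) auto
      then show ?thesis using B(4)[OF xK] by simp
    qed
    have c3: "0 < c" unfolding c_def using upos slope_pos[of "G x"] by simp
    have y: "R / (2 * (1 + B)) \<le> norm y"
    proof -
      have "R / 2 \<le> (1 + B) * norm y"
        using norm_gframe_ge[of "x - z" "G x"] x(1) sB unfolding y_def P_def
        by (meson mult_right_mono norm_ge_zero order_trans)
      then show ?thesis using B(1) by (simp add: field_simps)
    qed
    have dist1: "\<bar>u x - u' x\<bar> + norm (G x - G' x) \<le> \<epsilon> * E * (1 + 2 * \<alpha> * R)"
    proof -
      have "barrier \<alpha> R z x \<le> E" unfolding barrier_def E_def by simp
      then have "\<bar>u x - u' x\<bar> \<le> \<epsilon> * E" using w \<epsilon> mult_left_mono[of "barrier \<alpha> R z x" E \<epsilon>] by linarith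
      moreover have "norm (G x - G' x) = \<epsilon> * (2 * \<alpha> * E * norm (x - z))"
        unfolding g barrier_grad_def E_def using \<epsilon> \<alpha> by (simp add: abs_mult)
      then have "norm (G x - G' x) \<le> \<epsilon> * (2 * \<alpha> * E * R)"
        using x(2) \<epsilon> \<alpha> E by (simp add: mult_left_mono)
      ultimately show ?thesis by (simp add: algebra_simps)
    qed
    define s where "s = \<epsilon> * E * \<alpha> * W"
    have s: "0 \<le> s" unfolding s_def using \<epsilon> E \<alpha> W by simp
    \<comment> \<open>rank one gain in the direction \<open>y\<close>, loss \<open>s\<close> in all directions\<close>
    have main: "graph_form (u x) (G x) (H x) v - graph_form (u' x) (G' x) (H' x) v
        \<ge> 4 * \<epsilon> * E * \<alpha>\<^sup>2 * c * (y \<bullet> v)\<^sup>2 - s * (v \<bullet> v)" for v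
    proof -
      have "\<epsilon> * (barrier_hess \<alpha> z x (P v) \<bullet> P v) \<le> H x (P v) \<bullet> P v - H' x (P v) \<bullet> P v"
        using h[of "P v"] by (simp add: inner_diff_left)
      moreover have "barrier_hess \<alpha> z x (P v) \<bullet> P v = E * (4 * \<alpha>\<^sup>2 * (y \<bullet> v)\<^sup>2 - 2 * \<alpha> * (P v \<bullet> P v))"
        unfolding barrier_hess_inner E_def[symmetric] y_def P_def gframe_symmetric ..
      moreover have "P v \<bullet> P v \<le> v \<bullet> v"
        using norm_gframe_le[of "G x" v] unfolding P_def by (simp add: norm_le)
      then have "2 * \<alpha> * (P v \<bullet> P v) \<le> 2 * \<alpha> * (v \<bullet> v)" using \<alpha> by simp
      ultimately have "\<epsilon> * (E * (4 * \<alpha>\<^sup>2 * (y \<bullet> v)\<^sup>2 - 2 * \<alpha> * (v \<bullet> v))) \<le> H x (P v) \<bullet> P v - H' x (P v) \<bullet> P v"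
        using \<epsilon> E by (smt (verit) mult_left_mono)
      then have "c * (\<epsilon> * (E * (4 * \<alpha>\<^sup>2 * (y \<bullet> v)\<^sup>2 - 2 * \<alpha> * (v \<bullet> v))))
          \<le> c * (H x (P v) \<bullet> P v - H' x (P v) \<bullet> P v)"
        using c3 by (intro mult_left_mono) auto
      moreover have "graph_form (u x) (G x) (H x) v - graph_form (u x) (G x) (H' x) v
          = c * (H x (P v) \<bullet> P v - H' x (P v) \<bullet> P v)"
        unfolding graph_form_def c_def P_def by (simp add: algebra_simps)
      moreover have "\<bar>graph_form (u x) (G x) (H' x) v - graph_form (u' x) (G' x) (H' x) v\<bar>
          \<le> L * (\<bar>u x - u' x\<bar> + norm (G x - G' x)) * (v \<bullet> v)"
        unfolding L_def using B(2,3,5)[OF xK] upos N lin xK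
        by (intro graph_form_lipschitz) (auto simp: less_imp_le)
      moreover have "L * (\<bar>u x - u' x\<bar> + norm (G x - G' x)) * (v \<bullet> v) \<le> L * (\<epsilon> * E * (1 + 2 * \<alpha> * R)) * (v \<bullet> v)"
        using dist1 L by (intro mult_right_mono mult_left_mono) auto
      moreover have "2 * \<alpha> * c * \<epsilon> * E * (v \<bullet> v) + L * (\<epsilon> * E * (1 + 2 * \<alpha> * R)) * (v \<bullet> v) \<le> s * (v \<bullet> v)"
      proof -
        have "2 * \<alpha> * c + L * (1 + 2 * \<alpha> * R) \<le> \<alpha> * W"
        proof -
          have "2 * \<alpha> * c \<le> 2 * \<alpha> * B" "L \<le> L * \<alpha>" using c2 \<alpha> L by simp_all
          then show ?thesis unfolding W_def by (simp add: algebra_simps)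
        qed
        then have "(2 * \<alpha> * c + L * (1 + 2 * \<alpha> * R)) * (\<epsilon> * E * (v \<bullet> v)) \<le> (\<alpha> * W) * (\<epsilon> * E * (v \<bullet> v))"
          using \<epsilon> E by (intro mult_right_mono) auto
        then show ?thesis unfolding s_def by (simp add: algebra_simps)
      qed
      moreover have "c * (\<epsilon> * (E * (4 * \<alpha>\<^sup>2 * (y \<bullet> v)\<^sup>2 - 2 * \<alpha> * (v \<bullet> v))))
          = 4 * \<epsilon> * E * \<alpha>\<^sup>2 * c * (y \<bullet> v)\<^sup>2 - 2 * \<alpha> * c * \<epsilon> * E * (v \<bullet> v)" by (simp add: algebra_simps)
      ultimately show ?thesis by linarith
    qed
    define T where "T = 4 * \<epsilon> * E * \<alpha>\<^sup>2 * c * (y \<bullet> y) - real CARD('n) * s"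
    obtain l where l: "l \<in> pos_cone" "f l = C" "diag_form (graph_form (u' x) (G' x) (H' x)) l"
      using graph_solutionD(5)[OF sol' xU] by blast
    obtain m where m: "m \<in> pos_cone" "f m = C" "diag_form (graph_form (u x) (G x) (H x)) m"
      using graph_solutionD(5)[OF sol xU] by blast
    have "f l < f m"
    proof (rule spectral_comparison[OF sym m1 fd fb \<theta> s l(3) m(3)])
      show "m1 \<le> l $ i \<and> l $ i \<le> m2" for i using b(2)[OF xK l(3), of i] unfolding m1_def m2_def by auto
      show "m1 \<le> m $ i \<and> m $ i \<le> m2" for i using a(2)[OF xK m(3), of i] unfolding m1_def m2_def by auto
      show "graph_form (u' x) (G' x) (H' x) v \<le> graph_form (u x) (G x) (H x) v + s * (v \<bullet> v)" for v
      proof -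
        have "0 \<le> 4 * \<epsilon> * E * \<alpha>\<^sup>2 * c * (y \<bullet> v)\<^sup>2" using \<epsilon> E c3 by simp
        then show ?thesis using main[of v] by linarith
      qed
      show "(\<Sum>i\<in>UNIV. graph_form (u' x) (G' x) (H' x) (axis i 1)) + T
          \<le> (\<Sum>i\<in>UNIV. graph_form (u x) (G x) (H x) (axis i 1))"
      proof -
        have "(\<Sum>i\<in>UNIV. 4 * \<epsilon> * E * \<alpha>\<^sup>2 * c * (y \<bullet> axis i 1)\<^sup>2 - s * (axis i 1 \<bullet> (axis i 1 :: real ^ 'n)))
          \<le> (\<Sum>i\<in>UNIV. graph_form (u x) (G x) (H x) (axis i 1) - graph_form (u' x) (G' x) (H' x) (axis i 1))"
          by (intro sum_mono main)
        moreover have "(\<Sum>i\<in>UNIV. 4 * \<epsilon> * E * \<alpha>\<^sup>2 * c * (y \<bullet> axis i 1)\<^sup>2 - s * (axis i 1 \<bullet> (axis i 1 :: real ^ 'n))) = T"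
          unfolding T_def sum_subtractf sum_distrib_left[symmetric]
          by (simp add: inner_axis inner_axis_axis inner_vec_def[of y y] power2_eq_square)
        ultimately show ?thesis by (simp add: sum_subtractf)
      qed
      show "real CARD('n) * \<Theta> * s < \<theta> * T"
      proof -
        have "(R / (2 * (1 + B)))\<^sup>2 \<le> (norm y)\<^sup>2" using y R B by (intro power_mono) auto
        then have "(c0 / (1 + B)) * (R / (2 * (1 + B)))\<^sup>2 \<le> c * (y \<bullet> y)"
          unfolding power2_norm_eq_inner using c1 c3 c0 B by (intro mult_mono) auto
        then have kk: "k \<le> 4 * (c * (y \<bullet> y))" unfolding k_def by linarith
        have e: "0 < \<epsilon> * E * \<alpha>" using \<epsilon> E \<alpha> by simp
        have "\<theta> * (\<alpha> * k) \<le> \<theta> * (\<alpha> * (4 * (c * (y \<bullet> y))))"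
          using kk \<theta> \<alpha> by (intro mult_left_mono) auto
        then have "real CARD('n) * W * \<Theta> + real CARD('n) * W * \<theta> < \<theta> * (\<alpha> * (4 * (c * (y \<bullet> y))))"
        proof -
          have "real CARD('n) * W * \<Theta> \<le> real CARD('n) * W * \<bar>\<Theta>\<bar>" using W by (intro mult_left_mono) auto
          then show ?thesis using \<alpha>k \<open>\<theta> * (\<alpha> * k) \<le> _\<close> by linarith
        qed
        then have "(\<epsilon> * E * \<alpha>) * (real CARD('n) * W * \<Theta> + real CARD('n) * W * \<theta>)
            < (\<epsilon> * E * \<alpha>) * (\<theta> * (\<alpha> * (4 * (c * (y \<bullet> y)))))"
          using e mult_strict_left_mono by blast
        then show ?thesis unfolding T_def s_def by (simp add: algebra_simps power2_eq_square)
      qed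
    qed
    then show False using l m by simp
  qed
qed

text \<open>Hopf's boundary point lemma.  A small multiple \<open>\<epsilon> h\<close> of the barrier lies below \<open>u - u'\<close> on the inner
and outer boundary of the annulus \<open>R/2 \<le> |x - z| \<le> R\<close>, hence on all of it, since a negative interior minimum
is excluded by \<open>barrier_strict\<close>.  At \<open>b\<close> both functions vanish, and \<open>h\<close> grows at a positive rate
towards \<open>z\<close>.\<close>

lemma hopf_boundary_gradient:
  fixes f :: "real ^ 'n::finite \<Rightarrow> real"
  assumes sm: "smooth_on pos_cone f" and sym: "symmetric_fun f" and inc: "increasing_fun f"
    and sol: "graph_solution f C U u G H" and sol': "graph_solution f C U u' G' H'"
    and R: "0 < R" "cball z R \<subseteq> U"
    and b: "norm (b - z) = R" "u b = u' b"
    and above: "\<And>x. x \<in> cball z R - {b} \<Longrightarrow> u' x < u x"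
  shows "G b \<noteq> G' b"
proof
  assume Gb: "G b = G' b"
  obtain \<alpha> where \<alpha>: "0 < \<alpha>"
    "\<And>x \<epsilon>. \<lbrakk>0 < \<epsilon>; R / 2 \<le> norm (x - z); norm (x - z) \<le> R; u' x \<le> u x;
        u x - u' x \<le> \<epsilon> * barrier \<alpha> R z x; G x - G' x = \<epsilon> *\<^sub>R barrier_grad \<alpha> z x;
        \<And>v. \<epsilon> * (barrier_hess \<alpha> z x v \<bullet> v) \<le> (H x v - H' x v) \<bullet> v\<rbrakk> \<Longrightarrow> False"
    using barrier_strict[OF sm sym inc sol sol' R] by blast
  define h where "h = barrier \<alpha> R z"
  have hout: "h x = 0" if "norm (x - z) = R" for x
    using that by (simp add: h_def barrier_def power2_norm_eq_inner[symmetric])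
  have hle: "h x \<le> 1" for x
  proof -
    have "exp (- \<alpha> * ((x - z) \<bullet> (x - z))) \<le> 1" using \<alpha>(1) by simp
    moreover have "0 < exp (- \<alpha> * R\<^sup>2)" by simp
    ultimately show ?thesis unfolding h_def barrier_def by linarith
  qed
  have contu: "continuous_on (cball z R) u" "continuous_on (cball z R) u'"
    using graph_solutionD(6)[OF sol] graph_solutionD(6)[OF sol'] R continuous_on_subset by blast+
  obtain \<epsilon> where \<epsilon>: "0 < \<epsilon>" "\<And>x. norm (x - z) = R / 2 \<Longrightarrow> \<epsilon> \<le> u x - u' x"
  proof -
    have sub: "sphere z (R / 2) \<subseteq> cball z R" using R by auto
    have "continuous_on (sphere z (R / 2)) (\<lambda>x. u x - u' x)"
      using contu sub by (intro continuous_intros) (auto intro: continuous_on_subset)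
    moreover have ne: "sphere z (R / 2) \<noteq> {}" using R by simp
    ultimately obtain x1 where x1: "x1 \<in> sphere z (R / 2)"
        "\<And>x. x \<in> sphere z (R / 2) \<Longrightarrow> u x1 - u' x1 \<le> u x - u' x"
      using continuous_attains_inf[OF compact_sphere ne] by blast
    have "x1 \<noteq> b" using x1(1) b(1) R by (auto simp: dist_norm norm_minus_commute)
    then have "u' x1 < u x1" using above x1(1) sub by blast
    then show ?thesis using that[of "u x1 - u' x1"] x1(2) by (auto simp: dist_norm norm_minus_commute)
  qed
  define g where "g = (\<lambda>x. u x - u' x - \<epsilon> * h x)"
  define A where "A = {x. R / 2 \<le> norm (x - z) \<and> norm (x - z) \<le> R}"
  have A: "compact A" "A \<subseteq> cball z R" "b \<in> A"
  proof -
    have "A = cball z R - ball z (R / 2)" by (auto simp: A_def dist_norm norm_minus_commute)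
    then show "compact A" by (simp add: compact_diff)
    show "A \<subseteq> cball z R" by (auto simp: A_def dist_norm norm_minus_commute)
    show "b \<in> A" using b R by (simp add: A_def)
  qed
  have above': "u' x \<le> u x" if "x \<in> cball z R" for x
    using above[of x] b(2) that by (cases "x = b") auto
  have conth: "continuous_on S h" for S
    unfolding h_def barrier_def[abs_def] by (intro continuous_intros)
  have contg: "continuous_on A g"
    unfolding g_def using contu A(2) conth
    by (intro continuous_intros) (auto intro: continuous_on_subset)
  obtain x0 where x0: "x0 \<in> A" "\<And>x. x \<in> A \<Longrightarrow> g x0 \<le> g x"
    using continuous_attains_inf[OF A(1) _ contg] A(3) by blast
  have dg: "(g has_derivative (\<lambda>v. (G x - G' x - \<epsilon> *\<^sub>R barrier_grad \<alpha> z x) \<bullet> v)) (at x)"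
    if "x \<in> U" for x
  proof -
    have "(g has_derivative (\<lambda>v. G x \<bullet> v - G' x \<bullet> v - \<epsilon> * (barrier_grad \<alpha> z x \<bullet> v))) (at x)"
      unfolding g_def h_def
      by (intro has_derivative_diff has_derivative_mult_right barrier_derivative
          graph_solutionD(2)[OF sol that] graph_solutionD(2)[OF sol' that])
    then show ?thesis by (simp add: inner_diff_left)
  qed
  have "0 \<le> g x0"
  proof (rule ccontr)
    assume neg: "\<not> 0 \<le> g x0"
    have x0w: "u' x0 \<le> u x0" using above' x0(1) A(2) by blast
    have ne1: "norm (x0 - z) \<noteq> R"
      using hout[of x0] neg x0w unfolding g_def by auto
    have ne2: "norm (x0 - z) \<noteq> R / 2"
    proof
      assume "norm (x0 - z) = R / 2"
      then have "\<epsilon> * h x0 \<le> u x0 - u' x0"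
        using \<epsilon>(2)[of x0] mult_left_mono[OF hle[of x0], of \<epsilon>] \<epsilon>(1) by linarith
      then show False using neg unfolding g_def by simp
    qed
    define V where "V = {x. R / 2 < norm (x - z) \<and> norm (x - z) < R}"
    have "V = ball z R - cball z (R / 2)" by (auto simp: V_def dist_norm norm_minus_commute)
    then have V: "open V" by (simp add: open_Diff)
    have VA: "V \<subseteq> A" unfolding V_def A_def by auto
    then have VU: "V \<subseteq> U" using A R by blast
    have x0V: "x0 \<in> V" using x0(1) ne1 ne2 unfolding V_def A_def by auto
    have dgr: "((\<lambda>x. G x - G' x - \<epsilon> *\<^sub>R barrier_grad \<alpha> z x) has_derivative
        (\<lambda>v. H x0 v - H' x0 v - \<epsilon> *\<^sub>R barrier_hess \<alpha> z x0 v)) (at x0)"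
      using x0V VU graph_solutionD(3)[OF sol] graph_solutionD(3)[OF sol']
      by (intro has_derivative_diff has_derivative_scaleR_right barrier_grad_derivative) blast+
    have m: "g x0 \<le> g x" if "x \<in> V" for x using x0(2) that VA by blast
    have d: "(g has_derivative (\<lambda>v. (G x - G' x - \<epsilon> *\<^sub>R barrier_grad \<alpha> z x) \<bullet> v)) (at x)"
      if "x \<in> V" for x using dg that VU by blast
    note crit = minimum_second_order(1)[OF V x0V d m]
    note hess = minimum_second_order(2)[OF V x0V d m dgr]
    show False
    proof (rule \<alpha>(2)[OF \<epsilon>(1), of x0])
      show "R / 2 \<le> norm (x0 - z)" "norm (x0 - z) \<le> R" using x0(1) unfolding A_def by auto
      show "u' x0 \<le> u x0" by (rule x0w)
      show "u x0 - u' x0 \<le> \<epsilon> * barrier \<alpha> R z x0" using neg unfolding g_def h_def by simp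
      show "G x0 - G' x0 = \<epsilon> *\<^sub>R barrier_grad \<alpha> z x0" using crit by simp
      show "\<epsilon> * (barrier_hess \<alpha> z x0 v \<bullet> v) \<le> (H x0 v - H' x0 v) \<bullet> v" for v
        using hess[of v] by (simp add: inner_diff_left)
    qed
  qed
  then have gpos: "0 \<le> g x" if "x \<in> A" for x using x0(2)[OF that] by linarith
  have gb: "g b = 0" using b hout unfolding g_def by simp
  define \<phi> where "\<phi> = (\<lambda>t. g (b + t *\<^sub>R (z - b)))"
  have bU: "b \<in> U" using A R by blast
  have "((\<lambda>t. b + t *\<^sub>R (z - b)) has_derivative (\<lambda>h. h *\<^sub>R (z - b))) (at 0)"
    by (auto intro!: derivative_eq_intros)
  moreover have "(g has_derivative (\<lambda>v. (- \<epsilon> *\<^sub>R barrier_grad \<alpha> z b) \<bullet> v)) (at (b + 0 *\<^sub>R (z - b)))"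
    using dg[OF bU] Gb by simp
  ultimately have "(\<phi> has_derivative (\<lambda>h. (- \<epsilon> *\<^sub>R barrier_grad \<alpha> z b) \<bullet> (h *\<^sub>R (z - b)))) (at 0)"
    unfolding \<phi>_def by (rule has_derivative_compose)
  then have d\<phi>: "(\<phi> has_real_derivative ((- \<epsilon> *\<^sub>R barrier_grad \<alpha> z b) \<bullet> (z - b))) (at 0)"
    unfolding has_field_derivative_def by (rule has_derivative_eq_rhs) (auto simp: mult.commute)
  have "(- \<epsilon> *\<^sub>R barrier_grad \<alpha> z b) \<bullet> (z - b) < 0"
  proof -
    have "(- \<epsilon> *\<^sub>R barrier_grad \<alpha> z b) \<bullet> (z - b)
        = (2 * \<epsilon> * \<alpha> * exp (- \<alpha> * ((b - z) \<bullet> (b - z)))) * ((b - z) \<bullet> (z - b))"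
      unfolding barrier_grad_def by simp
    moreover have "(b - z) \<bullet> (z - b) = - R\<^sup>2"
      using b(1) by (metis inner_minus_right minus_diff_eq power2_norm_eq_inner)
    ultimately show ?thesis using \<epsilon>(1) \<alpha>(1) R(1) by (simp add: mult_pos_neg)
  qed
  from DERIV_neg_dec_right[OF d\<phi> this]
  obtain d where d: "0 < d" "\<And>t. 0 < t \<Longrightarrow> t < d \<Longrightarrow> \<phi> t < \<phi> 0" by auto
  define t where "t = min (d / 2) (1 / 2)"
  have t: "0 < t" "t < d" "t \<le> 1 / 2" using d unfolding t_def by auto
  have "norm (b + t *\<^sub>R (z - b) - z) = (1 - t) * R"
  proof -
    have "b + t *\<^sub>R (z - b) - z = (1 - t) *\<^sub>R (b - z)" by (simp add: algebra_simps)
    then show ?thesis using b t by simp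
  qed
  moreover have "R / 2 \<le> (1 - t) * R" "(1 - t) * R \<le> R"
    using t R(1) mult_right_mono[of "1 / 2" "1 - t" R] mult_right_mono[of "1 - t" 1 R] by simp_all
  ultimately have "b + t *\<^sub>R (z - b) \<in> A" unfolding A_def mem_Collect_eq by (simp only:)
  then have "0 \<le> \<phi> t" using gpos unfolding \<phi>_def by blast
  moreover have "\<phi> 0 = 0" unfolding \<phi>_def using gb by simp
  ultimately show False using d(2)[of t] t by simp
qed

text \<open>If the contact set were not open, a point off it would be the centre of a ball without contact
points inside but with one, \<open>b\<close>, on its boundary.  There the gradients agree, because
\<open>u - u'\<close> has an interior minimum, contrary to Hopf's lemma.\<close>

lemma strong_maximum_principle:
  fixes f :: "real ^ 'n::finite \<Rightarrow> real"
  assumes sm: "smooth_on pos_cone f" and sym: "symmetric_fun f" and inc: "increasing_fun f"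
    and sol: "graph_solution f C U u G H" and sol': "graph_solution f C U u' G' H'"
    and V: "open V" "connected V" "V \<subseteq> U"
    and above: "\<And>x. x \<in> V \<Longrightarrow> u' x \<le> u x"
    and a: "a \<in> V" "u a = u' a"
    and x: "x \<in> V"
  shows "u x = u' x"
proof -
  define Z where "Z = {x \<in> V. u x = u' x}"
  have contV: "continuous_on V u" "continuous_on V u'"
    using graph_solutionD(6)[OF sol] graph_solutionD(6)[OF sol'] V continuous_on_subset by blast+
  have grad: "G p = G' p" if "p \<in> Z" for p
  proof -
    have "G p - G' p = 0"
    proof (rule minimum_second_order(1)[OF V(1), of p "\<lambda>x. u x - u' x" "\<lambda>x. G x - G' x"])
      show "p \<in> V" using that by (simp add: Z_def)
      show "((\<lambda>x. u x - u' x) has_derivative (\<lambda>h. (G x - G' x) \<bullet> h)) (at x)" if "x \<in> V" for x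
        using has_derivative_diff[OF graph_solutionD(2)[OF sol, of x] graph_solutionD(2)[OF sol', of x]]
          that V(3) by (auto simp: inner_diff_left)
      show "u p - u' p \<le> u x - u' x" if "x \<in> V" for x
        using above[OF that] \<open>p \<in> Z\<close> by (simp add: Z_def)
    qed
    then show ?thesis by simp
  qed
  have "openin (top_of_set V) Z"
  proof (subst openin_open_eq[OF V(1)], intro conjI)
    show "Z \<subseteq> V" by (auto simp: Z_def)
    show "open Z"
      unfolding open_contains_ball
    proof
      fix p assume p: "p \<in> Z"
      then obtain \<rho> where \<rho>: "0 < \<rho>" "cball p \<rho> \<subseteq> V"
        using V(1) unfolding Z_def by (metis (mono_tags, lifting) mem_Collect_eq open_contains_cball)
      have "ball p (\<rho> / 2) \<subseteq> Z"
      proof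
        fix y assume y: "y \<in> ball p (\<rho> / 2)"
        show "y \<in> Z"
        proof (rule ccontr)
          assume yZ: "y \<notin> Z"
          define Z' where "Z' = {q \<in> cball p \<rho>. u q - u' q = 0}"
          have Z'Z: "Z' \<subseteq> Z" using \<rho>(2) unfolding Z'_def Z_def by auto
          have "closed Z'"
            unfolding Z'_def using contV \<rho>(2)
            by (intro continuous_closed_preimage_constant continuous_intros closed_cball)
              (auto intro: continuous_on_subset)
          moreover have "p \<in> Z'" using p \<rho>(1) unfolding Z'_def Z_def by simp
          ultimately obtain b where b: "b \<in> Z'" "\<And>q. q \<in> Z' \<Longrightarrow> dist y b \<le> dist y q"
            using distance_attains_inf[of Z' y] by blast
          define d where "d = dist y b"
          have d: "0 < d" "d < \<rho> / 2"
            using b yZ Z'Z b(2)[OF \<open>p \<in> Z'\<close>] y unfolding d_def by (auto simp: dist_commute)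
          define z where "z = y + (1/2) *\<^sub>R (b - y)"
          have bz: "norm (b - z) = d / 2"
          proof -
            have "b - z = (1/2) *\<^sub>R (b - y)" unfolding z_def by (simp add: algebra_simps scaleR_2[symmetric])
            then show ?thesis unfolding d_def by (simp add: dist_norm norm_minus_commute)
          qed
          \<comment> \<open>the ball with diameter from y to b lies, but for b, in the open ball about y\<close>
          have inner: "norm (q - y) < d" if q: "norm (q - z) \<le> d / 2" "q \<noteq> b" for q
          proof (rule ccontr)
            assume "\<not> norm (q - y) < d"
            then have ge: "d\<^sup>2 \<le> (norm (q - y))\<^sup>2" using d by (intro power_mono) auto
            define v where "v = q - y"
            define c where "c = b - y"
            have nc: "(norm c)\<^sup>2 = d\<^sup>2" unfolding c_def d_def by (simp add: dist_norm norm_minus_commute)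
            have "q - z = v - (1/2) *\<^sub>R c" unfolding z_def v_def c_def by simp
            then have "(norm (v - (1/2) *\<^sub>R c))\<^sup>2 \<le> (d / 2)\<^sup>2" using q(1) by (intro power_mono) auto
            moreover have "(norm (v - (1/2) *\<^sub>R c))\<^sup>2 = (norm v)\<^sup>2 - v \<bullet> c + (norm c)\<^sup>2 / 4"
              unfolding power2_norm_eq_inner by (simp add: inner_diff_left inner_diff_right inner_commute)
            moreover have "(d / 2)\<^sup>2 = d\<^sup>2 / 4" by (simp add: power2_eq_square)
            ultimately have "(norm v)\<^sup>2 \<le> v \<bullet> c" using nc by simp
            moreover have "(norm (v - c))\<^sup>2 = (norm v)\<^sup>2 - 2 * (v \<bullet> c) + (norm c)\<^sup>2"
              unfolding power2_norm_eq_inner by (simp add: inner_diff_left inner_diff_right inner_commute)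
            ultimately have "(norm (v - c))\<^sup>2 \<le> 0" using ge nc unfolding v_def by linarith
            then show False using q(2) unfolding v_def c_def by simp
          qed
          have strict: "u' q < u q" if "q \<in> cball z (d / 2) - {b}" for q
          proof -
            have q: "norm (q - y) < d" using inner[of q] that by (auto simp: dist_norm norm_minus_commute)
            have "dist p q \<le> dist p y + dist y q" by (rule dist_triangle)
            then have "q \<in> cball p \<rho>" using q d y by (simp add: dist_norm norm_minus_commute)
            moreover have "q \<notin> Z'" using b(2)[of q] q unfolding d_def by (auto simp: dist_norm norm_minus_commute)
            ultimately have "q \<in> V" "u q \<noteq> u' q" using \<rho>(2) unfolding Z'_def by auto
            then show ?thesis using above[of q] by simp
          qed
          have sub: "cball z (d / 2) \<subseteq> U"
          proof
            fix q assume q: "q \<in> cball z (d / 2)"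
            have "norm (q - y) \<le> d"
              using inner[of q] q d_def by (cases "q = b") (auto simp: dist_norm norm_minus_commute)
            moreover have "dist p q \<le> dist p y + dist y q" by (rule dist_triangle)
            ultimately have "q \<in> cball p \<rho>" using d y by (simp add: dist_norm norm_minus_commute)
            then show "q \<in> U" using \<rho>(2) V(3) by blast
          qed
          have "u b = u' b" using b(1) by (simp add: Z'_def)
          then have "G b \<noteq> G' b"
            using hopf_boundary_gradient[OF sm sym inc sol sol' _ sub bz _ strict] d by auto
          then show False using grad b(1) Z'Z by blast
        qed
      qed
      then show "\<exists>e>0. ball p e \<subseteq> Z" using \<rho>(1) by (intro exI[of _ "\<rho> / 2"]) simp
    qed
  qed
  moreover have "closedin (top_of_set V) Z"
  proof -
    have "Z = {x \<in> V. u x - u' x = 0}" by (auto simp: Z_def)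
    then show ?thesis
      using continuous_closedin_preimage_constant[of V "\<lambda>x. u x - u' x" 0] contV
      by (simp add: continuous_on_diff)
  qed
  ultimately have "Z = {} \<or> Z = V" using V(2) unfolding connected_clopen by blast
  then have "Z = V" using a by (auto simp: Z_def)
  then show ?thesis using x by (auto simp: Z_def)
qed

section \<open>Smooth maps and implicit functions\<close>

lemma frechet_derivative_eqI:
  "(f has_derivative f') (at x) \<Longrightarrow> frechet_derivative f (at x) = f'"
  using frechet_derivative_at by metis

lemma Ck_cong:
  assumes "open S" "\<And>x. x \<in> S \<Longrightarrow> f x = g x" "Ck_on k S f"
  shows "Ck_on k S g"
  using assms
proof (induction k arbitrary: f g)
  case 0
  then show ?case by (auto cong: continuous_on_cong)
next
  case (Suc k)
  have d: "f differentiable (at x)" if "x \<in> S" for x using Suc.prems(3) that by simp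
  have eq: "(g has_derivative frechet_derivative f (at x)) (at x)" if "x \<in> S" for x
  proof (rule has_derivative_transform_within_open[OF _ Suc.prems(1) that])
    show "(f has_derivative frechet_derivative f (at x)) (at x)"
      using d[OF that] frechet_derivative_works by blast
  qed (use Suc.prems(2) in simp)
  have "Ck_on k S (\<lambda>x. frechet_derivative g (at x) v)" for v
  proof (rule Suc.IH[OF Suc.prems(1)])
    show "Ck_on k S (\<lambda>x. frechet_derivative f (at x) v)" using Suc.prems(3) by simp
    show "frechet_derivative f (at x) v = frechet_derivative g (at x) v" if "x \<in> S" for x
      using frechet_derivative_eqI[OF eq[OF that]] by simp
  qed
  then show ?case using differentiableI[OF eq] by simp
qed

lemma Ck_SucI:
  assumes "open S" "\<And>x. x \<in> S \<Longrightarrow> (f has_derivative f' x) (at x)"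
    and "\<And>v. Ck_on k S (\<lambda>x. f' x v)"
  shows "Ck_on (Suc k) S f"
proof -
  have "Ck_on k S (\<lambda>x. frechet_derivative f (at x) v)" for v
    by (rule Ck_cong[OF assms(1) _ assms(3)]) (simp add: frechet_derivative_eqI[OF assms(2)])
  then show ?thesis using differentiableI[OF assms(2)] by simp
qed

lemma Ck_SucD:
  assumes "Ck_on (Suc k) S f"
  shows "x \<in> S \<Longrightarrow> (f has_derivative frechet_derivative f (at x)) (at x)"
    and "Ck_on k S (\<lambda>x. frechet_derivative f (at x) v)"
  using assms frechet_derivative_works by auto

lemma Ck_on_le_Suc: "Ck_on (Suc k) S f \<Longrightarrow> Ck_on k S f"
proof (induction k arbitrary: f)
  case 0
  then have "(f has_derivative frechet_derivative f (at x)) (at x)" if "x \<in> S" for x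
    using Ck_SucD(1) that by blast
  then have "continuous_on S f"
    by (intro continuous_at_imp_continuous_on ballI) (rule has_derivative_continuous)
  then show ?case by simp
next
  case (Suc k)
  have "\<forall>x\<in>S. f differentiable (at x)"
    using Suc.prems unfolding Ck_on.simps(2)[of "Suc k"] by (rule conjunct1)
  moreover have "Ck_on (Suc k) S (\<lambda>x. frechet_derivative f (at x) v)" for v
    using Suc.prems unfolding Ck_on.simps(2)[of "Suc k"] by blast
  then have "Ck_on k S (\<lambda>x. frechet_derivative f (at x) v)" for v by (rule Suc.IH)
  ultimately show ?case unfolding Ck_on.simps(2)[of k] by blast
qed

lemma Ck_subset: "Ck_on k S f \<Longrightarrow> T \<subseteq> S \<Longrightarrow> Ck_on k T f"
proof (induction k arbitrary: f)
  case 0 then show ?case by (auto intro: continuous_on_subset)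
next
  case (Suc k)
  have "f differentiable (at x)" if "x \<in> T" for x
    using Suc.prems that unfolding Ck_on.simps(2)[of k] by blast
  moreover have "Ck_on k T (\<lambda>x. frechet_derivative f (at x) v)" for v
    using Suc.prems unfolding Ck_on.simps(2)[of k] by (intro Suc.IH) blast+
  ultimately show ?case by simp
qed

lemma Ck_continuous: "Ck_on k S f \<Longrightarrow> continuous_on S f"
proof (induction k)
  case 0 then show ?case by simp
next
  case (Suc k) then show ?case using Ck_on_le_Suc[of k S f] by simp
qed

lemma Ck_const: "open S \<Longrightarrow> Ck_on k S (\<lambda>x. c)"
proof (induction k arbitrary: c)
  case 0 then show ?case by simp
next
  case (Suc k)
  show ?case
    by (rule Ck_SucI[OF Suc.prems, where f' = "\<lambda>x v. 0"]) (rule has_derivative_const, rule Suc.IH[OF Suc.prems])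
qed

lemma Ck_linear:
  fixes f :: "'a::euclidean_space \<Rightarrow> 'b::euclidean_space"
  assumes "open S" "linear f"
  shows "Ck_on k S f"
proof -
  have bl: "bounded_linear f" using assms(2) linear_conv_bounded_linear by blast
  show ?thesis
  proof (cases k)
    case 0
    then show ?thesis using linear_continuous_on[OF bl] by simp
  next
    case (Suc m)
    show ?thesis unfolding Suc
      by (rule Ck_SucI[OF assms(1) bounded_linear_imp_has_derivative[OF bl] Ck_const[OF assms(1)]])
  qed
qed

lemma Ck_add:
  assumes "open S" "Ck_on k S f" "Ck_on k S g"
  shows "Ck_on k S (\<lambda>x. f x + g x)"
  using assms
proof (induction k arbitrary: f g)
  case 0 then show ?case by (auto intro: continuous_intros)
next
  case (Suc k)
  show ?case
  proof (rule Ck_SucI[OF Suc.prems(1)])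
    show "((\<lambda>x. f x + g x) has_derivative
        (\<lambda>v. frechet_derivative f (at x) v + frechet_derivative g (at x) v)) (at x)" if "x \<in> S" for x
      by (intro has_derivative_add Ck_SucD(1)[OF Suc.prems(2) that] Ck_SucD(1)[OF Suc.prems(3) that])
    show "Ck_on k S (\<lambda>x. frechet_derivative f (at x) v + frechet_derivative g (at x) v)" for v
      by (rule Suc.IH[OF Suc.prems(1) Ck_SucD(2)[OF Suc.prems(2)] Ck_SucD(2)[OF Suc.prems(3)]])
  qed
qed

lemma Ck_sum:
  assumes "open S" "finite I" "\<And>i. i \<in> I \<Longrightarrow> Ck_on k S (f i)"
  shows "Ck_on k S (\<lambda>x. \<Sum>i\<in>I. f i x)"
  using assms(2,3)
proof (induction I rule: finite_induct)
  case empty then show ?case using Ck_const[OF assms(1)] by simp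
next
  case (insert i I)
  have "Ck_on k S (\<lambda>x. f i x + (\<Sum>i\<in>I. f i x))"
    by (rule Ck_add[OF assms(1)]) (use insert in auto)
  then show ?case using insert by simp
qed

lemma Ck_linear_compose:
  assumes "open S" "linear L" "Ck_on k S f"
  shows "Ck_on k S (\<lambda>x. L (f x))"
  using assms
proof (induction k arbitrary: f)
  case 0
  have "bounded_linear L" using 0 linear_conv_bounded_linear by blast
  then show ?case using 0 by (simp add: bounded_linear.continuous_on)
next
  case (Suc k)
  show ?case
  proof (rule Ck_SucI[OF Suc.prems(1)])
    show "((\<lambda>x. L (f x)) has_derivative (\<lambda>v. L (frechet_derivative f (at x) v))) (at x)" if "x \<in> S" for x
      using bounded_linear.has_derivative[OF _ Ck_SucD(1)[OF Suc.prems(3) that], of L] Suc.prems(2)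
        linear_conv_bounded_linear by blast
    show "Ck_on k S (\<lambda>x. L (frechet_derivative f (at x) v))" for v
      by (rule Suc.IH[OF Suc.prems(1,2) Ck_SucD(2)[OF Suc.prems(3)]])
  qed
qed

lemma Ck_scaleR:
  fixes a :: "'a::euclidean_space \<Rightarrow> real" and f :: "'a \<Rightarrow> 'b::euclidean_space"
  assumes "open S" "Ck_on k S a" "Ck_on k S f"
  shows "Ck_on k S (\<lambda>x. a x *\<^sub>R f x)"
  using assms
proof (induction k arbitrary: a f)
  case 0 then show ?case by (auto intro: continuous_intros)
next
  case (Suc k)
  show ?case
  proof (rule Ck_SucI[OF Suc.prems(1)])
    show "((\<lambda>x. a x *\<^sub>R f x) has_derivative
        (\<lambda>v. a x *\<^sub>R frechet_derivative f (at x) v + frechet_derivative a (at x) v *\<^sub>R f x)) (at x)"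
      if "x \<in> S" for x
      by (intro has_derivative_scaleR Ck_SucD(1)[OF Suc.prems(2) that] Ck_SucD(1)[OF Suc.prems(3) that])
    show "Ck_on k S (\<lambda>x. a x *\<^sub>R frechet_derivative f (at x) v + frechet_derivative a (at x) v *\<^sub>R f x)" for v
      by (rule Ck_add[OF Suc.prems(1) Suc.IH[OF Suc.prems(1) Ck_on_le_Suc[OF Suc.prems(2)] Ck_SucD(2)[OF Suc.prems(3)]]
            Suc.IH[OF Suc.prems(1) Ck_SucD(2)[OF Suc.prems(2)] Ck_on_le_Suc[OF Suc.prems(3)]]])
  qed
qed

lemma Ck_mult:
  fixes a b :: "'a::euclidean_space \<Rightarrow> real"
  shows "open S \<Longrightarrow> Ck_on k S a \<Longrightarrow> Ck_on k S b \<Longrightarrow> Ck_on k S (\<lambda>x. a x * b x)"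
  using Ck_scaleR[of S k a b] by simp

lemma Ck_inverse:
  fixes a :: "'a::euclidean_space \<Rightarrow> real"
  assumes "open S" "Ck_on k S a" "\<And>x. x \<in> S \<Longrightarrow> a x \<noteq> 0"
  shows "Ck_on k S (\<lambda>x. inverse (a x))"
  using assms(2)
proof (induction k)
  case 0 then show ?case using assms(3) by (auto intro: continuous_intros)
next
  case (Suc k)
  show ?case
  proof (rule Ck_SucI[OF assms(1)])
    show "((\<lambda>x. inverse (a x)) has_derivative
        (\<lambda>v. - (inverse (a x) * frechet_derivative a (at x) v * inverse (a x)))) (at x)" if "x \<in> S" for x
      using Deriv.has_derivative_inverse[OF assms(3)[OF that] Ck_SucD(1)[OF Suc.prems that]] .
    have i: "Ck_on k S (\<lambda>x. inverse (a x))" using Suc Ck_on_le_Suc by blast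
    show "Ck_on k S (\<lambda>x. - (inverse (a x) * frechet_derivative a (at x) v * inverse (a x)))" for v
      by (rule Ck_linear_compose[OF assms(1) _ Ck_mult[OF assms(1) Ck_mult[OF assms(1) i Ck_SucD(2)[OF Suc.prems]] i],
            where L = uminus]) (simp add: linearI)
  qed
qed

text \<open>The chain rule, written in a basis of the intermediate space, reduces the composition to sums and
products of functions with one derivative less to go.\<close>

lemma Ck_compose:
  fixes f :: "'a::euclidean_space \<Rightarrow> 'b::euclidean_space" and g :: "'b \<Rightarrow> 'c::euclidean_space"
  assumes "open S" "open T" "Ck_on k S f" "Ck_on k T g" "f ` S \<subseteq> T"
  shows "Ck_on k S (\<lambda>x. g (f x))"
  using assms
proof (induction k arbitrary: g)
  case 0 then show ?case by (auto intro: continuous_on_compose2)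
next
  case (Suc k)
  have fd: "(f has_derivative frechet_derivative f (at x)) (at x)" if "x \<in> S" for x
    using Ck_SucD(1)[OF Suc.prems(3) that] .
  have gd: "(g has_derivative frechet_derivative g (at (f x))) (at (f x))" if "x \<in> S" for x
    using Ck_SucD(1)[OF Suc.prems(4)] that Suc.prems(5) by blast
  show ?case
  proof (rule Ck_SucI[OF Suc.prems(1)])
    show "((\<lambda>x. g (f x)) has_derivative
        (\<lambda>v. \<Sum>b\<in>Basis. (frechet_derivative f (at x) v \<bullet> b) *\<^sub>R frechet_derivative g (at (f x)) b)) (at x)"
      if "x \<in> S" for x
    proof (rule has_derivative_eq_rhs[OF has_derivative_compose[OF fd[OF that] gd[OF that]]])
      have lin: "linear (frechet_derivative g (at (f x)))" using has_derivative_linear[OF gd[OF that]] .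
      show "(\<lambda>v. frechet_derivative g (at (f x)) (frechet_derivative f (at x) v)) =
          (\<lambda>v. \<Sum>b\<in>Basis. (frechet_derivative f (at x) v \<bullet> b) *\<^sub>R frechet_derivative g (at (f x)) b)"
      proof
        fix v
        have "frechet_derivative g (at (f x)) (frechet_derivative f (at x) v)
            = frechet_derivative g (at (f x)) (\<Sum>b\<in>Basis. (frechet_derivative f (at x) v \<bullet> b) *\<^sub>R b)"
          by (simp only: euclidean_representation)
        then show "frechet_derivative g (at (f x)) (frechet_derivative f (at x) v)
            = (\<Sum>b\<in>Basis. (frechet_derivative f (at x) v \<bullet> b) *\<^sub>R frechet_derivative g (at (f x)) b)"
          by (simp add: linear_sum[OF lin] linear_cmul[OF lin])
      qed
    qed
    show "Ck_on k S (\<lambda>x. \<Sum>b\<in>Basis. (frechet_derivative f (at x) v \<bullet> b) *\<^sub>R frechet_derivative g (at (f x)) b)" for v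
    proof (intro Ck_sum Ck_scaleR Suc.prems(1) finite_Basis)
      fix b :: 'b
      show "Ck_on k S (\<lambda>x. frechet_derivative f (at x) v \<bullet> b)"
        by (rule Ck_linear_compose[OF Suc.prems(1) _ Ck_SucD(2)[OF Suc.prems(3)]])
          (auto intro: bounded_linear.linear bounded_linear_inner_left)
      show "Ck_on k S (\<lambda>x. frechet_derivative g (at (f x)) b)"
        by (rule Suc.IH[OF Suc.prems(1,2) Ck_on_le_Suc[OF Suc.prems(3)] Ck_SucD(2)[OF Suc.prems(4)] Suc.prems(5)])
    qed
  qed
qed

lemma Ck_Pair:
  assumes "open S" "Ck_on k S f" "Ck_on k S g"
  shows "Ck_on k S (\<lambda>x. (f x, g x))"
proof -
  have "Ck_on k S (\<lambda>x. (f x, 0) + (0, g x))"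
    using assms by (intro Ck_add Ck_linear_compose[where L = "\<lambda>y. (y, 0)"] Ck_linear_compose[where L = "\<lambda>y. (0, y)"])
      (auto intro!: linearI)
  then show ?thesis by simp
qed

text \<open>Linearise \<open>\<psi>(x, u(x)) = 0\<close>.  The estimate first bounds the increment of \<open>u\<close> by a multiple of the
increment of \<open>x\<close>, and then improves this to the derivative.\<close>

lemma implicit_function_derivative:
  fixes \<psi> :: "'a::euclidean_space \<times> real \<Rightarrow> real"
  assumes d\<psi>: "(\<psi> has_derivative A) (at (x, u x))" and \<beta>: "A (0, 1) \<noteq> 0"
    and U: "open U" "x \<in> U" "\<And>x'. x' \<in> U \<Longrightarrow> \<psi> (x', u x') = 0"
    and cont: "continuous (at x) u"
  shows "(u has_derivative (\<lambda>h. - (A (h, 0) * inverse (A (0, 1))))) (at x)"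
proof -
  define \<beta> where "\<beta> = A (0, 1)"
  have b0: "0 < \<bar>\<beta>\<bar>" using \<beta> by (simp add: \<beta>_def)
  have bl: "bounded_linear A" using has_derivative_bounded_linear[OF d\<psi>] .
  have lin: "linear A" using bl bounded_linear.linear by blast
  have Asplit: "A (h, t) = A (h, 0) + \<beta> * t" for h t
  proof -
    have "A (h, t) = A ((h, 0) + t *\<^sub>R (0, 1))" by simp
    then show ?thesis unfolding linear_add[OF lin] linear_cmul[OF lin] \<beta>_def by (simp add: mult.commute)
  qed
  obtain N where N: "0 < N" "\<And>k. norm (A k) \<le> norm k * N"
    using bounded_linear.pos_bounded[OF bl] by blast
  have N': "\<bar>A (h, 0)\<bar> \<le> N * norm h" for h using N(2)[of "(h, 0)"] by (simp add: mult.commute)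
  have linu: "linear (\<lambda>h. - (A (h, 0) * inverse \<beta>))"
  proof (rule linearI)
    show "- (A (a + b, 0) * inverse \<beta>) = - (A (a, 0) * inverse \<beta>) + - (A (b, 0) * inverse \<beta>)" for a b
      using linear_add[OF lin, of "(a, 0)" "(b, 0)"] by (simp add: algebra_simps)
    show "- (A (c *\<^sub>R a, 0) * inverse \<beta>) = c *\<^sub>R - (A (a, 0) * inverse \<beta>)" for c a
      using linear_cmul[OF lin, of c "(a, 0)"] by simp
  qed
  define M where "M = (2 * N + \<bar>\<beta>\<bar>) / \<bar>\<beta>\<bar>"
  have M: "0 < M" unfolding M_def using N b0 by simp
  show ?thesis
    unfolding \<beta>_def[symmetric] has_derivative_at_alt
  proof (intro conjI allI impI)
    show "bounded_linear (\<lambda>h. - (A (h, 0) * inverse \<beta>))" using linu linear_conv_bounded_linear by blast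
    fix e :: real assume e: "0 < e"
    \<comment> \<open>small enough to absorb the increment of \<open>u\<close>, and to give the final bound\<close>
    define e1 where "e1 = min (\<bar>\<beta>\<bar> / 2) (e * \<bar>\<beta>\<bar> / (1 + M))"
    have e1: "0 < e1" "e1 \<le> \<bar>\<beta>\<bar> / 2" "e1 * (1 + M) \<le> e * \<bar>\<beta>\<bar>"
    proof -
      show "0 < e1" unfolding e1_def using b0 e M by simp
      show "e1 \<le> \<bar>\<beta>\<bar> / 2" unfolding e1_def by (rule min.cobounded1)
      have "e1 * (1 + M) \<le> e * \<bar>\<beta>\<bar> / (1 + M) * (1 + M)"
        unfolding e1_def using M by (intro mult_right_mono) auto
      then show "e1 * (1 + M) \<le> e * \<bar>\<beta>\<bar>" using M by simp
    qed
    obtain d where d: "0 < d" "\<And>z. norm (z - (x, u x)) < d \<Longrightarrow>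
        norm (\<psi> z - \<psi> (x, u x) - A (z - (x, u x))) \<le> e1 * norm (z - (x, u x))"
      using d\<psi> e1(1) unfolding has_derivative_at_alt by blast
    obtain d1 where d1: "0 < d1" "\<And>x'. dist x' x < d1 \<Longrightarrow> dist (u x') (u x) < d / 2"
      using cont d(1) unfolding continuous_at_eps_delta by (metis half_gt_zero)
    obtain d2 where d2: "0 < d2" "ball x d2 \<subseteq> U" using U openE by blast
    define d3 where "d3 = min (d / 2) (min d1 d2)"
    show "\<exists>d>0. \<forall>y. norm (y - x) < d \<longrightarrow>
        norm (u y - u x - - (A (y - x, 0) * inverse \<beta>)) \<le> e * norm (y - x)"
    proof (intro exI[of _ d3] conjI allI impI)
      show "0 < d3" unfolding d3_def using d d1 d2 by simp
      fix y assume y: "norm (y - x) < d3"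
      define h where "h = y - x"
      define \<eta> where "\<eta> = u y - u x"
      have yU: "y \<in> U" using y d2(2) unfolding d3_def by (auto simp: dist_norm norm_minus_commute)
      have "\<bar>\<eta>\<bar> < d / 2" using d1(2)[of y] y unfolding d3_def \<eta>_def by (auto simp: dist_norm)
      moreover have "norm h < d / 2" using y unfolding d3_def h_def by simp
      moreover have hn: "norm (h, \<eta>) \<le> norm h + \<bar>\<eta>\<bar>" using norm_Pair_le[of h \<eta>] by simp
      ultimately have "norm (h, \<eta>) < d" by linarith
      then have "norm (A (h, \<eta>)) \<le> e1 * norm (h, \<eta>)"
        using d(2)[of "(y, u y)"] U(3)[OF yU] U(3)[OF U(2)] by (simp add: h_def \<eta>_def)
      also have "\<dots> \<le> e1 * (norm h + \<bar>\<eta>\<bar>)" using hn e1(1) by simp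
      finally have main: "\<bar>A (h, 0) + \<beta> * \<eta>\<bar> \<le> e1 * (norm h + \<bar>\<eta>\<bar>)" unfolding Asplit[of h \<eta>] by simp
      have "\<bar>\<beta>\<bar> * \<bar>\<eta>\<bar> \<le> \<bar>A (h, 0) + \<beta> * \<eta>\<bar> + \<bar>A (h, 0)\<bar>" unfolding abs_mult[symmetric] by linarith
      also have "\<dots> \<le> e1 * norm h + e1 * \<bar>\<eta>\<bar> + N * norm h" using main N'[of h] by (simp add: algebra_simps)
      also have "\<dots> \<le> \<bar>\<beta>\<bar> / 2 * norm h + \<bar>\<beta>\<bar> / 2 * \<bar>\<eta>\<bar> + N * norm h"
        using e1(2) by (intro add_mono mult_right_mono) auto
      finally have "\<bar>\<beta>\<bar> * \<bar>\<eta>\<bar> \<le> (2 * N + \<bar>\<beta>\<bar>) * norm h" by (simp add: algebra_simps)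
      then have "\<bar>\<eta>\<bar> \<le> M * norm h" unfolding M_def using b0 by (simp add: field_simps)
      then have "e1 * (norm h + \<bar>\<eta>\<bar>) \<le> e1 * ((1 + M) * norm h)"
        using e1(1) by (intro mult_left_mono) (auto simp: algebra_simps)
      also have "\<dots> \<le> e * \<bar>\<beta>\<bar> * norm h" using e1(3) mult_right_mono[OF e1(3), of "norm h"] by (simp add: mult.assoc)
      finally have "\<bar>A (h, 0) + \<beta> * \<eta>\<bar> \<le> e * \<bar>\<beta>\<bar> * norm h" using main by linarith
      moreover have "A (h, 0) + \<beta> * \<eta> = \<beta> * (\<eta> + A (h, 0) * inverse \<beta>)" using b0 by (simp add: field_simps)
      then have "\<bar>\<beta>\<bar> * \<bar>\<eta> + A (h, 0) * inverse \<beta>\<bar> = \<bar>A (h, 0) + \<beta> * \<eta>\<bar>"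
        by (simp only: abs_mult)
      ultimately have "\<bar>\<beta>\<bar> * \<bar>\<eta> + A (h, 0) * inverse \<beta>\<bar> \<le> \<bar>\<beta>\<bar> * (e * norm h)"
        by (simp add: mult_ac)
      then have "\<bar>\<eta> + A (h, 0) * inverse \<beta>\<bar> \<le> e * norm h" using b0 by simp
      then show "norm (u y - u x - - (A (y - x, 0) * inverse \<beta>)) \<le> e * norm (y - x)"
        unfolding h_def \<eta>_def by simp
    qed
  qed
qed

text \<open>Near the point \<open>\<psi>\<close> decreases strictly in the last variable, so the intermediate value theorem gives
the unique zero \<open>u(x)\<close> together with the sign of \<open>\<psi>\<close> on both sides of it.  Regularity follows by
induction, since the derivative of \<open>u\<close> is a rational expression in derivatives of \<open>\<psi>\<close> at
\<open>(x, u(x))\<close>.\<close>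

lemma implicit_graph:
  fixes \<psi> :: "'a::euclidean_space \<times> real \<Rightarrow> real"
  assumes O: "open O'" "\<And>k. Ck_on k O' \<psi>" "(x0, y0) \<in> O'" and z: "\<psi> (x0, y0) = 0"
    and neg: "frechet_derivative \<psi> (at (x0, y0)) (0, 1) < 0" and d0: "0 < d0"
  obtains r \<delta> u where "0 < r" "0 < \<delta>" "\<delta> < d0" "\<And>k. Ck_on k (ball x0 r) u" "u x0 = y0"
    "\<And>x. x \<in> ball x0 r \<Longrightarrow> \<bar>u x - y0\<bar> < \<delta>"
    "\<And>x y. x \<in> ball x0 r \<Longrightarrow> \<bar>y - y0\<bar> < \<delta> \<Longrightarrow>
      (x, y) \<in> O' \<and> (\<psi> (x, y) = 0 \<longleftrightarrow> y = u x) \<and> (0 < \<psi> (x, y) \<longleftrightarrow> y < u x)"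
proof -
  define A where "A = (\<lambda>z. frechet_derivative \<psi> (at z))"
  have C1: "Ck_on (Suc 0) O' \<psi>" using O(2) .
  have dA: "(\<psi> has_derivative A z) (at z)" if "z \<in> O'" for z
    unfolding A_def using Ck_SucD(1)[OF C1 that] .
  have cA: "continuous_on O' (\<lambda>z. A z (0, 1))" unfolding A_def using Ck_SucD(2)[OF C1] by simp
  have c\<psi>: "continuous_on O' \<psi>" using Ck_continuous[OF O(2)] .
  have "open {z \<in> O'. A z (0, 1) < 0}"
  proof -
    have "{z \<in> O'. A z (0, 1) < 0} = O' \<inter> (\<lambda>z. A z (0, 1)) -` {..<0}" by auto
    then show ?thesis using continuous_open_preimage[OF cA O(1)] by simp
  qed
  moreover have "(x0, y0) \<in> {z \<in> O'. A z (0, 1) < 0}" using O(3) neg by (simp add: A_def)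
  ultimately obtain e where e: "0 < e" "ball (x0, y0) e \<subseteq> {z \<in> O'. A z (0, 1) < 0}" using openE by blast
  define \<delta> where "\<delta> = min d0 e / 2"
  have \<delta>: "0 < \<delta>" "\<delta> < d0" "\<delta> \<le> e / 2" using d0 e(1) unfolding \<delta>_def by auto
  have box: "(x, y) \<in> O'" "A (x, y) (0, 1) < 0" if "dist x0 x < e / 2" "\<bar>y - y0\<bar> \<le> \<delta>" for x y
  proof -
    have "dist (x0, y0) (x, y) \<le> norm (x0 - x) + norm (y0 - y)"
      unfolding dist_norm using norm_Pair_le[of "x0 - x" "y0 - y"] by simp
    also have "\<dots> < e" using that \<delta> by (simp add: dist_norm abs_minus_commute)
    finally have "(x, y) \<in> ball (x0, y0) e" by simp
    then show "(x, y) \<in> O'" "A (x, y) (0, 1) < 0" using e(2) by auto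
  qed
  have dec: "\<psi> (x, y2) < \<psi> (x, y1)"
    if x: "dist x0 x < e / 2" and y: "\<bar>y1 - y0\<bar> \<le> \<delta>" "\<bar>y2 - y0\<bar> \<le> \<delta>" "y1 < y2" for x y1 y2
  proof (rule DERIV_neg_imp_decreasing[OF y(3)])
    fix t assume t: "y1 \<le> t" "t \<le> y2"
    have tb: "(x, t) \<in> O'" "A (x, t) (0, 1) < 0" using box[of x t] x y t by auto
    have "((\<lambda>t. (x, t)) has_derivative (\<lambda>h. (0, h))) (at t)"
      by (intro has_derivative_Pair has_derivative_const has_derivative_ident)
    from has_derivative_compose[OF this dA[OF tb(1)]]
    have "((\<lambda>t. \<psi> (x, t)) has_derivative (\<lambda>h. A (x, t) (0, h))) (at t)" .
    moreover have "A (x, t) (0, h) = A (x, t) (0, 1) * h" for h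
      using linear_cmul[OF has_derivative_linear[OF dA[OF tb(1)]], of h "(0, 1)"] by (simp add: mult.commute)
    then have "(\<lambda>h. A (x, t) (0, h)) = (*) (A (x, t) (0, 1))" by (intro ext)
    ultimately have "((\<lambda>t. \<psi> (x, t)) has_real_derivative A (x, t) (0, 1)) (at t)"
      unfolding has_field_derivative_def by (simp only:)
    then show "\<exists>l. ((\<lambda>t. \<psi> (x, t)) has_real_derivative l) (at t) \<and> l < 0" using tb(2) by blast
  qed
  have near: "\<exists>r>0. \<forall>x'. dist x x' < r \<longrightarrow> P (\<psi> (x', y))"
    if "dist x0 x < e / 2" "\<bar>y - y0\<bar> \<le> \<delta>" "P (\<psi> (x, y))" "open {t. P t}" for x y and P :: "real \<Rightarrow> bool"
  proof -
    have "open (O' \<inter> \<psi> -` {t. P t})" using continuous_open_preimage[OF c\<psi> O(1) that(4)] .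
    moreover have "(x, y) \<in> O' \<inter> \<psi> -` {t. P t}" using box(1)[OF that(1,2)] that(3) by simp
    ultimately obtain s where s: "0 < s" "ball (x, y) s \<subseteq> O' \<inter> \<psi> -` {t. P t}" using openE by blast
    have "P (\<psi> (x', y))" if "dist x x' < s" for x'
    proof -
      have "(x', y) \<in> ball (x, y) s" using that by (simp add: dist_Pair_Pair)
      then show ?thesis using s by auto
    qed
    then show ?thesis using s by blast
  qed
  have e2: "dist x0 x0 < e / 2" using e by simp
  have p0: "0 < \<psi> (x0, y0 - \<delta>)" using dec[OF e2, of "y0 - \<delta>" y0] \<delta> z by simp
  have n0: "\<psi> (x0, y0 + \<delta>) < 0" using dec[OF e2, of y0 "y0 + \<delta>"] \<delta> z by simp
  obtain r1 where r1: "0 < r1" "\<And>x. dist x0 x < r1 \<Longrightarrow> 0 < \<psi> (x, y0 - \<delta>)"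
    using near[OF e2, of "y0 - \<delta>" "\<lambda>t. 0 < t"] p0 \<delta> by (auto simp: open_Collect_less)
  obtain r2 where r2: "0 < r2" "\<And>x. dist x0 x < r2 \<Longrightarrow> \<psi> (x, y0 + \<delta>) < 0"
    using near[OF e2, of "y0 + \<delta>" "\<lambda>t. t < 0"] n0 \<delta> by (auto simp: open_Collect_less)
  define r where "r = min (e / 2) (min r1 r2)"
  have r: "0 < r" unfolding r_def using e r1 r2 by simp
  have rin: "dist x0 x < e / 2" "0 < \<psi> (x, y0 - \<delta>)" "\<psi> (x, y0 + \<delta>) < 0" if "x \<in> ball x0 r" for x
    using that r1(2) r2(2) unfolding r_def by auto
  have ex: "\<exists>y. \<bar>y - y0\<bar> < \<delta> \<and> \<psi> (x, y) = 0" if x: "x \<in> ball x0 r" for x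
  proof -
    have "continuous_on {y0 - \<delta>..y0 + \<delta>} (\<lambda>y. \<psi> (x, y))"
      by (rule continuous_on_compose2[OF c\<psi>]) (use box(1)[OF rin(1)[OF x]] in \<open>auto intro!: continuous_intros simp: abs_le_iff\<close>)
    then obtain y where y: "y0 - \<delta> \<le> y" "y \<le> y0 + \<delta>" "\<psi> (x, y) = 0"
      using IVT2'[of "\<lambda>y. \<psi> (x, y)" "y0 + \<delta>" 0 "y0 - \<delta>"] rin[OF x] \<delta> by auto
    moreover have "y \<noteq> y0 - \<delta>" "y \<noteq> y0 + \<delta>" using y(3) rin[OF x] by auto
    ultimately show ?thesis by (intro exI[of _ y]) auto
  qed
  define u where "u = (\<lambda>x. SOME y. \<bar>y - y0\<bar> < \<delta> \<and> \<psi> (x, y) = 0)"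
  have u: "\<bar>u x - y0\<bar> < \<delta>" "\<psi> (x, u x) = 0" if "x \<in> ball x0 r" for x
    using someI_ex[OF ex[OF that]] unfolding u_def by auto
  have iff: "(x, y) \<in> O' \<and> (\<psi> (x, y) = 0 \<longleftrightarrow> y = u x) \<and> (0 < \<psi> (x, y) \<longleftrightarrow> y < u x)"
    if x: "x \<in> ball x0 r" and y: "\<bar>y - y0\<bar> < \<delta>" for x y
  proof -
    note d = dec[OF rin(1)[OF x]]
    have "(x, y) \<in> O'" using box(1)[OF rin(1)[OF x]] y by simp
    moreover consider "y < u x" | "y = u x" | "u x < y" by linarith
    then have "(\<psi> (x, y) = 0 \<longleftrightarrow> y = u x) \<and> (0 < \<psi> (x, y) \<longleftrightarrow> y < u x)"
      using d[of y "u x"] d[of "u x" y] u[OF x] y by cases auto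
    ultimately show ?thesis by blast
  qed
  have cont: "continuous (at x) u" if x: "x \<in> ball x0 r" for x
    unfolding continuous_at_eps_delta
  proof (intro allI impI)
    fix \<epsilon> :: real assume \<epsilon>: "0 < \<epsilon>"
    define t where "t = min (\<epsilon> / 2) ((\<delta> - \<bar>u x - y0\<bar>) / 2)"
    have t: "0 < t" "t < \<epsilon>" "\<bar>u x - t - y0\<bar> < \<delta>" "\<bar>u x + t - y0\<bar> < \<delta>"
    proof -
      have m: "t \<le> \<epsilon> / 2" "t \<le> (\<delta> - \<bar>u x - y0\<bar>) / 2" unfolding t_def by (rule min.cobounded1 min.cobounded2)+
      show "0 < t" unfolding t_def using \<epsilon> u(1)[OF x] by simp
      then show "t < \<epsilon>" using m \<epsilon> by linarith
      have "\<bar>u x - y0\<bar> + t < \<delta>" using m(2) u(1)[OF x] by (simp add: field_simps)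
      moreover have "\<bar>u x - t - y0\<bar> \<le> \<bar>u x - y0\<bar> + t" "\<bar>u x + t - y0\<bar> \<le> \<bar>u x - y0\<bar> + t"
        using \<open>0 < t\<close> by (simp_all add: abs_if)
      ultimately show "\<bar>u x - t - y0\<bar> < \<delta>" "\<bar>u x + t - y0\<bar> < \<delta>" by linarith+
    qed
    have "0 < \<psi> (x, u x - t)" using iff[OF x t(3)] t(1) by simp
    then obtain s1 where s1: "0 < s1" "\<And>x'. dist x x' < s1 \<Longrightarrow> 0 < \<psi> (x', u x - t)"
      using near[OF rin(1)[OF x], of "u x - t" "\<lambda>t. 0 < t"] t(3) by (auto simp: open_Collect_less)
    have "\<psi> (x, u x + t) < 0" using iff[OF x t(4)] t(1) by auto
    then obtain s2 where s2: "0 < s2" "\<And>x'. dist x x' < s2 \<Longrightarrow> \<psi> (x', u x + t) < 0"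
      using near[OF rin(1)[OF x], of "u x + t" "\<lambda>t. t < 0"] t(4) by (auto simp: open_Collect_less)
    obtain s3 where s3: "0 < s3" "ball x s3 \<subseteq> ball x0 r" using x openE[OF open_ball] by metis
    show "\<exists>d>0. \<forall>x'. dist x' x < d \<longrightarrow> dist (u x') (u x) < \<epsilon>"
    proof (intro exI[of _ "min s1 (min s2 s3)"] conjI allI impI)
      show "0 < min s1 (min s2 s3)" using s1 s2 s3 by simp
      fix x' assume "dist x' x < min s1 (min s2 s3)"
      then have d: "dist x x' < s1" "dist x x' < s2" and "x' \<in> ball x s3" by (auto simp: dist_commute)
      then have d3: "x' \<in> ball x0 r" using s3 by blast
      have "u x - t < u x'" using iff[OF d3 t(3)] s1(2)[OF d(1)] by simp
      moreover have "u x' < u x + t"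
        using iff[OF d3 t(4)] s2(2)[OF d(2)] by fastforce
      ultimately show "dist (u x') (u x) < \<epsilon>" using t by (simp add: dist_real_def)
    qed
  qed
  have Oux: "(x, u x) \<in> O'" if "x \<in> ball x0 r" for x using iff[OF that u(1)[OF that]] by blast
  have nz: "A (x, u x) (0, 1) \<noteq> 0" if "x \<in> ball x0 r" for x
    using box(2)[OF rin(1)[OF that], of "u x"] u(1)[OF that] by simp
  have du: "(u has_derivative (\<lambda>h. - (A (x, u x) (h, 0) * inverse (A (x, u x) (0, 1))))) (at x)"
    if "x \<in> ball x0 r" for x
    by (rule implicit_function_derivative[OF dA[OF Oux[OF that]] nz[OF that] open_ball that u(2) cont[OF that]])
  have Cku: "Ck_on k (ball x0 r) u" for k
  proof (induction k)
    case 0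
    have "continuous_on (ball x0 r) u" using continuous_at_imp_continuous_on cont by blast
    then show ?case by simp
  next
    case (Suc k)
    have pair: "Ck_on k (ball x0 r) (\<lambda>x. (x, u x))"
      by (intro Ck_Pair Ck_linear Suc) (auto intro: linearI)
    have AA: "Ck_on k (ball x0 r) (\<lambda>x. A (x, u x) w)" for w
      by (rule Ck_compose[OF _ O(1) pair, where g = "\<lambda>z. A z w"])
        (use Ck_SucD(2)[OF O(2)[of "Suc k"]] Oux in \<open>auto simp: A_def\<close>)
    show ?case
    proof (rule Ck_SucI[OF _ du])
      show "Ck_on k (ball x0 r) (\<lambda>x. - (A (x, u x) (v, 0) * inverse (A (x, u x) (0, 1))))" for v
        by (rule Ck_linear_compose[OF _ _ Ck_mult[OF _ AA Ck_inverse[OF _ AA]], where L = uminus])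
          (use nz in \<open>auto intro: linearI\<close>)
    qed auto
  qed
  have "u x0 = y0" using iff[of x0 y0] r \<delta> z by simp
  then show ?thesis by (rule that[OF r \<delta>(1,2) Cku _ u(1) iff])
qed

lemma gradient_and_hessian:
  fixes u :: "'a::euclidean_space \<Rightarrow> real"
  assumes S: "open S" and u: "Ck_on (Suc (Suc 0)) S u"
  obtains G H where "\<And>x. x \<in> S \<Longrightarrow> (u has_derivative (\<lambda>h. G x \<bullet> h)) (at x)"
    "\<And>x. x \<in> S \<Longrightarrow> (G has_derivative H x) (at x)"
    "\<And>v. continuous_on S (\<lambda>x. H x v)"
proof -
  define D where "D = (\<lambda>b x. frechet_derivative u (at x) b)"
  have D: "Ck_on (Suc 0) S (D b)" for b unfolding D_def using Ck_SucD(2)[OF u] .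
  show ?thesis
  proof (rule that[of "\<lambda>x. \<Sum>b\<in>Basis. D b x *\<^sub>R b" "\<lambda>x v. \<Sum>b\<in>Basis. frechet_derivative (D b) (at x) v *\<^sub>R b"])
    fix x assume x: "x \<in> S"
    have d: "(u has_derivative frechet_derivative u (at x)) (at x)" using Ck_SucD(1)[OF u x] .
    have lin: "linear (frechet_derivative u (at x))" using has_derivative_linear[OF d] .
    have "frechet_derivative u (at x) h = (\<Sum>b\<in>Basis. D b x *\<^sub>R b) \<bullet> h" for h
    proof -
      have "frechet_derivative u (at x) h = frechet_derivative u (at x) (\<Sum>b\<in>Basis. (h \<bullet> b) *\<^sub>R b)"
        by (simp only: euclidean_representation)
      also have "\<dots> = (\<Sum>b\<in>Basis. (h \<bullet> b) * D b x)"
        by (simp add: linear_sum[OF lin] linear_cmul[OF lin] D_def)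
      also have "\<dots> = (\<Sum>b\<in>Basis. D b x *\<^sub>R b) \<bullet> h"
        unfolding inner_sum_left by (intro sum.cong refl) (simp add: inner_commute)
      finally show ?thesis .
    qed
    then show "(u has_derivative (\<lambda>h. (\<Sum>b\<in>Basis. D b x *\<^sub>R b) \<bullet> h)) (at x)" by (intro has_derivative_eq_rhs[OF d] ext)
    show "((\<lambda>x. \<Sum>b\<in>Basis. D b x *\<^sub>R b) has_derivative
        (\<lambda>v. \<Sum>b\<in>Basis. frechet_derivative (D b) (at x) v *\<^sub>R b)) (at x)"
      by (intro has_derivative_sum has_derivative_scaleR_left Ck_SucD(1)[OF D x])
  next
    show "continuous_on S (\<lambda>x. \<Sum>b\<in>Basis. frechet_derivative (D b) (at x) v *\<^sub>R b)" for v
      using Ck_SucD(2)[OF D] by (intro continuous_intros) simp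
  qed
qed

section \<open>The hyperboloid, reflections and horospherical coordinates\<close>

lemma mink_add_left: "mink (x + y) z = mink x z + mink y z"
  and mink_add_right: "mink z (x + y) = mink z x + mink z y"
  and mink_diff_left: "mink (x - y) z = mink x z - mink y z"
  and mink_diff_right: "mink z (x - y) = mink z x - mink z y"
  and mink_minus_left: "mink (- x) z = - mink x z"
  and mink_minus_right: "mink z (- x) = - mink z x"
  and mink_scaleR_left: "mink (c *\<^sub>R x) z = c * mink x z"
  and mink_scaleR_right: "mink z (c *\<^sub>R x) = c * mink z x"
  and mink_zero_left: "mink 0 z = 0"
  and mink_zero_right: "mink z 0 = 0"
  by (simp_all add: mink_def algebra_simps)

lemmas mink_simps = mink_add_left mink_add_right mink_diff_left mink_diff_right
  mink_minus_left mink_minus_right mink_scaleR_left mink_scaleR_right mink_zero_left mink_zero_right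

lemma mink_commute: "mink x y = mink y x"
  by (simp add: mink_def inner_commute mult.commute)

lemma bounded_bilinear_mink: "bounded_bilinear (mink :: 'n::finite minkowski \<Rightarrow> _)"
proof
  show "\<exists>K. \<forall>a b :: 'n minkowski. norm (mink a b) \<le> norm a * norm b * K"
  proof (intro exI[of _ 2] allI)
    fix a b :: "'n minkowski"
    have "\<bar>fst a \<bullet> fst b\<bar> \<le> norm (fst a) * norm (fst b)" by (rule Cauchy_Schwarz_ineq2)
    also have "\<dots> \<le> norm a * norm b" 
      using norm_fst_le[of "fst a" "snd a"] norm_fst_le[of "fst b" "snd b"] by (intro mult_mono) auto
    finally have 1: "\<bar>fst a \<bullet> fst b\<bar> \<le> norm a * norm b" .
    have "\<bar>snd a * snd b\<bar> = norm (snd a) * norm (snd b)" by (simp add: abs_mult)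
    also have "\<dots> \<le> norm a * norm b" 
      using norm_snd_le[of "snd a" "fst a"] norm_snd_le[of "snd b" "fst b"] by (intro mult_mono) auto
    finally show "norm (mink a b) \<le> norm a * norm b * 2" using 1 unfolding mink_def real_norm_def by linarith
  qed
qed (simp_all add: mink_simps)

lemmas mink_has_derivative = bounded_bilinear.FDERIV[OF bounded_bilinear_mink]
lemmas mink_continuous_on = bounded_bilinear.continuous_on[OF bounded_bilinear_mink]
lemmas mink_tendsto = bounded_bilinear.tendsto[OF bounded_bilinear_mink]

lemma hyp_space_iff: "p \<in> hyp_space \<longleftrightarrow> snd p = sqrt (1 + (norm (fst p))\<^sup>2)"
proof
  assume "p \<in> hyp_space"
  then have "(snd p)\<^sup>2 = 1 + (norm (fst p))\<^sup>2" "0 < snd p"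
    unfolding hyp_space_def mink_def power2_norm_eq_inner by (simp_all add: power2_eq_square)
  then show "snd p = sqrt (1 + (norm (fst p))\<^sup>2)" by (metis real_sqrt_unique less_imp_le)
next
  assume s: "snd p = sqrt (1 + (norm (fst p))\<^sup>2)"
  have "0 < 1 + (norm (fst p))\<^sup>2" by (simp add: add_pos_nonneg)
  then have "0 < snd p" "snd p * snd p = 1 + (norm (fst p))\<^sup>2"
    unfolding s by (simp_all add: add_nonneg_nonneg)
  then show "p \<in> hyp_space" unfolding hyp_space_def mink_def by (simp add: power2_norm_eq_inner)
qed

lemma hyp_space_snd: "p \<in> hyp_space \<Longrightarrow> snd p = norm (fst p, 1::real)"
  by (simp add: hyp_space_iff norm_prod_def add.commute)

text \<open>The Cauchy-Schwarz inequality for the Euclidean vectors \<open>(fst p, 1)\<close> and \<open>(fst q, 1)\<close>, whose norms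
are the time components.\<close>

lemma hyp_mink_le:
  assumes "p \<in> hyp_space" "q \<in> hyp_space"
  shows "mink p q \<le> -1"
proof -
  have "(fst p, 1::real) \<bullet> (fst q, 1::real) \<le> norm (fst p, 1::real) * norm (fst q, 1::real)"
    by (rule norm_cauchy_schwarz)
  then show ?thesis
    unfolding mink_def hyp_space_snd[OF assms(1), symmetric] hyp_space_snd[OF assms(2), symmetric] inner_Pair
    by simp
qed

lemma hyp_mink_less:
  assumes "p \<in> hyp_space" "q \<in> hyp_space" "p \<noteq> q"
  shows "mink p q < -1"
proof (rule ccontr)
  assume "\<not> mink p q < -1"
  then have "(fst p, 1::real) \<bullet> (fst q, 1::real) = norm (fst p, 1::real) * norm (fst q, 1::real)"
    using hyp_mink_le[OF assms(1,2)]
    unfolding mink_def hyp_space_snd[OF assms(1), symmetric] hyp_space_snd[OF assms(2), symmetric] inner_Pair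
    by simp
  then have "norm (fst p, 1::real) *\<^sub>R (fst q, 1::real) = norm (fst q, 1::real) *\<^sub>R (fst p, 1::real)"
    unfolding norm_cauchy_schwarz_eq .
  then have e: "norm (fst p, 1::real) = norm (fst q, 1::real)" "norm (fst p, 1::real) *\<^sub>R fst q = norm (fst q, 1::real) *\<^sub>R fst p"
    by auto
  moreover have "norm (fst p, 1::real) \<noteq> 0" by (simp add: zero_prod_def)
  ultimately have "fst p = fst q" by (metis scaleR_cancel_left)
  moreover have "snd p = snd q" using e(1) by (simp only: hyp_space_snd[OF assms(1)] hyp_space_snd[OF assms(2)])
  ultimately show False using assms(3) by (simp add: prod_eq_iff)
qed

lemma hyp_spaceI_mink:
  assumes "mink p p = -1" "q \<in> hyp_space" "mink p q < 0"
  shows "p \<in> hyp_space"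
proof (rule ccontr)
  assume n: "p \<notin> hyp_space"
  have "snd p \<noteq> 0"
  proof
    assume "snd p = 0"
    then have "fst p \<bullet> fst p = -1" using assms(1) by (simp add: mink_def)
    then show False using inner_ge_zero[of "fst p"] by simp
  qed
  then have "- p \<in> hyp_space" using n assms(1) unfolding hyp_space_def by (auto simp: mink_simps)
  then have "mink (- p) q \<le> -1" using hyp_mink_le assms(2) by blast
  then show False using assms(3) by (simp add: mink_simps)
qed

definition reflect :: "'n::finite minkowski \<Rightarrow> 'n minkowski \<Rightarrow> 'n minkowski" where
  "reflect w p = p - (2 * mink p w / mink w w) *\<^sub>R w"

lemma linear_reflect: "linear (reflect w)"
  by (rule linearI) (simp_all add: reflect_def mink_simps algebra_simps add_divide_distrib)

lemma reflect_isometry: "mink w w \<noteq> 0 \<Longrightarrow> mink (reflect w p) (reflect w p') = mink p p'"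
  unfolding reflect_def mink_simps mink_commute[of w p] mink_commute[of w p'] by (simp add: field_simps)

lemma mink_reflect: "mink w w \<noteq> 0 \<Longrightarrow> mink (reflect w p) w = - mink p w"
  by (simp add: reflect_def mink_simps)

lemma reflect_reflect: "mink w w \<noteq> 0 \<Longrightarrow> reflect w (reflect w p) = p"
proof -
  assume "mink w w \<noteq> 0"
  then have "reflect w (reflect w p) = reflect w p + (2 * mink p w / mink w w) *\<^sub>R w"
    unfolding reflect_def[of w "reflect w p"] by (simp add: mink_reflect)
  then show ?thesis by (simp add: reflect_def)
qed

lemma reflect_fixed: "mink p w = 0 \<Longrightarrow> reflect w p = p"
  by (simp add: reflect_def)

lemma reflect_adjoint: "mink w w \<noteq> 0 \<Longrightarrow> mink (reflect w p) p' = mink p (reflect w p')"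
  by (metis reflect_isometry reflect_reflect)

lemma reflect_hyp_space:
  assumes w: "0 < mink w w" and p: "p \<in> hyp_space"
  shows "reflect w p \<in> hyp_space"
proof (rule hyp_spaceI_mink[OF _ p])
  show "mink (reflect w p) (reflect w p) = -1" using reflect_isometry[of w p p] w p by (simp add: hyp_space_def)
  have "mink (reflect w p) p = -1 - 2 * (mink p w)\<^sup>2 / mink w w"
    using p by (simp add: reflect_def mink_simps hyp_space_def mink_commute[of w p] power2_eq_square)
  moreover have "0 \<le> 2 * (mink p w)\<^sup>2 / mink w w" using w by simp
  ultimately show "mink (reflect w p) p < 0" by linarith
qed

lemma continuous_on_reflect [continuous_intros]:
  assumes "continuous_on S w" "continuous_on S p" "\<And>x. x \<in> S \<Longrightarrow> mink (w x) (w x) \<noteq> 0"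
  shows "continuous_on S (\<lambda>x. reflect (w x) (p x))"
  unfolding reflect_def using assms
  by (intro continuous_intros mink_continuous_on) auto

text \<open>Horospherical coordinates at \<open>q\<close> with unit normal \<open>\<nu>\<close>: \<open>horo_a\<close> and \<open>horo_b\<close> are null vectors with
sum \<open>q\<close> and difference \<open>-\<nu>\<close>, and \<open>(x, y) \<mapsto> horo q \<nu> e x y\<close>, \<open>y > 0\<close>, is the upper half-space model,
normalised so that \<open>(0, 1)\<close> is \<open>q\<close> and \<open>\<nu>\<close> points in the direction of decreasing \<open>y\<close>.  Its inverse
is \<open>(horo_x, horo_y)\<close>.\<close>

definition horo_a :: "'n::finite minkowski \<Rightarrow> 'n minkowski \<Rightarrow> 'n minkowski" where
  "horo_a q \<nu> = (1/2) *\<^sub>R (q - \<nu>)"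

definition horo_b :: "'n::finite minkowski \<Rightarrow> 'n minkowski \<Rightarrow> 'n minkowski" where
  "horo_b q \<nu> = (1/2) *\<^sub>R (q + \<nu>)"

definition horo ::
  "'n::finite minkowski \<Rightarrow> 'n minkowski \<Rightarrow> (real ^ 'n \<Rightarrow> 'n minkowski) \<Rightarrow> real ^ 'n \<Rightarrow> real \<Rightarrow> 'n minkowski" where
  "horo q \<nu> e x y = (1 / y) *\<^sub>R (horo_b q \<nu> + e x + (x \<bullet> x + y\<^sup>2) *\<^sub>R horo_a q \<nu>)"

definition horo_y :: "'n::finite minkowski \<Rightarrow> 'n minkowski \<Rightarrow> 'n minkowski \<Rightarrow> real" where
  "horo_y q \<nu> p = - 1 / (2 * mink p (horo_a q \<nu>))"

definition horo_x ::
  "'n::finite minkowski \<Rightarrow> 'n minkowski \<Rightarrow> (real ^ 'n \<Rightarrow> 'n minkowski) \<Rightarrow> 'n minkowski \<Rightarrow> real ^ 'n" where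
  "horo_x q \<nu> e p = horo_y q \<nu> p *\<^sub>R (\<chi> i. mink p (e (axis i 1)))"

locale hyp_frame =
  fixes q \<nu> :: "'n::finite minkowski" and e :: "real ^ 'n \<Rightarrow> 'n minkowski"
  assumes q_hyp: "q \<in> hyp_space"
    and \<nu>_unit: "mink \<nu> \<nu> = 1" and q_\<nu>: "mink q \<nu> = 0"
    and e_linear: "linear e" and e_iso: "mink (e x) (e y) = x \<bullet> y"
    and q_e: "mink q (e x) = 0" and \<nu>_e: "mink \<nu> (e x) = 0"
begin

abbreviation "a \<equiv> horo_a q \<nu>"
abbreviation "b \<equiv> horo_b q \<nu>"
abbreviation "\<Psi> \<equiv> horo q \<nu> e"

lemma q_q: "mink q q = -1" using q_hyp by (simp add: hyp_space_def)

lemma mink_frame: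
  "mink a a = 0" "mink b b = 0" "mink a b = - 1 / 2" "mink b a = - 1 / 2"
  "mink a (e x) = 0" "mink (e x) a = 0" "mink b (e x) = 0" "mink (e x) b = 0"
  "mink \<nu> q = 0" "mink (e x) q = 0" "mink (e x) \<nu> = 0"
  "mink a q = - 1 / 2" "mink b q = - 1 / 2"
  by (simp_all add: horo_a_def horo_b_def mink_simps q_q \<nu>_unit q_\<nu> q_e \<nu>_e mink_commute[of \<nu> q]
      mink_commute[of "e x"])

lemma ab: "a + b = q" "b - a = \<nu>"
  by (simp_all add: horo_a_def horo_b_def algebra_simps scaleR_2[symmetric])

text \<open>The vectors \<open>q\<close>, \<open>\<nu>\<close> and the range of \<open>e\<close> are Minkowski-orthonormal, hence independent, and there are as
many as the dimension.\<close>

lemma expand: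
  "p = (- mink p q) *\<^sub>R q + mink p \<nu> *\<^sub>R \<nu> + e (\<chi> i. mink p (e (axis i 1)))"
proof -
  define T where "T = (\<lambda>z :: 'n minkowski. e (fst (fst z)) + snd (fst z) *\<^sub>R \<nu> + snd z *\<^sub>R q)"
  have lin: "linear T"
    unfolding T_def
    by (rule linearI) (simp_all add: linear_add[OF e_linear] linear_cmul[OF e_linear] algebra_simps)
  have Tq: "mink (T z) q = - snd z" "mink (T z) \<nu> = snd (fst z)" "mink (T z) (e x) = fst (fst z) \<bullet> x" for z x
    by (simp_all add: T_def mink_simps mink_frame q_q \<nu>_unit q_\<nu> e_iso q_e \<nu>_e)
  have "inj T"
  proof (rule injI)
    fix z z' assume "T z = T z'"
    then have "snd z = snd z'" "snd (fst z) = snd (fst z')" "\<And>x. fst (fst z) \<bullet> x = fst (fst z') \<bullet> x"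
      using Tq by (metis neg_equal_iff_equal, metis, metis)
    moreover from this(3) have "fst (fst z) = fst (fst z')" using vector_eq_rdot by blast
    ultimately show "z = z'" by (simp add: prod_eq_iff)
  qed
  then have "surj T" using lin linear_injective_imp_surjective by blast
  then obtain z where z: "p = T z" by blast
  have "(\<chi> i. mink p (e (axis i 1))) = fst (fst z)"
    unfolding z Tq by (simp add: vec_eq_iff inner_axis)
  then show ?thesis unfolding z Tq by (simp add: T_def)
qed

lemma mink_a_neg:
  assumes "p \<in> hyp_space"
  shows "mink p a < 0"
proof -
  define s where "s = - mink p q"
  define t where "t = mink p \<nu>"
  define x where "x = (\<chi> i. mink p (e (axis i 1)))"
  have s: "1 \<le> s" using hyp_mink_le[OF assms q_hyp] by (simp add: s_def)
  have p: "p = s *\<^sub>R q + t *\<^sub>R \<nu> + e x" using expand[of p] by (simp add: s_def t_def x_def)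
  have "mink p p = - s\<^sup>2 + t\<^sup>2 + x \<bullet> x"
    unfolding p by (simp add: mink_simps mink_frame q_q \<nu>_unit q_\<nu> e_iso q_e \<nu>_e power2_eq_square)
  then have "s\<^sup>2 = 1 + t\<^sup>2 + x \<bullet> x" using assms by (simp add: hyp_space_def)
  then have "t\<^sup>2 < s\<^sup>2" using inner_ge_zero[of x] by linarith
  then have "\<bar>t\<bar> < \<bar>s\<bar>" using power2_less_imp_less[of "\<bar>t\<bar>" "\<bar>s\<bar>"] by simp
  then have "- t < s" using s by linarith
  moreover have "mink p a = (- s - t) / 2" by (simp add: horo_a_def mink_simps s_def t_def)
  ultimately show ?thesis by simp
qed

lemma horo_self:
  assumes "y \<noteq> 0"
  shows "mink (\<Psi> x y) (\<Psi> x y) = -1"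
proof -
  define V where "V = b + e x + (x \<bullet> x + y\<^sup>2) *\<^sub>R a"
  have "mink V V = - y\<^sup>2"
    unfolding V_def by (simp add: mink_simps mink_frame e_iso)
  then show ?thesis
    unfolding horo_def V_def[symmetric] mink_scaleR_left mink_scaleR_right using assms
    by (simp add: power2_eq_square)
qed

lemma horo_hyp:
  assumes y: "0 < y"
  shows "\<Psi> x y \<in> hyp_space"
proof (rule hyp_spaceI_mink[OF _ q_hyp])
  show "mink (\<Psi> x y) (\<Psi> x y) = -1" using y by (simp add: horo_self)
  have "mink (\<Psi> x y) q = (1 / y) * (- 1 / 2 - (x \<bullet> x + y\<^sup>2) / 2)"
    by (simp add: horo_def mink_simps mink_frame)
  moreover have "- 1 / 2 - (x \<bullet> x + y\<^sup>2) / 2 < 0" 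
  proof -
    have "0 \<le> x \<bullet> x + y\<^sup>2" by simp
    then have "- 1 < x \<bullet> x + y\<^sup>2" by linarith
    then show ?thesis by (simp add: field_simps)
  qed
  ultimately show "mink (\<Psi> x y) q < 0" using y by (metis mult_pos_neg zero_less_divide_1_iff)
qed

lemma mink_horo_a: "y \<noteq> 0 \<Longrightarrow> mink (\<Psi> x y) a = - 1 / (2 * y)"
  by (simp add: horo_def mink_simps mink_frame)

lemma horo_y_horo: "0 < y \<Longrightarrow> horo_y q \<nu> (\<Psi> x y) = y"
  by (simp add: horo_y_def mink_horo_a)

lemma horo_x_horo: "0 < y \<Longrightarrow> horo_x q \<nu> e (\<Psi> x y) = x"
proof -
  assume y: "0 < y"
  have "mink (\<Psi> x y) (e z) = (1 / y) * (x \<bullet> z)" for z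
    by (simp add: horo_def mink_simps mink_frame e_iso)
  then show ?thesis unfolding horo_x_def horo_y_horo[OF y] using y by (simp add: vec_eq_iff inner_axis)
qed

lemma horo_y_pos: "p \<in> hyp_space \<Longrightarrow> 0 < horo_y q \<nu> p"
  using mink_a_neg[of p] by (simp add: horo_y_def zero_less_divide_iff)

text \<open>Write \<open>p = s q + t \<nu> + e x\<close>; then \<open>y (s + t) = 1\<close> by the definition of \<open>horo_y\<close>, and
\<open>mink p p = -1\<close> gives the coefficient of the other null vector.\<close>

lemma horo_chart:
  assumes "p \<in> hyp_space"
  shows "\<Psi> (horo_x q \<nu> e p) (horo_y q \<nu> p) = p"
proof -
  define y where "y = horo_y q \<nu> p"
  define s where "s = - mink p q"
  define t where "t = mink p \<nu>"
  define x where "x = (\<chi> i. mink p (e (axis i 1)))"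
  have p: "p = s *\<^sub>R q + t *\<^sub>R \<nu> + e x" using expand[of p] by (simp add: s_def t_def x_def)
  have y: "0 < y" unfolding y_def using horo_y_pos[OF assms] .
  have st: "y * (s + t) = 1"
  proof -
    have m: "mink p a = - (s + t) / 2" by (simp add: horo_a_def mink_simps s_def t_def)
    moreover have "y * mink p a = - 1 / 2" using mink_a_neg[OF assms] by (simp add: y_def horo_y_def)
    ultimately have "y * (- (s + t) / 2) = - 1 / 2" by (simp only:)
    then show ?thesis by (simp add: algebra_simps)
  qed
  have "mink p p = - s\<^sup>2 + t\<^sup>2 + x \<bullet> x"
    unfolding p by (simp add: mink_simps mink_frame q_q \<nu>_unit q_\<nu> e_iso q_e \<nu>_e power2_eq_square)
  then have "s\<^sup>2 = 1 + t\<^sup>2 + x \<bullet> x" using assms by (simp add: hyp_space_def)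
  then have "1 + x \<bullet> x = s\<^sup>2 - t\<^sup>2" by simp
  then have "y\<^sup>2 * (1 + x \<bullet> x) = y\<^sup>2 * (s\<^sup>2 - t\<^sup>2)" by simp
  also have "\<dots> = (y * (s + t)) * (y * (s - t))" by (simp add: power2_eq_square algebra_simps)
  finally have "y\<^sup>2 * (1 + x \<bullet> x) = (y * (s + t)) * (y * (s - t))" .
  then have xx: "y\<^sup>2 * (x \<bullet> x) + y\<^sup>2 = y * (s - t)" unfolding st by (simp add: algebra_simps)
  have "horo_x q \<nu> e p = y *\<^sub>R x" by (simp add: horo_x_def y_def x_def)
  then have "\<Psi> (horo_x q \<nu> e p) (horo_y q \<nu> p) = (1 / y) *\<^sub>R (b + e (y *\<^sub>R x) + (y\<^sup>2 * (x \<bullet> x) + y\<^sup>2) *\<^sub>R a)"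
    by (simp add: horo_def y_def[symmetric] power2_eq_square mult.assoc)
  also have "\<dots> = (1 / y) *\<^sub>R ((y * (s + t)) *\<^sub>R b + y *\<^sub>R e x + (y * (s - t)) *\<^sub>R a)"
    unfolding xx st by (simp add: linear_cmul[OF e_linear])
  also have "\<dots> = (s + t) *\<^sub>R b + e x + (s - t) *\<^sub>R a" using y by (simp add: scaleR_right_distrib)
  also have "\<dots> = s *\<^sub>R (a + b) + t *\<^sub>R (b - a) + e x" by (simp add: algebra_simps)
  also have "\<dots> = p" unfolding ab using p by simp
  finally show ?thesis .
qed

lemma continuous_on_horo_y: "continuous_on hyp_space (horo_y q \<nu>)"
  unfolding horo_y_def using mink_a_neg
  by (intro continuous_intros mink_continuous_on) (auto simp: less_imp_neq)

lemma continuous_on_horo_x: "continuous_on hyp_space (horo_x q \<nu> e)"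
  unfolding horo_x_def
  by (intro continuous_intros continuous_on_horo_y continuous_on_vec_lambda mink_continuous_on)

lemma horo_geodesic: "hyp_geodesic q \<nu> t = \<Psi> 0 (exp (- t))" "hyp_geodesic q (- \<nu>) t = \<Psi> 0 (exp t)"
proof -
  have P: "\<Psi> 0 (exp s) = exp (- s) *\<^sub>R b + exp s *\<^sub>R a" for s
    by (simp add: horo_def linear_0[OF e_linear] exp_minus power2_eq_square scaleR_right_distrib field_simps)
  show "hyp_geodesic q \<nu> t = \<Psi> 0 (exp (- t))"
    unfolding hyp_geodesic_def P horo_a_def horo_b_def cosh_def sinh_def by (simp add: algebra_simps)
  show "hyp_geodesic q (- \<nu>) t = \<Psi> 0 (exp t)"
    unfolding hyp_geodesic_def P horo_a_def horo_b_def cosh_def sinh_def by (simp add: algebra_simps)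
qed

lemma horo_base: "\<Psi> 0 1 = q"
  using horo_geodesic(1)[of 0] by (simp add: hyp_geodesic_def)

lemma Ck_horo: "Ck_on k {z. 0 < snd z} (\<lambda>z. \<Psi> (fst z) (snd z))"
proof -
  let ?S = "{z :: (real ^ 'n) \<times> real. 0 < snd z}"
  have S: "open ?S" by (intro open_Collect_less continuous_intros)
  have f: "Ck_on k ?S (\<lambda>z. fst z $ i)" for i
    by (rule Ck_linear[OF S]) (auto intro!: linearI)
  have s: "Ck_on k ?S snd" by (rule Ck_linear[OF S]) (rule linear_snd)
  have "(\<lambda>z. fst z \<bullet> fst z + (snd z)\<^sup>2) = (\<lambda>z :: (real ^ 'n) \<times> real. (\<Sum>i\<in>UNIV. fst z $ i * fst z $ i) + snd z * snd z)"
    by (simp add: inner_vec_def power2_eq_square)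
  moreover have "Ck_on k ?S (\<lambda>z. (\<Sum>i\<in>UNIV. fst z $ i * fst z $ i) + snd z * snd z)"
    by (intro Ck_add Ck_sum Ck_mult f s S finite)
  ultimately have 1: "Ck_on k ?S (\<lambda>z. fst z \<bullet> fst z + (snd z)\<^sup>2)" by simp
  have 2: "Ck_on k ?S (\<lambda>z. e (fst z))"
    by (rule Ck_linear[OF S]) (use linear_compose[OF linear_fst e_linear] in \<open>simp add: o_def\<close>)
  have "Ck_on k ?S (\<lambda>z. inverse (snd z) *\<^sub>R (b + e (fst z) + (fst z \<bullet> fst z + (snd z)\<^sup>2) *\<^sub>R a))"
    by (intro Ck_scaleR Ck_inverse Ck_add Ck_const 1 2 S s) auto
  then show ?thesis by (simp add: horo_def inverse_eq_divide)
qed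

lemma continuous_on_horo:
  assumes "continuous_on S f" "continuous_on S g" "\<And>x. x \<in> S \<Longrightarrow> 0 < g x"
  shows "continuous_on S (\<lambda>x. \<Psi> (f x) (g x))"
proof -
  have "continuous_on {z. 0 < snd z} (\<lambda>z. \<Psi> (fst z) (snd z))" using Ck_continuous[OF Ck_horo] .
  moreover have "(\<lambda>x. (f x, g x)) ` S \<subseteq> {z. 0 < snd z}" using assms(3) by auto
  ultimately show ?thesis using continuous_on_compose2[OF _ continuous_on_Pair[OF assms(1,2)]] by fastforce
qed

text \<open>Reflections carry frames to frames and, by linearity, the coordinates of one to those of the other.
This is why a hypersurface and its mirror image can be compared as two graphs over the same ball.\<close>

lemma hyp_frame_reflect:
  assumes "0 < mink w w"
  shows "hyp_frame (reflect w q) (reflect w \<nu>) (\<lambda>x. reflect w (e x))"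
proof (rule hyp_frame.intro)
  show "linear (\<lambda>x. reflect w (e x))" using linear_compose[OF e_linear linear_reflect] by (simp add: o_def)
qed (use assms in \<open>simp_all add: reflect_hyp_space q_hyp reflect_isometry \<nu>_unit q_\<nu> e_iso q_e \<nu>_e\<close>)

lemma reflect_horo: "reflect w (\<Psi> x y) = horo (reflect w q) (reflect w \<nu>) (\<lambda>x. reflect w (e x)) x y"
  by (simp add: horo_def horo_a_def horo_b_def linear_add[OF linear_reflect] linear_cmul[OF linear_reflect]
      linear_diff[OF linear_reflect])

text \<open>\<open>dF x y g\<close> is the differential at \<open>x\<close> of \<open>x \<mapsto> \<Psi> x (u x)\<close> when \<open>u x = y\<close> and \<open>u\<close> has gradient \<open>g\<close>.  The
vector \<open>Z x y g\<close> is orthogonal to the graph and has length \<open>slope g\<close>; this form of the normal is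
chosen because its derivative contains \<open>D\<^sup>2u\<close> in a single term.\<close>

definition dF :: "real ^ 'n \<Rightarrow> real \<Rightarrow> real ^ 'n \<Rightarrow> real ^ 'n \<Rightarrow> 'n minkowski" where
  "dF x y g \<xi> = (1 / y) *\<^sub>R (e \<xi> + (2 * (x \<bullet> \<xi>) + 2 * y * (g \<bullet> \<xi>)) *\<^sub>R a) - ((g \<bullet> \<xi>) / y) *\<^sub>R \<Psi> x y"

definition Z :: "real ^ 'n \<Rightarrow> real \<Rightarrow> real ^ 'n \<Rightarrow> 'n minkowski" where
  "Z x y g = e g + \<Psi> x y + (2 * (x \<bullet> g) - 2 * y) *\<^sub>R a"

definition graph_normal :: "real ^ 'n \<Rightarrow> real \<Rightarrow> real ^ 'n \<Rightarrow> 'n minkowski" where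
  "graph_normal x y g = (1 / slope g) *\<^sub>R Z x y g"

lemma mink_point:
  assumes "y \<noteq> 0"
  shows "mink (\<Psi> x y) (e \<xi>) = (x \<bullet> \<xi>) / y" "mink (e \<xi>) (\<Psi> x y) = (x \<bullet> \<xi>) / y"
    "mink (\<Psi> x y) a = - 1 / (2 * y)" "mink a (\<Psi> x y) = - 1 / (2 * y)"
    "mink (\<Psi> x y) (\<Psi> x y) = -1"
proof -
  show 1: "mink (\<Psi> x y) (e \<xi>) = (x \<bullet> \<xi>) / y"
    by (simp add: horo_def mink_simps mink_frame e_iso)
  then show "mink (e \<xi>) (\<Psi> x y) = (x \<bullet> \<xi>) / y" by (simp add: mink_commute)
  show "mink (\<Psi> x y) a = - 1 / (2 * y)" by (rule mink_horo_a[OF assms])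
  then show "mink a (\<Psi> x y) = - 1 / (2 * y)" by (simp add: mink_commute)
  show "mink (\<Psi> x y) (\<Psi> x y) = -1" by (rule horo_self[OF assms])
qed

lemma mink_dF_dF:
  assumes "y \<noteq> 0"
  shows "mink (dF x y g \<xi>) (dF x y g \<eta>) = (\<xi> \<bullet> \<eta> + (g \<bullet> \<xi>) * (g \<bullet> \<eta>)) / y\<^sup>2"
  using assms unfolding dF_def
  by (simp add: mink_simps mink_frame e_iso mink_point field_simps power2_eq_square)

lemma mink_Z:
  assumes "y \<noteq> 0"
  shows "mink (Z x y g) (Z x y g) = (slope g)\<^sup>2" "mink (Z x y g) (\<Psi> x y) = 0"
    "mink (Z x y g) (dF x y g \<xi>) = 0"
    "mink (e \<zeta> + (2 * (x \<bullet> \<zeta>)) *\<^sub>R a) (dF x y g \<xi>) = (\<zeta> \<bullet> \<xi>) / y"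
proof -
  show "mink (Z x y g) (Z x y g) = (slope g)\<^sup>2" unfolding slope_square Z_def using assms
    by (simp add: mink_simps mink_frame e_iso mink_point field_simps)
  show "mink (Z x y g) (\<Psi> x y) = 0" unfolding Z_def using assms
    by (simp add: mink_simps mink_frame e_iso mink_point field_simps)
  show "mink (Z x y g) (dF x y g \<xi>) = 0" unfolding Z_def dF_def using assms
    by (simp add: mink_simps mink_frame e_iso mink_point field_simps)
  show "mink (e \<zeta> + (2 * (x \<bullet> \<zeta>)) *\<^sub>R a) (dF x y g \<xi>) = (\<zeta> \<bullet> \<xi>) / y" unfolding dF_def using assms
    by (simp add: mink_simps mink_frame e_iso mink_point field_simps)
qed

end

section \<open>Local structure and the two sides of a hypersurface\<close>

lemma smooth_onD: "smooth_on S f \<Longrightarrow> Ck_on k S f"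
  by (simp add: smooth_on_def)

lemma smooth_on_has_derivative:
  "smooth_on S f \<Longrightarrow> x \<in> S \<Longrightarrow> (f has_derivative frechet_derivative f (at x)) (at x)"
  using Ck_SucD(1)[OF smooth_onD[of S f "Suc 0"]] by blast

text \<open>Projection to the space components is a homeomorphism onto a vector space; balls there are
connected.\<close>

lemma hyp_space_locally_connected:
  assumes p: "p \<in> hyp_space" and O: "open O'" "p \<in> O'"
  obtains W where "open W" "p \<in> W" "W \<inter> hyp_space \<subseteq> O'" "connected (W \<inter> hyp_space)"
proof -
  define \<iota> :: "(real ^ 'a) \<times> real \<Rightarrow> 'a minkowski" where "\<iota> = (\<lambda>X. (X, sqrt (1 + (norm X)\<^sup>2)))"
  have cont: "continuous_on UNIV \<iota>" unfolding \<iota>_def by (intro continuous_intros)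
  have \<iota>p: "\<iota> (fst z) = z" if "z \<in> hyp_space" for z
    using that unfolding \<iota>_def hyp_space_iff by (simp add: prod_eq_iff)
  have \<iota>H: "\<iota> X \<in> hyp_space" for X unfolding hyp_space_iff \<iota>_def by simp
  have "open (\<iota> -` O')" using cont O(1) by (simp add: continuous_on_open_vimage)
  moreover have "fst p \<in> \<iota> -` O'" using \<iota>p[OF p] O(2) by simp
  ultimately obtain r where r: "0 < r" "ball (fst p) r \<subseteq> \<iota> -` O'" using openE by blast
  define W where "W = fst -` ball (fst p) r \<inter> (UNIV :: 'a minkowski set)"
  have WH: "W \<inter> hyp_space = \<iota> ` ball (fst p) r"
  proof
    show "W \<inter> hyp_space \<subseteq> \<iota> ` ball (fst p) r"
    proof
      fix z assume z: "z \<in> W \<inter> hyp_space"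
      then have "z = \<iota> (fst z)" "fst z \<in> ball (fst p) r" using \<iota>p unfolding W_def by auto
      then show "z \<in> \<iota> ` ball (fst p) r" by blast
    qed
    show "\<iota> ` ball (fst p) r \<subseteq> W \<inter> hyp_space" using \<iota>H unfolding W_def \<iota>_def by auto
  qed
  show ?thesis
  proof (rule that[of W])
    show "open W" unfolding W_def by (simp add: open_vimage_fst)
    show "p \<in> W" unfolding W_def using r by simp
    show "W \<inter> hyp_space \<subseteq> O'" unfolding WH using r by auto
    show "connected (W \<inter> hyp_space)" unfolding WH
      by (intro connected_continuous_image continuous_on_subset[OF cont]) auto
  qed
qed

lemma exterior_subset: "exterior_region M \<subseteq> hyp_space - M"
  by (auto simp: exterior_region_def)

lemma exterior_connected:
  assumes S: "connected S" "S \<subseteq> hyp_space - M" and x: "x \<in> S" "x \<in> exterior_region M"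
  shows "S \<subseteq> exterior_region M"
proof
  fix y assume y: "y \<in> S"
  have "connected_component (hyp_space - M) x y" using S x(1) y unfolding connected_component_def by blast
  then have "connected_component_set (hyp_space - M) x = connected_component_set (hyp_space - M) y"
    by (metis connected_component_eq mem_Collect_eq)
  then show "y \<in> exterior_region M" using x(2) S y unfolding exterior_region_def by auto
qed

lemma exterior_locally_constant:
  assumes M: "closed M" and p: "p \<in> hyp_space - M"
  obtains W where "open W" "p \<in> W"
    "W \<inter> hyp_space \<subseteq> exterior_region M \<or> W \<inter> hyp_space \<inter> exterior_region M = {}"
    "W \<inter> hyp_space \<inter> M = {}"
proof -
  obtain W where W: "open W" "p \<in> W" "W \<inter> hyp_space \<subseteq> - M" "connected (W \<inter> hyp_space)"
    using hyp_space_locally_connected[of p "- M"] M p by auto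
  then have "W \<inter> hyp_space \<subseteq> exterior_region M \<or> W \<inter> hyp_space \<inter> exterior_region M = {}"
    using exterior_connected[OF W(4), of M] by blast
  then show ?thesis using that[OF W(1,2)] W(3) by blast
qed

lemma tangent_space_subset:
  assumes "M \<subseteq> hyp_space" "v \<in> tangent_space M p"
  shows "mink p v = 0"
proof -
  obtain \<gamma> \<epsilon> where \<gamma>: "0 < \<epsilon>" "\<gamma> ` {-\<epsilon><..<\<epsilon>} \<subseteq> M" "\<gamma> (0::real) = p" "(\<gamma> has_vector_derivative v) (at 0)"
    using assms(2) unfolding tangent_space_def by blast
  have d: "((\<lambda>t. mink (\<gamma> t) (\<gamma> t)) has_derivative (\<lambda>h. mink (\<gamma> 0) (h *\<^sub>R v) + mink (h *\<^sub>R v) (\<gamma> 0))) (at 0)"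
    using mink_has_derivative[OF \<gamma>(4)[unfolded has_vector_derivative_def] \<gamma>(4)[unfolded has_vector_derivative_def]] .
  have "((\<lambda>t. mink (\<gamma> t) (\<gamma> t)) has_derivative (\<lambda>h. 0)) (at 0)"
  proof (rule has_derivative_transform_within_open[of "\<lambda>t. -1"])
    show "-1 = mink (\<gamma> t) (\<gamma> t)" if "t \<in> {-\<epsilon><..<\<epsilon>}" for t
      using \<gamma>(2) assms(1) that unfolding hyp_space_def by fastforce
  qed (use \<gamma>(1) in auto)
  then have "(\<lambda>h. mink (\<gamma> 0) (h *\<^sub>R v) + mink (h *\<^sub>R v) (\<gamma> 0)) = (\<lambda>h. 0)"
    using has_derivative_unique[OF d] by blast
  from fun_cong[OF this, of 1] show ?thesis using \<gamma>(3) by (simp add: mink_commute)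
qed

text \<open>A curve in \<open>M\<close> stays in the zero set of the defining function.\<close>

lemma tangent_space_kernel:
  assumes U: "open U" "smooth_on U \<phi>" "M \<inter> U = {x \<in> hyp_space \<inter> U. \<phi> x = (0::real)}"
    and p: "p \<in> M \<inter> U" and v: "v \<in> tangent_space M p"
  shows "frechet_derivative \<phi> (at p) v = 0"
proof -
  obtain \<gamma> \<epsilon> where \<gamma>: "0 < \<epsilon>" "\<gamma> ` {-\<epsilon><..<\<epsilon>} \<subseteq> M" "\<gamma> (0::real) = p" "(\<gamma> has_vector_derivative v) (at 0)"
    using v unfolding tangent_space_def by blast
  have d\<phi>: "(\<phi> has_derivative frechet_derivative \<phi> (at p)) (at (\<gamma> 0))"
    using smooth_on_has_derivative[OF U(2)] p \<gamma>(3) by simp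
  have d: "((\<lambda>t. \<phi> (\<gamma> t)) has_derivative (\<lambda>h. frechet_derivative \<phi> (at p) (h *\<^sub>R v))) (at 0)"
    using has_derivative_compose[OF \<gamma>(4)[unfolded has_vector_derivative_def] d\<phi>] .
  have "continuous (at 0) \<gamma>" using \<gamma>(4) has_vector_derivative_continuous by blast
  then have "\<forall>\<^sub>F t in at 0. \<gamma> t \<in> U"
    using U(1) p \<gamma>(3) unfolding continuous_within by (intro topological_tendstoD) auto
  then have "\<forall>\<^sub>F t in nhds 0. \<gamma> t \<in> U"
    using p \<gamma>(3) unfolding eventually_nhds_conv_at by simp
  then obtain S where S: "open S" "0 \<in> S" "\<And>t. t \<in> S \<Longrightarrow> \<gamma> t \<in> U" unfolding eventually_nhds by blast
  have "((\<lambda>t. \<phi> (\<gamma> t)) has_derivative (\<lambda>h. 0)) (at 0)"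
  proof (rule has_derivative_transform_within_open[of "\<lambda>t. 0" _ _ _ "S \<inter> {-\<epsilon><..<\<epsilon>}"])
    show "0 = \<phi> (\<gamma> t)" if "t \<in> S \<inter> {-\<epsilon><..<\<epsilon>}" for t
    proof -
      have "\<gamma> t \<in> M \<inter> U" using that S(3)[of t] \<gamma>(2) by blast
      from subsetD[OF equalityD1[OF U(3)] this] show ?thesis by simp
    qed
  qed (use \<gamma>(1) S in auto)
  then have "(\<lambda>h. frechet_derivative \<phi> (at p) (h *\<^sub>R v)) = (\<lambda>h. 0)"
    using has_derivative_unique[OF d] by blast
  from fun_cong[OF this, of 1] show ?thesis by simp
qed

lemma hyp_frame_of_family:
  fixes e :: "'n::finite \<Rightarrow> 'n minkowski"
  assumes q: "q \<in> hyp_space" "mink \<nu> \<nu> = 1" "mink q \<nu> = 0"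
    and e: "\<And>i j. mink (e i) (e j) = (if i = j then 1 else 0)"
    and qe: "\<And>i. mink q (e i) = 0" and \<nu>e: "\<And>i. mink \<nu> (e i) = 0"
  shows "hyp_frame q \<nu> (\<lambda>x. \<Sum>i\<in>UNIV. (x $ i) *\<^sub>R e i)"
proof (rule hyp_frame.intro)
  have ml: "mink (\<Sum>i\<in>UNIV. (x $ i) *\<^sub>R e i) z = (\<Sum>i\<in>UNIV. x $ i * mink (e i) z)" for x z
    by (simp add: bounded_bilinear.sum_left[OF bounded_bilinear_mink] mink_simps)
  show "linear (\<lambda>x. \<Sum>i\<in>UNIV. (x $ i) *\<^sub>R e i)"
    by (rule linearI) (simp_all add: scaleR_left_distrib sum.distrib scaleR_sum_right)
  show "mink (\<Sum>i\<in>UNIV. (x $ i) *\<^sub>R e i) (\<Sum>i\<in>UNIV. (y $ i) *\<^sub>R e i) = x \<bullet> y" for x y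
    unfolding ml bounded_bilinear.sum_right[OF bounded_bilinear_mink] mink_simps e inner_vec_def
    by (simp add: if_distrib[of "\<lambda>t. _ * t"] mult.commute cong: if_cong)
  show "mink q (\<Sum>i\<in>UNIV. (x $ i) *\<^sub>R e i) = 0" "mink \<nu> (\<Sum>i\<in>UNIV. (x $ i) *\<^sub>R e i) = 0" for x
    by (simp_all add: bounded_bilinear.sum_right[OF bounded_bilinear_mink] mink_simps qe \<nu>e)
qed (use q in auto)

lemma (in hyp_frame) chart_box:
  assumes "0 < r" "0 < \<delta>"
  obtains W where "open W" "q \<in> W"
    "W \<inter> hyp_space = {p \<in> hyp_space. horo_x q \<nu> e p \<in> ball 0 r \<and> \<bar>horo_y q \<nu> p - 1\<bar> < \<delta>}"
proof -
  obtain A where A: "open A" "A \<inter> hyp_space = horo_x q \<nu> e -` ball 0 r \<inter> hyp_space"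
    using continuous_on_horo_x open_ball unfolding continuous_on_open_invariant by metis
  obtain B where B: "open B" "B \<inter> hyp_space = horo_y q \<nu> -` ball 1 \<delta> \<inter> hyp_space"
    using continuous_on_horo_y open_ball unfolding continuous_on_open_invariant by metis
  have "\<bar>t - 1\<bar> < \<delta> \<longleftrightarrow> t \<in> ball 1 \<delta>" for t by (auto simp: dist_real_def)
  then have AB: "A \<inter> B \<inter> hyp_space = {p \<in> hyp_space. horo_x q \<nu> e p \<in> ball 0 r \<and> \<bar>horo_y q \<nu> p - 1\<bar> < \<delta>}"
    using A(2) B(2) by blast
  have "horo_x q \<nu> e q = 0" "horo_y q \<nu> q = 1"
    using horo_x_horo[of 1 0] horo_y_horo[of 1 0] horo_base by simp_all
  then have "q \<in> A \<inter> B \<inter> hyp_space" unfolding AB using q_hyp assms by simp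
  then show ?thesis using that[of "A \<inter> B"] A(1) B(1) AB by blast
qed

text \<open>The strip is the image of a ball times an interval.\<close>

lemma (in hyp_frame) connected_strip:
  assumes l: "continuous_on (ball 0 r) l" and h: "continuous_on (ball 0 r) h"
    and lh: "\<And>x. x \<in> ball 0 r \<Longrightarrow> 0 \<le> l x \<and> l x < h x"
  shows "connected {\<Psi> x y |x y. x \<in> ball 0 r \<and> l x < y \<and> y < h x}"
proof -
  define T where "T = (\<lambda>z :: (real ^ 'n) \<times> real. l (fst z) + snd z * (h (fst z) - l (fst z)))"
  have T: "l (fst z) < T z \<and> T z < h (fst z)" if z: "z \<in> ball 0 r \<times> {0<..<1}" for z
  proof -
    define c where "c = h (fst z) - l (fst z)"
    have c: "0 < c" using lh[of "fst z"] z unfolding c_def by auto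
    have "0 < snd z * c" "snd z * c < 1 * c"
      using z c by (auto simp del: mult_1 intro!: mult_pos_pos mult_strict_right_mono)
    then show ?thesis unfolding T_def c_def[symmetric] using c_def by linarith
  qed
  have "continuous_on (ball 0 r \<times> {0<..<1}) T"
    unfolding T_def by (intro continuous_intros continuous_on_compose2[OF l] continuous_on_compose2[OF h]) auto
  moreover have "0 < T z" if "z \<in> ball 0 r \<times> {0<..<1}" for z
    using T[OF that] lh[of "fst z"] that by force
  ultimately have "continuous_on (ball 0 r \<times> {0<..<1}) (\<lambda>z. \<Psi> (fst z) (T z))"
    by (intro continuous_on_horo continuous_intros) auto
  moreover have "connected (ball (0 :: real ^ 'n) r \<times> {0<..<1 :: real})" by (intro connected_Times) auto
  ultimately have "connected ((\<lambda>z. \<Psi> (fst z) (T z)) ` (ball 0 r \<times> {0<..<1}))"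
    by (rule connected_continuous_image)
  moreover have "(\<lambda>z. \<Psi> (fst z) (T z)) ` (ball 0 r \<times> {0<..<1})
      = {\<Psi> x y |x y. x \<in> ball 0 r \<and> l x < y \<and> y < h x}"
  proof
    show "(\<lambda>z. \<Psi> (fst z) (T z)) ` (ball 0 r \<times> {0<..<1}) \<subseteq> {\<Psi> x y |x y. x \<in> ball 0 r \<and> l x < y \<and> y < h x}"
    proof
      fix p assume "p \<in> (\<lambda>z. \<Psi> (fst z) (T z)) ` (ball 0 r \<times> {0<..<1})"
      then obtain z where z: "z \<in> ball 0 r \<times> {0<..<1}" "p = \<Psi> (fst z) (T z)" by blast
      then show "p \<in> {\<Psi> x y |x y. x \<in> ball 0 r \<and> l x < y \<and> y < h x}"
        using T[OF z(1)] by (auto simp: mem_Times_iff)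
    qed
    show "{\<Psi> x y |x y. x \<in> ball 0 r \<and> l x < y \<and> y < h x} \<subseteq> (\<lambda>z. \<Psi> (fst z) (T z)) ` (ball 0 r \<times> {0<..<1})"
    proof
      fix p assume "p \<in> {\<Psi> x y |x y. x \<in> ball 0 r \<and> l x < y \<and> y < h x}"
      then obtain x y where xy: "p = \<Psi> x y" "x \<in> ball 0 r" "l x < y" "y < h x" by blast
      define s where "s = (y - l x) / (h x - l x)"
      have "T (x, s) = y" "0 < s" "s < 1" unfolding T_def s_def using xy(3,4) by auto
      then show "p \<in> (\<lambda>z. \<Psi> (fst z) (T z)) ` (ball 0 r \<times> {0<..<1})"
        using xy(1,2) by (intro image_eqI[of _ _ "(x, s)"]) auto
    qed
  qed
  ultimately show ?thesis by simp
qed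

lemma principal_curvaturesE:
  assumes "principal_curvatures M p k"
  obtains \<nu> D e where "\<forall>q\<in>M. outward_unit_normal M q (\<nu> q)" "(\<nu> has_derivative D) (at p within M)"
    "\<forall>i. e i \<in> tangent_space M p" "\<forall>i j. mink (e i) (e j) = (if i = j then 1 else 0)"
    "\<forall>i. hyp_proj p (D (e i)) = (k $ i) *\<^sub>R e i"
  using assms unfolding principal_curvatures_def by (elim exE conjE) (rule that, assumption+)

locale closed_hypersurface =
  fixes M :: "'n::finite minkowski set" and \<kappa> :: "'n minkowski \<Rightarrow> real ^ 'n"
  assumes hypersurface: "smooth_hypersurface M" and compact_M: "compact M"
    and \<kappa>: "\<And>p. p \<in> M \<Longrightarrow> principal_curvatures M p (\<kappa> p)"
    and hconvex: "strictly_h_convex M"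
begin

abbreviation "E \<equiv> exterior_region M"

lemma M_sub: "M \<subseteq> hyp_space" and M_ne: "M \<noteq> {}" and M_connected: "connected M"
  using hypersurface by (auto simp: smooth_hypersurface_def)

lemma closed_M: "closed M" using compact_M compact_imp_closed by blast

lemma tangent_frame:
  assumes q: "q \<in> M" and \<nu>: "outward_unit_normal M q \<nu>"
  obtains e where "hyp_frame q \<nu> e"
    "\<And>L x. linear L \<Longrightarrow> (\<And>v. v \<in> tangent_space M q \<Longrightarrow> L v = 0) \<Longrightarrow> L (e x) = 0"
proof -
  obtain e0 :: "'n \<Rightarrow> 'n minkowski"
    where e0: "\<forall>i. e0 i \<in> tangent_space M q" "\<forall>i j. mink (e0 i) (e0 j) = (if i = j then 1 else 0)"
    using \<kappa>[OF q] by (rule principal_curvaturesE) blast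
  show ?thesis
  proof (rule that[of "\<lambda>x. \<Sum>i\<in>UNIV. (x $ i) *\<^sub>R e0 i"])
    show "hyp_frame q \<nu> (\<lambda>x. \<Sum>i\<in>UNIV. (x $ i) *\<^sub>R e0 i)"
      using e0 \<nu> q M_sub tangent_space_subset[OF M_sub]
      by (intro hyp_frame_of_family) (auto simp: outward_unit_normal_def hyp_tangent_def)
    show "L (\<Sum>i\<in>UNIV. (x $ i) *\<^sub>R e0 i) = 0"
      if "linear L" "\<And>v. v \<in> tangent_space M q \<Longrightarrow> L v = 0" for L :: "_ \<Rightarrow> 'z::real_vector" and x
      using e0(1) that by (simp add: linear_sum linear_cmul)
  qed
qed

text \<open>In horospherical coordinates at \<open>q\<close> the defining function has nonzero derivative in the direction
of \<open>\<nu>\<close>, because it vanishes on the tangent space of \<open>M\<close> but not on that of hyperbolic space; after a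
choice of sign the derivative is positive.  The part below the graph is connected, misses \<open>M\<close> and meets the exterior
region along the geodesic in direction \<open>\<nu>\<close>, so it lies in the exterior region.\<close>

lemma local_graph:
  assumes fr: "hyp_frame q \<nu> e" and q: "q \<in> M" and \<nu>: "outward_unit_normal M q \<nu>"
  obtains U \<phi> r \<delta> u where "open U" "q \<in> U" "smooth_on U \<phi>" "M \<inter> U = {x \<in> hyp_space \<inter> U. \<phi> x = (0::real)}"
    "0 < frechet_derivative \<phi> (at q) \<nu>"
    "\<And>v. mink q v = 0 \<Longrightarrow> frechet_derivative \<phi> (at q) v = mink v \<nu> * frechet_derivative \<phi> (at q) \<nu>"
    "0 < r" "0 < \<delta>" "\<delta> < 1" "\<And>k. Ck_on k (ball 0 r) u" "u 0 = 1"
    "\<And>x. x \<in> ball 0 r \<Longrightarrow> \<bar>u x - 1\<bar> < \<delta>"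
    "\<And>x y. x \<in> ball 0 r \<Longrightarrow> \<bar>y - 1\<bar> < \<delta> \<Longrightarrow> horo q \<nu> e x y \<in> U \<and>
      (horo q \<nu> e x y \<in> M \<longleftrightarrow> y = u x) \<and> (0 < \<phi> (horo q \<nu> e x y) \<longleftrightarrow> y < u x)"
    "\<And>x y. x \<in> ball 0 r \<Longrightarrow> \<bar>y - 1\<bar> < \<delta> \<Longrightarrow> y < u x \<Longrightarrow> horo q \<nu> e x y \<in> E"
proof -
  interpret hyp_frame q \<nu> e by (rule fr)
  obtain U \<phi>0 where U: "open U" "q \<in> U" "smooth_on U \<phi>0" "M \<inter> U = {x \<in> hyp_space \<inter> U. \<phi>0 x = (0::real)}"
      "\<forall>x\<in>M \<inter> U. \<exists>v\<in>hyp_tangent x. frechet_derivative \<phi>0 (at x) v \<noteq> 0"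
    using hypersurface q unfolding smooth_hypersurface_def by blast
  define D0 where "D0 = frechet_derivative \<phi>0 (at q)"
  have d0: "(\<phi>0 has_derivative D0) (at q)" unfolding D0_def using smooth_on_has_derivative[OF U(3,2)] .
  have lin0: "linear D0" using has_derivative_linear[OF d0] .
  obtain e0 where e0: "hyp_frame q \<nu> e0"
    "\<And>L x. linear L \<Longrightarrow> (\<And>v. v \<in> tangent_space M q \<Longrightarrow> L v = 0) \<Longrightarrow> L (e0 x) = (0::real)"
    using tangent_frame[OF q \<nu>] by blast
  have D0e0: "D0 (e0 x) = 0" for x
    using e0(2)[OF lin0] tangent_space_kernel[OF U(1,3,4)] q U(2) unfolding D0_def by blast
  have D0v: "D0 v = mink v \<nu> * D0 \<nu>" if "mink q v = 0" for v
  proof -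
    have "v = mink v \<nu> *\<^sub>R \<nu> + e0 (\<chi> i. mink v (e0 (axis i 1)))"
      using hyp_frame.expand[OF e0(1), of v] that by (simp add: mink_commute[of v q])
    then have "D0 v = D0 (mink v \<nu> *\<^sub>R \<nu> + e0 (\<chi> i. mink v (e0 (axis i 1))))" by (rule arg_cong)
    then show ?thesis by (simp add: linear_add[OF lin0] linear_cmul[OF lin0] D0e0)
  qed
  have D0\<nu>: "D0 \<nu> \<noteq> 0"
    using U(5) q U(2) D0v unfolding hyp_tangent_def D0_def by fastforce
  \<comment> \<open>orient the defining function so that it increases towards the exterior\<close>
  define \<phi> where "\<phi> = (\<lambda>x. sgn (D0 \<nu>) * \<phi>0 x)"
  have sm: "smooth_on U \<phi>"
    unfolding smooth_on_def \<phi>_def by (intro allI Ck_mult Ck_const U(1) smooth_onD[OF U(3)])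
  have z: "M \<inter> U = {x \<in> hyp_space \<inter> U. \<phi> x = 0}"
    unfolding U(4) \<phi>_def using D0\<nu> by (auto simp: sgn_eq_0_iff)
  define D where "D = frechet_derivative \<phi> (at q)"
  have d: "(\<phi> has_derivative D) (at q)" unfolding D_def using smooth_on_has_derivative[OF sm U(2)] .
  have lin: "linear D" using has_derivative_linear[OF d] .
  have "(\<phi> has_derivative (\<lambda>v. sgn (D0 \<nu>) * D0 v)) (at q)"
    unfolding \<phi>_def by (rule has_derivative_mult_right[OF d0])
  then have DD0: "D = (\<lambda>v. sgn (D0 \<nu>) * D0 v)" using has_derivative_unique[OF d] by blast
  have D\<nu>: "0 < D \<nu>" unfolding DD0 using D0\<nu> by (simp add: sgn_mult_self_eq[symmetric] abs_sgn[symmetric] mult.commute)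
  have Dv: "D v = mink v \<nu> * D \<nu>" if "mink q v = 0" for v unfolding DD0 using D0v[OF that] by simp
  define O' where "O' = {z. 0 < snd z} \<inter> (\<lambda>z. \<Psi> (fst z) (snd z)) -` U"
  have oS: "open {z :: (real ^ 'n) \<times> real. 0 < snd z}" by (intro open_Collect_less continuous_intros)
  have O': "open O'"
    unfolding O'_def by (rule continuous_open_preimage[OF Ck_continuous[OF Ck_horo] oS U(1)])
  define \<psi> where "\<psi> = (\<lambda>z. \<phi> (\<Psi> (fst z) (snd z)))"
  have Ck\<psi>: "Ck_on k O' \<psi>" for k
    unfolding \<psi>_def
    by (rule Ck_compose[OF O' U(1) Ck_subset[OF Ck_horo] smooth_onD[OF sm]]) (auto simp: O'_def)
  have in0: "(0, 1) \<in> O'" using horo_base U(2) by (simp add: O'_def)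
  have \<psi>0: "\<psi> (0, 1) = 0" using z q U(2) horo_base unfolding \<psi>_def by auto
  have \<psi>': "frechet_derivative \<psi> (at (0, 1)) (0, 1) = - D \<nu>"
  proof -
    have A: "(\<psi> has_derivative frechet_derivative \<psi> (at (0, 1))) (at ((0, 1 + 0) :: (real ^ 'n) \<times> real))"
      using Ck_SucD(1)[OF Ck\<psi> in0] by simp
    have l: "((\<lambda>t::real. (0, 1 + t) :: (real ^ 'n) \<times> real) has_derivative (\<lambda>h. (0, h))) (at 0)"
      by (auto intro!: derivative_eq_intros)
    have 1: "((\<lambda>t. \<psi> (0, 1 + t)) has_derivative (\<lambda>h. frechet_derivative \<psi> (at (0, 1)) (0, h))) (at 0)"
      using has_derivative_compose[OF l A] .
    have P: "\<Psi> 0 (1 + t) = (1 / (1 + t)) *\<^sub>R b + (1 + t) *\<^sub>R a" if "1 + t \<noteq> 0" for t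
      using that by (simp add: horo_def linear_0[OF e_linear] scaleR_right_distrib power2_eq_square)
    have "((\<lambda>t. (1 / (1 + t)) *\<^sub>R b + (1 + t) *\<^sub>R a) has_derivative (\<lambda>h. h *\<^sub>R (a - b))) (at 0)"
      by (auto intro!: derivative_eq_intros simp: algebra_simps)
    then have "((\<lambda>t. \<Psi> 0 (1 + t)) has_derivative (\<lambda>h. h *\<^sub>R (a - b))) (at 0)"
      by (rule has_derivative_transform_within_open[of _ _ _ _ "{-1<..}"]) (auto simp: P)
    moreover have "a - b = - \<nu>" using ab(2) by (metis minus_diff_eq)
    ultimately have m: "((\<lambda>t. \<Psi> 0 (1 + t)) has_derivative (\<lambda>h. h *\<^sub>R (- \<nu>))) (at 0)" by simp
    have d': "(\<phi> has_derivative D) (at (\<Psi> 0 (1 + 0)))" using d horo_base by simp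
    have "((\<lambda>t. \<psi> (0, 1 + t)) has_derivative (\<lambda>h. D (h *\<^sub>R (- \<nu>)))) (at 0)"
      using has_derivative_compose[OF m d'] unfolding \<psi>_def by simp
    then have "(\<lambda>h. frechet_derivative \<psi> (at (0, 1)) (0, h)) = (\<lambda>h. D (h *\<^sub>R (- \<nu>)))"
      using has_derivative_unique[OF 1] by blast
    from fun_cong[OF this, of 1] show ?thesis by (simp add: linear_neg[OF lin])
  qed
  have neg: "frechet_derivative \<psi> (at (0, 1)) (0, 1) < 0" using \<psi>' D\<nu> by simp
  obtain r \<delta> u where g: "0 < r" "0 < \<delta>" "\<delta> < 1" "\<And>k. Ck_on k (ball 0 r) u" "u 0 = 1"
    "\<And>x. x \<in> ball 0 r \<Longrightarrow> \<bar>u x - 1\<bar> < \<delta>"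
    "\<And>x y. x \<in> ball 0 r \<Longrightarrow> \<bar>y - 1\<bar> < \<delta> \<Longrightarrow>
      (x, y) \<in> O' \<and> (\<psi> (x, y) = 0 \<longleftrightarrow> y = u x) \<and> (0 < \<psi> (x, y) \<longleftrightarrow> y < u x)"
    using implicit_graph[OF O' Ck\<psi> in0 \<psi>0 neg, of 1] by auto
  have box: "\<Psi> x y \<in> U \<and> (\<Psi> x y \<in> M \<longleftrightarrow> y = u x) \<and> (0 < \<phi> (\<Psi> x y) \<longleftrightarrow> y < u x)"
    if "x \<in> ball 0 r" "\<bar>y - 1\<bar> < \<delta>" for x y
  proof -
    have o: "0 < y" "\<Psi> x y \<in> U" using g(7)[OF that] unfolding O'_def by auto
    have "\<Psi> x y \<in> M \<inter> U \<longleftrightarrow> \<Psi> x y \<in> {x \<in> hyp_space \<inter> U. \<phi> x = 0}" unfolding z ..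
    then have "\<Psi> x y \<in> M \<longleftrightarrow> \<phi> (\<Psi> x y) = 0" using o horo_hyp[OF o(1)] by simp
    then show ?thesis using g(7)[OF that] o(2) unfolding \<psi>_def by auto
  qed
  have lower: "\<Psi> x y \<in> E" if x: "x \<in> ball 0 r" and y: "\<bar>y - 1\<bar> < \<delta>" "y < u x" for x y
  proof -
    define S where "S = {\<Psi> x y |x y. x \<in> ball 0 r \<and> 1 - \<delta> < y \<and> y < u x}"
    have inS: "\<Psi> x y \<in> S" if "x \<in> ball 0 r" "1 - \<delta> < y" "y < u x" for x y
      using that unfolding S_def by blast
    have lt: "0 \<le> 1 - \<delta> \<and> 1 - \<delta> < u x" if "x \<in> ball 0 r" for x using g(6)[OF that] g(3) by linarith
    have "connected S"
      unfolding S_def by (rule connected_strip[OF continuous_on_const Ck_continuous[OF g(4)] lt])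
    moreover have "S \<subseteq> hyp_space - M"
    proof
      fix p assume "p \<in> S"
      then obtain x y where z: "p = \<Psi> x y" "x \<in> ball 0 r" "1 - \<delta> < y" "y < u x" unfolding S_def by blast
      have "\<bar>y - 1\<bar> < \<delta>" using z g(6)[OF z(2)] by (simp add: abs_less_iff)
      then show "p \<in> hyp_space - M"
        using box[OF z(2)] z g(3) horo_hyp[of y x] by auto
    qed
    moreover have "\<exists>p\<in>S. p \<in> E"
    proof -
      have "\<forall>\<^sub>F t in at_right 0. hyp_geodesic q \<nu> t \<in> E" using \<nu> unfolding outward_unit_normal_def by blast
      moreover have "\<forall>\<^sub>F t in at_right (0::real). 1 - \<delta> < exp (- t)"
      proof -
        have "((\<lambda>t::real. exp (- t)) \<longlongrightarrow> exp (- 0)) (at_right 0)" by (intro tendsto_intros)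
        then show ?thesis using g(2) by (intro order_tendstoD(1)[of _ 1]) auto
      qed
      moreover have "\<forall>\<^sub>F t in at_right (0::real). 0 < t" by (simp add: eventually_at_right_less)
      ultimately have "\<forall>\<^sub>F t in at_right (0::real). hyp_geodesic q \<nu> t \<in> E \<and> 1 - \<delta> < exp (- t) \<and> 0 < t"
        by eventually_elim simp
      then obtain t where t: "hyp_geodesic q \<nu> t \<in> E" "1 - \<delta> < exp (- t)" "0 < t"
        using eventually_happens'[OF trivial_limit_at_right_real] by blast
      then have "hyp_geodesic q \<nu> t \<in> S" unfolding horo_geodesic using g(1,5) by (intro inS) auto
      then show ?thesis using t(1) by blast
    qed
    ultimately have "S \<subseteq> E" using exterior_connected[of S M] by blast
    then show ?thesis using inS[OF x _ y(2)] y(1) by (auto simp: abs_if split: if_splits)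
  qed
  show ?thesis
    by (rule that[OF U(1,2) sm z D\<nu>[unfolded D_def] Dv[unfolded D_def] g(1-6) box lower])
qed

end

context closed_hypersurface
begin

lemma frame_of_normal:
  assumes "q \<in> M" "outward_unit_normal M q \<nu>"
  obtains e where "hyp_frame q \<nu> e"
  by (rule tangent_frame[OF assms]) (rule that)

text \<open>A box in horospherical coordinates in which \<open>M\<close> is the graph of \<open>u\<close>.  Only the inclusion of the
lower side in the exterior region is part of this local notion; that the upper side avoids the
exterior is a global fact, \<open>exterior_iff_below_graph\<close>.\<close>

definition graph_box ::
  "'n minkowski \<Rightarrow> 'n minkowski \<Rightarrow> (real ^ 'n \<Rightarrow> 'n minkowski) \<Rightarrow> real \<Rightarrow> real \<Rightarrow> (real ^ 'n \<Rightarrow> real) \<Rightarrow> bool" where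
  "graph_box q \<nu> e r \<delta> u \<longleftrightarrow> 0 < r \<and> 0 < \<delta> \<and> \<delta> < 1 \<and> (\<forall>k. Ck_on k (ball 0 r) u) \<and> u 0 = 1 \<and>
     (\<forall>x\<in>ball 0 r. \<bar>u x - 1\<bar> < \<delta> \<and> (\<forall>y. \<bar>y - 1\<bar> < \<delta> \<longrightarrow>
        (horo q \<nu> e x y \<in> M \<longleftrightarrow> y = u x) \<and> (y < u x \<longrightarrow> horo q \<nu> e x y \<in> E)))"

lemma graph_boxD:
  assumes "graph_box q \<nu> e r \<delta> u"
  shows "0 < r" "0 < \<delta>" "\<delta> < 1" "Ck_on k (ball 0 r) u" "u 0 = 1" "continuous_on (ball 0 r) u"
    "x \<in> ball 0 r \<Longrightarrow> \<bar>u x - 1\<bar> < \<delta>" "x \<in> ball 0 r \<Longrightarrow> 0 < u x"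
    "x \<in> ball 0 r \<Longrightarrow> \<bar>y - 1\<bar> < \<delta> \<Longrightarrow> horo q \<nu> e x y \<in> M \<longleftrightarrow> y = u x"
    "x \<in> ball 0 r \<Longrightarrow> horo q \<nu> e x (u x) \<in> M"
    "x \<in> ball 0 r \<Longrightarrow> \<bar>y - 1\<bar> < \<delta> \<Longrightarrow> y < u x \<Longrightarrow> horo q \<nu> e x y \<in> E"
proof -
  show *: "0 < r" "0 < \<delta>" "\<delta> < 1" "u 0 = 1" and ck: "Ck_on k (ball 0 r) u" for k
    using assms unfolding graph_box_def by simp_all
  have ux: "\<bar>u x - 1\<bar> < \<delta>" if "x \<in> ball 0 r" for x using assms that unfolding graph_box_def by blast
  then show "\<bar>u x - 1\<bar> < \<delta>" if "x \<in> ball 0 r" using that by blast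
  show "0 < u x" if "x \<in> ball 0 r" using ux[OF that] *(3) by linarith
  show "continuous_on (ball 0 r) u" using Ck_continuous ck by blast
  have m: "horo q \<nu> e x y \<in> M \<longleftrightarrow> y = u x" if "x \<in> ball 0 r" "\<bar>y - 1\<bar> < \<delta>" for x y
    using assms that unfolding graph_box_def by blast
  then show "horo q \<nu> e x y \<in> M \<longleftrightarrow> y = u x" if "x \<in> ball 0 r" "\<bar>y - 1\<bar> < \<delta>" using that by blast
  show "horo q \<nu> e x (u x) \<in> M" if "x \<in> ball 0 r" using m[OF that ux[OF that]] by simp
  show "horo q \<nu> e x y \<in> E" if "x \<in> ball 0 r" "\<bar>y - 1\<bar> < \<delta>" "y < u x"
    using assms that unfolding graph_box_def by blast
qed

lemma graph_box_exists:
  assumes "hyp_frame q \<nu> e" "q \<in> M" "outward_unit_normal M q \<nu>"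
  obtains r \<delta> u where "graph_box q \<nu> e r \<delta> u"
proof (rule local_graph[OF assms])
  fix U \<phi> r \<delta> u
  assume g: "0 < r" "0 < \<delta>" "\<delta> < 1" "\<And>k. Ck_on k (ball 0 r) u" "u 0 = 1"
    "\<And>x. x \<in> ball 0 r \<Longrightarrow> \<bar>u x - 1\<bar> < \<delta>"
    "\<And>x y. x \<in> ball 0 r \<Longrightarrow> \<bar>y - 1\<bar> < \<delta> \<Longrightarrow> horo q \<nu> e x y \<in> U \<and>
      (horo q \<nu> e x y \<in> M \<longleftrightarrow> y = u x) \<and> (0 < \<phi> (horo q \<nu> e x y) \<longleftrightarrow> y < u x)"
    "\<And>x y. x \<in> ball 0 r \<Longrightarrow> \<bar>y - 1\<bar> < \<delta> \<Longrightarrow> y < u x \<Longrightarrow> horo q \<nu> e x y \<in> E"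
  show thesis
    by (rule that[of r \<delta> u], unfold graph_box_def) (intro conjI ballI allI impI; simp add: g)
qed

lemma upper_side_connected:
  assumes fr: "hyp_frame q \<nu> e" and gb: "graph_box q \<nu> e r \<delta> u"
    and p: "x0 \<in> ball 0 r" "\<bar>y0 - 1\<bar> < \<delta>" "u x0 < y0" "horo q \<nu> e x0 y0 \<in> E"
    and x: "x \<in> ball 0 r" "\<bar>y - 1\<bar> < \<delta>" "u x < y"
  shows "horo q \<nu> e x y \<in> E"
proof -
  interpret hyp_frame q \<nu> e by (rule fr)
  note g = graph_boxD[OF gb]
  define S where "S = {\<Psi> x y |x y. x \<in> ball 0 r \<and> u x < y \<and> y < 1 + \<delta>}"
  have inS: "\<Psi> x y \<in> S" if "x \<in> ball 0 r" "y < 1 + \<delta>" "u x < y" for x y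
    using that unfolding S_def by blast
  have lt: "0 \<le> u x \<and> u x < 1 + \<delta>" if "x \<in> ball 0 r" for x using g(7,8)[OF that] by linarith
  have "connected S"
    unfolding S_def by (rule connected_strip[OF g(6) continuous_on_const lt])
  moreover have "S \<subseteq> hyp_space - M"
  proof
    fix p assume "p \<in> S"
    then obtain x y where z: "p = \<Psi> x y" "x \<in> ball 0 r" "u x < y" "y < 1 + \<delta>" unfolding S_def by blast
    have "\<bar>y - 1\<bar> < \<delta>" using z g(7)[OF z(2)] by (simp add: abs_less_iff)
    then show "p \<in> hyp_space - M"
      using g(9)[OF z(2)] g(8)[OF z(2)] z horo_hyp[of y x] by auto
  qed
  moreover have "\<Psi> x0 y0 \<in> S" using p by (intro inS) auto
  ultimately have "S \<subseteq> E" using exterior_connected[of S M] p(4) by blast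
  then show ?thesis using inS[OF x(1) _ x(3)] x(2) by auto
qed

text \<open>Points all of whose neighbours off \<open>M\<close> are exterior.\<close>

definition two_sided :: "'n minkowski set" where
  "two_sided = {q \<in> M. \<exists>W. open W \<and> q \<in> W \<and> W \<inter> hyp_space \<subseteq> E \<union> M}"

lemma upper_near:
  assumes fr: "hyp_frame q \<nu> e" and gb: "graph_box q \<nu> e r \<delta> u" and x: "x \<in> ball 0 r"
    and W: "open W" "horo q \<nu> e x (u x) \<in> W"
  obtains y where "u x < y" "\<bar>y - 1\<bar> < \<delta>" "horo q \<nu> e x y \<in> W"
proof -
  interpret hyp_frame q \<nu> e by (rule fr)
  note g = graph_boxD[OF gb]
  have "continuous_on {0<..} (\<lambda>y. \<Psi> x y)" by (intro continuous_on_horo continuous_intros) auto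
  then have "open ({0<..} \<inter> (\<lambda>y. \<Psi> x y) -` W)" using W(1) by (intro continuous_open_preimage) auto
  moreover have "u x \<in> {0<..} \<inter> (\<lambda>y. \<Psi> x y) -` W" using g(8)[OF x] W(2) by simp
  ultimately obtain s where s: "0 < s" "ball (u x) s \<subseteq> {0<..} \<inter> (\<lambda>y. \<Psi> x y) -` W" using openE by blast
  define t where "t = min (s / 2) ((\<delta> - \<bar>u x - 1\<bar>) / 2)"
  have t: "0 < t" "t \<le> s / 2" "t \<le> (\<delta> - \<bar>u x - 1\<bar>) / 2"
  proof -
    show "0 < t" unfolding t_def using s(1) g(7)[OF x] by simp
  qed (unfold t_def, rule min.cobounded1, rule min.cobounded2)
  have "u x + t \<in> ball (u x) s" using t s(1) by (simp add: dist_real_def)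
  then have "\<Psi> x (u x + t) \<in> W" using s(2) by auto
  moreover have "\<bar>u x + t - 1\<bar> < \<delta>"
  proof -
    have "\<bar>u x + t - 1\<bar> \<le> \<bar>u x - 1\<bar> + t" using t(1) by (simp add: abs_if)
    moreover have "\<bar>u x - 1\<bar> + t < \<delta>" using t(1,3) by (simp add: field_simps)
    ultimately show ?thesis by linarith
  qed
  ultimately show ?thesis using that[of "u x + t"] t(1) by simp
qed

lemma two_sided_iff:
  assumes fr: "hyp_frame q \<nu> e" and gb: "graph_box q \<nu> e r \<delta> u"
  shows "q \<in> two_sided \<longleftrightarrow> (\<forall>x y. x \<in> ball 0 r \<longrightarrow> \<bar>y - 1\<bar> < \<delta> \<longrightarrow> u x < y \<longrightarrow> horo q \<nu> e x y \<in> E)"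
proof -
  interpret hyp_frame q \<nu> e by (rule fr)
  note g = graph_boxD[OF gb]
  have z: "0 \<in> ball (0 :: real ^ 'n) r" "\<Psi> 0 (u 0) = q" using g(1,5) horo_base by simp_all
  show ?thesis
  proof
    assume "q \<in> two_sided"
    then obtain W where W: "open W" "q \<in> W" "W \<inter> hyp_space \<subseteq> E \<union> M" unfolding two_sided_def by blast
    obtain y where y: "u 0 < y" "\<bar>y - 1\<bar> < \<delta>" "\<Psi> 0 y \<in> W"
      using upper_near[OF fr gb z(1) W(1)] W(2) z(2) by metis
    have "\<Psi> 0 y \<in> hyp_space" using y(1) g(5) by (intro horo_hyp) simp
    moreover have "\<Psi> 0 y \<notin> M" using g(9)[OF z(1) y(2)] y(1) by simp
    ultimately have "\<Psi> 0 y \<in> E" using y(3) W(3) by blast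
    then show "\<forall>x y. x \<in> ball 0 r \<longrightarrow> \<bar>y - 1\<bar> < \<delta> \<longrightarrow> u x < y \<longrightarrow> \<Psi> x y \<in> E"
      using upper_side_connected[OF fr gb z(1) y(2,1)] by blast
  next
    assume up: "\<forall>x y. x \<in> ball 0 r \<longrightarrow> \<bar>y - 1\<bar> < \<delta> \<longrightarrow> u x < y \<longrightarrow> \<Psi> x y \<in> E"
    obtain W where W: "open W" "q \<in> W" "W \<inter> hyp_space = {p \<in> hyp_space. horo_x q \<nu> e p \<in> ball 0 r \<and> \<bar>horo_y q \<nu> p - 1\<bar> < \<delta>}"
      by (rule chart_box[OF g(1,2)])
    have "p \<in> E \<union> M" if p: "p \<in> W \<inter> hyp_space" for p
    proof -
      define x y where "x = horo_x q \<nu> e p" and "y = horo_y q \<nu> p"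
      have xy: "x \<in> ball 0 r" "\<bar>y - 1\<bar> < \<delta>" "\<Psi> x y = p"
        using p W(3) horo_chart[of p] unfolding x_def y_def by auto
      consider "y < u x" | "y = u x" | "u x < y" by linarith
      then have "\<Psi> x y \<in> E \<union> M" using g(9)[OF xy(1,2)] g(11)[OF xy(1,2)] up xy(1,2) by cases auto
      then show ?thesis using xy(3) by simp
    qed
    moreover have "q \<in> M" using g(10)[OF z(1)] z(2) by simp
    ultimately show "q \<in> two_sided" unfolding two_sided_def using W(1,2) by blast
  qed
qed

lemma normal_field:
  obtains \<nu> where "\<And>q. q \<in> M \<Longrightarrow> outward_unit_normal M q (\<nu> q)"
proof -
  obtain p where p: "p \<in> M" using M_ne by blast
  show ?thesis using \<kappa>[OF p] by (rule principal_curvaturesE) (use that in blast)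
qed

text \<open>The points with exterior on both sides form an open and closed subset of \<open>M\<close>.  If it were everything,
\<open>-\<nu>\<close> would be another outward normal field, with principal curvatures \<open>-\<kappa>\<close>, and horospherical
convexity would demand \<open>\<kappa> > 1\<close> and \<open>-\<kappa> > 1\<close> at once.\<close>

lemma two_sided_empty: "two_sided = {}"
proof -
  obtain \<nu> where \<nu>: "\<And>q. q \<in> M \<Longrightarrow> outward_unit_normal M q (\<nu> q)" using normal_field by blast
  have sub: "two_sided \<subseteq> M" unfolding two_sided_def by blast
  have "openin (top_of_set M) two_sided"
    unfolding openin_subopen[of _ two_sided]
  proof
    fix q assume "q \<in> two_sided"
    then obtain W where W: "open W" "q \<in> W" "q \<in> M" "W \<inter> hyp_space \<subseteq> E \<union> M" unfolding two_sided_def by blast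
    then have "M \<inter> W \<subseteq> two_sided" unfolding two_sided_def by blast
    then show "\<exists>T. openin (top_of_set M) T \<and> q \<in> T \<and> T \<subseteq> two_sided"
      using W by (intro exI[of _ "M \<inter> W"]) (auto intro: openin_open_Int)
  qed
  moreover have "openin (top_of_set M) (M - two_sided)"
    unfolding openin_subopen[of _ "M - two_sided"]
  proof
    fix q assume q: "q \<in> M - two_sided"
    have qM: "q \<in> M" using q by blast
    obtain e where fr: "hyp_frame q (\<nu> q) e" by (rule frame_of_normal[OF qM \<nu>[OF qM]])
    obtain r \<delta> u where gb: "graph_box q (\<nu> q) e r \<delta> u" by (rule graph_box_exists[OF fr qM \<nu>[OF qM]])
    interpret hyp_frame q "\<nu> q" e by (rule fr)
    note g = graph_boxD[OF gb]
    have none: "\<Psi> x y \<notin> E" if "x \<in> ball 0 r" "\<bar>y - 1\<bar> < \<delta>" "u x < y" for x y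
      using q two_sided_iff[OF fr gb] upper_side_connected[OF fr gb that] by blast
    obtain W where W: "open W" "q \<in> W" "W \<inter> hyp_space = {p \<in> hyp_space. horo_x q (\<nu> q) e p \<in> ball 0 r \<and> \<bar>horo_y q (\<nu> q) p - 1\<bar> < \<delta>}"
      by (rule chart_box[OF g(1,2)])
    have "p \<notin> two_sided" if p: "p \<in> M \<inter> W" for p
    proof
      assume "p \<in> two_sided"
      then obtain V where V: "open V" "p \<in> V" "V \<inter> hyp_space \<subseteq> E \<union> M" unfolding two_sided_def by blast
      define x y where "x = horo_x q (\<nu> q) e p" and "y = horo_y q (\<nu> q) p"
      have pH: "p \<in> hyp_space" using p M_sub by blast
      then have xy: "x \<in> ball 0 r" "\<bar>y - 1\<bar> < \<delta>" "\<Psi> x y = p"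
        using p W(3) horo_chart[OF pH] unfolding x_def y_def by auto
      then have "y = u x" using g(9)[OF xy(1,2)] p by simp
      then obtain z where z: "u x < z" "\<bar>z - 1\<bar> < \<delta>" "\<Psi> x z \<in> V"
        using upper_near[OF fr gb xy(1) V(1)] V(2) xy(3) by metis
      have "\<Psi> x z \<in> hyp_space" using z(1) g(8)[OF xy(1)] by (intro horo_hyp) simp
      moreover have "\<Psi> x z \<notin> M" using g(9)[OF xy(1) z(2)] z(1) by simp
      ultimately show False using none[OF xy(1) z(2,1)] z(3) V(3) by blast
    qed
    then show "\<exists>T. openin (top_of_set M) T \<and> q \<in> T \<and> T \<subseteq> M - two_sided"
      using W(1,2) q by (intro exI[of _ "M \<inter> W"]) (auto intro: openin_open_Int)
  qed
  then have "closedin (top_of_set M) two_sided" using sub by (simp add: closedin_def)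
  ultimately have "two_sided = {} \<or> two_sided = M" using M_connected unfolding connected_clopen by blast
  moreover have "two_sided \<noteq> M"
  proof
    assume all: "two_sided = M"
    obtain p where p: "p \<in> M" using M_ne by blast
    obtain \<nu> D e where n: "\<forall>q\<in>M. outward_unit_normal M q (\<nu> q)" "(\<nu> has_derivative D) (at p within M)"
      "\<forall>i. e i \<in> tangent_space M p" "\<forall>i j. mink (e i) (e j) = (if i = j then 1 else 0)"
      "\<forall>i. hyp_proj p (D (e i)) = (\<kappa> p $ i) *\<^sub>R e i"
      using \<kappa>[OF p] by (rule principal_curvaturesE)
    have op: "outward_unit_normal M q (- \<nu> q)" if q: "q \<in> M" for q
    proof -
      have \<nu>q: "outward_unit_normal M q (\<nu> q)" using n(1) q by blast
      obtain e' where fr: "hyp_frame q (\<nu> q) e'" by (rule frame_of_normal[OF q \<nu>q])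
      obtain r \<delta> u where gb: "graph_box q (\<nu> q) e' r \<delta> u" by (rule graph_box_exists[OF fr q \<nu>q])
      interpret hyp_frame q "\<nu> q" e' by (rule fr)
      note g = graph_boxD[OF gb]
      have up: "\<Psi> 0 y \<in> E" if "1 < y" "y < 1 + \<delta>" for y
        using two_sided_iff[OF fr gb] all q that g(1,5) by simp
      have "((\<lambda>t::real. exp t) \<longlongrightarrow> exp 0) (at_right 0)" by (intro tendsto_intros)
      then have "\<forall>\<^sub>F t in at_right (0::real). exp t < 1 + \<delta>" using g(2) by (intro order_tendstoD(2)[of _ 1]) auto
      moreover have "\<forall>\<^sub>F t in at_right (0::real). 0 < t" by (simp add: eventually_at_right_less)
      ultimately have "\<forall>\<^sub>F t in at_right 0. hyp_geodesic q (- \<nu> q) t \<in> E"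
        by eventually_elim (simp add: horo_geodesic up)
      then show ?thesis using \<nu>q unfolding outward_unit_normal_def hyp_tangent_def by (auto simp: mink_simps)
    qed
    have "principal_curvatures M p (- \<kappa> p)"
      unfolding principal_curvatures_def
    proof (intro exI conjI)
      show "\<forall>q\<in>M. outward_unit_normal M q ((\<lambda>q. - \<nu> q) q)" using op by blast
      show "((\<lambda>q. - \<nu> q) has_derivative (\<lambda>v. - D v)) (at p within M)" using n(2) by (rule has_derivative_minus)
      show "\<forall>i. hyp_proj p (- D (e i)) = ((- \<kappa> p) $ i) *\<^sub>R e i"
      proof
        fix i
        have "hyp_proj p (- D (e i)) = - hyp_proj p (D (e i))" by (simp add: hyp_proj_def mink_simps)
        then show "hyp_proj p (- D (e i)) = ((- \<kappa> p) $ i) *\<^sub>R e i" using n(5) by simp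
      qed
    qed (use n in auto)
    then have a: "1 < (- \<kappa> p) $ i" for i using hconvex p unfolding strictly_h_convex_def by blast
    have b: "1 < \<kappa> p $ i" for i using hconvex p \<kappa>[OF p] unfolding strictly_h_convex_def by blast
    show False using a[of undefined] b[of undefined] by simp
  qed
  ultimately show ?thesis by blast
qed

lemma exterior_iff_below_graph:
  assumes fr: "hyp_frame q \<nu> e" and gb: "graph_box q \<nu> e r \<delta> u"
    and x: "x \<in> ball 0 r" "\<bar>y - 1\<bar> < \<delta>"
  shows "horo q \<nu> e x y \<in> E \<longleftrightarrow> y < u x"
proof -
  note g = graph_boxD[OF gb]
  have "horo q \<nu> e x y \<notin> E" if "u x < y"
    using two_sided_iff[OF fr gb] two_sided_empty upper_side_connected[OF fr gb x that] by blast
  moreover have "horo q \<nu> e x y \<notin> E" if "y = u x"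
    using g(9)[OF x] that exterior_subset by blast
  moreover have "horo q \<nu> e x y \<in> E" if "y < u x" using g(11)[OF x that] .
  ultimately show ?thesis by (cases y "u x" rule: linorder_cases) auto
qed

text \<open>Only \<open>\<plusminus>\<nu>\<close> are unit normals, and the geodesic in direction \<open>-\<nu>\<close> enters the side that is not
exterior.\<close>

lemma outward_unit_normal_unique:
  assumes q: "q \<in> M" and \<nu>: "outward_unit_normal M q \<nu>" and \<nu>': "outward_unit_normal M q \<nu>'"
  shows "\<nu>' = \<nu>"
proof -
  obtain e where fr: "hyp_frame q \<nu> e"
    and ker: "\<And>L x. linear L \<Longrightarrow> (\<And>v. v \<in> tangent_space M q \<Longrightarrow> L v = 0) \<Longrightarrow> L (e x) = (0::real)"
    using tangent_frame[OF q \<nu>] by blast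
  obtain r \<delta> u where gb: "graph_box q \<nu> e r \<delta> u" by (rule graph_box_exists[OF fr q \<nu>])
  interpret hyp_frame q \<nu> e by (rule fr)
  note g = graph_boxD[OF gb]
  have n: "mink q \<nu>' = 0" "mink \<nu>' \<nu>' = 1" "\<And>v. v \<in> tangent_space M q \<Longrightarrow> mink \<nu>' v = 0"
    using \<nu>' unfolding outward_unit_normal_def hyp_tangent_def by auto
  have "linear (mink \<nu>')" by (rule linearI) (simp_all add: mink_simps)
  then have z: "mink \<nu>' (e x) = 0" for x using ker n(3) by blast
  define k where "k = mink \<nu>' \<nu>"
  have "\<nu>' = k *\<^sub>R \<nu> + e 0"
    using expand[of \<nu>'] n(1) z by (simp add: mink_commute[of \<nu>' q] zero_vec_def k_def)
  then have c: "\<nu>' = k *\<^sub>R \<nu>" by (simp add: linear_0[OF e_linear])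
  then have "k * k = 1" using n(2) \<nu>_unit by (simp add: mink_simps)
  then have "k = 1 \<or> k = -1" using square_eq_1_iff by blast
  moreover have False if "k = -1"
  proof -
    have "\<nu>' = - \<nu>" using c that by simp
    then have "\<forall>\<^sub>F t in at_right 0. hyp_geodesic q (- \<nu>) t \<in> E"
      using \<nu>' unfolding outward_unit_normal_def by simp
    moreover have "((\<lambda>t::real. exp t) \<longlongrightarrow> exp 0) (at_right 0)" by (intro tendsto_intros)
    then have "\<forall>\<^sub>F t in at_right (0::real). exp t < 1 + \<delta>" using g(2) by (intro order_tendstoD(2)[of _ 1]) auto
    moreover have "\<forall>\<^sub>F t in at_right (0::real). 0 < t" by (simp add: eventually_at_right_less)
    ultimately have "\<forall>\<^sub>F t in at_right (0::real). \<Psi> 0 (exp t) \<in> E \<and> exp t < 1 + \<delta> \<and> 0 < t"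
      unfolding horo_geodesic by eventually_elim simp
    then obtain t where "\<Psi> 0 (exp t) \<in> E" "exp t < 1 + \<delta>" "0 < t"
      using eventually_happens'[OF trivial_limit_at_right_real] by blast
    then show False using exterior_iff_below_graph[OF fr gb, of 0 "exp t"] g(1,5) by auto
  qed
  ultimately show ?thesis using c by auto
qed

definition N :: "'n minkowski \<Rightarrow> 'n minkowski" where
  "N p = (THE \<nu>. outward_unit_normal M p \<nu>)"

lemma N_eqI: "p \<in> M \<Longrightarrow> outward_unit_normal M p \<nu> \<Longrightarrow> N p = \<nu>"
  unfolding N_def using outward_unit_normal_unique by blast

lemma outward_N: "p \<in> M \<Longrightarrow> outward_unit_normal M p (N p)"
  using normal_field N_eqI by metis

lemma N_unit: "p \<in> M \<Longrightarrow> mink (N p) (N p) = 1"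
  and N_normal: "p \<in> M \<Longrightarrow> mink p (N p) = 0" "p \<in> M \<Longrightarrow> v \<in> tangent_space M p \<Longrightarrow> mink (N p) v = 0"
  using outward_N unfolding outward_unit_normal_def hyp_tangent_def by auto

lemma N_derivative:
  assumes p: "p \<in> M"
  obtains D and e :: "'n \<Rightarrow> 'n minkowski" where "(N has_derivative D) (at p within M)"
    "\<And>i. e i \<in> tangent_space M p" "\<And>i j. mink (e i) (e j) = (if i = j then 1 else 0)"
    "\<And>i. hyp_proj p (D (e i)) = (\<kappa> p $ i) *\<^sub>R e i"
proof -
  obtain \<nu> D and e :: "'n \<Rightarrow> 'n minkowski" where n: "\<forall>q\<in>M. outward_unit_normal M q (\<nu> q)" "(\<nu> has_derivative D) (at p within M)"
    "\<forall>i. e i \<in> tangent_space M p" "\<forall>i j. mink (e i) (e j) = (if i = j then 1 else 0)"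
    "\<forall>i. hyp_proj p (D (e i)) = (\<kappa> p $ i) *\<^sub>R e i"
    using \<kappa>[OF p] by (rule principal_curvaturesE)
  have "(N has_derivative D) (at p within M)"
    by (rule has_derivative_transform[OF p _ n(2)]) (use n(1) N_eqI in auto)
  then show ?thesis using that n(3-5) by blast
qed

lemma continuous_on_N: "continuous_on M N"
  unfolding continuous_on_eq_continuous_within
proof
  fix p assume p: "p \<in> M"
  show "continuous (at p within M) N" by (rule N_derivative[OF p]) (rule has_derivative_continuous)
qed

lemma frame_at:
  assumes "q \<in> M"
  obtains e where "hyp_frame q (N q) e"
  by (rule frame_of_normal[OF assms outward_N[OF assms]]) (rule that)

end

section \<open>The curvature equation in horospherical coordinates\<close>

lemma bilinear_diagonal:
  fixes B :: "real ^ 'n::finite \<Rightarrow> real ^ 'n \<Rightarrow> real"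
  assumes l1: "\<And>v. linear (B v)" and l2: "\<And>w. linear (\<lambda>v. B v w)"
    and \<xi>: "orthonormal_family \<xi>" and d: "\<And>i j. B (\<xi> i) (\<xi> j) = (if i = j then k $ i else 0)"
  shows "B v v = (\<Sum>i\<in>UNIV. k $ i * (v \<bullet> \<xi> i)\<^sup>2)"
proof -
  define c where "c = (\<lambda>i. v \<bullet> \<xi> i)"
  have v: "v = (\<Sum>i\<in>UNIV. c i *\<^sub>R \<xi> i)" unfolding c_def by (rule orthonormal_expand[OF \<xi>])
  have "B v v = B (\<Sum>i\<in>UNIV. c i *\<^sub>R \<xi> i) (\<Sum>i\<in>UNIV. c i *\<^sub>R \<xi> i)" using v by simp
  also have "\<dots> = (\<Sum>i\<in>UNIV. c i * B (\<xi> i) (\<Sum>i\<in>UNIV. c i *\<^sub>R \<xi> i))"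
    unfolding linear_sum[OF l2] linear_cmul[OF l2] by simp
  also have "\<dots> = (\<Sum>i\<in>UNIV. c i * (\<Sum>j\<in>UNIV. c j * B (\<xi> i) (\<xi> j)))"
    unfolding linear_sum[OF l1] linear_cmul[OF l1] by simp
  also have "\<dots> = (\<Sum>i\<in>UNIV. c i * (c i * k $ i))"
    unfolding d by (simp add: if_distrib[of "\<lambda>t. _ * t"] cong: if_cong)
  also have "\<dots> = (\<Sum>i\<in>UNIV. k $ i * (v \<bullet> \<xi> i)\<^sup>2)"
    by (simp add: c_def power2_eq_square mult.commute mult.left_commute)
  finally show ?thesis .
qed

context hyp_frame
begin

lemma mink_point_dF:
  assumes "y \<noteq> 0"
  shows "mink (\<Psi> x y) (dF x y g \<xi>) = 0"
  using assms unfolding dF_def by (simp add: mink_simps mink_point field_simps)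

lemma linear_dF: "linear (dF x y g)"
  by (rule linearI)
    (simp_all add: dF_def linear_add[OF e_linear] linear_cmul[OF e_linear] inner_add_right algebra_simps
      add_divide_distrib)

text \<open>At each of its points the graph carries an adapted frame again.  So the expansion of vectors in a
frame also serves to identify normals and tangent vectors away from the base point.\<close>

lemma graph_frame:
  assumes y: "0 < y"
  shows "hyp_frame (\<Psi> x y) (graph_normal x y g) (\<lambda>v. dF x y g (y *\<^sub>R gframe g v))"
proof (rule hyp_frame.intro)
  have y0: "y \<noteq> 0" using y by simp
  have s: "slope g \<noteq> 0" using slope_pos[of g] by simp
  show "\<Psi> x y \<in> hyp_space" by (rule horo_hyp[OF y])
  show "mink (graph_normal x y g) (graph_normal x y g) = 1"
    using s by (simp add: graph_normal_def mink_simps mink_Z[OF y0] power2_eq_square)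
  show "mink (\<Psi> x y) (graph_normal x y g) = 0"
    using mink_Z(2)[OF y0] by (simp add: graph_normal_def mink_simps mink_commute)
  show "linear (\<lambda>v. dF x y g (y *\<^sub>R gframe g v))"
    by (rule linearI) (simp_all add: linear_add[OF linear_gframe] linear_cmul[OF linear_gframe]
        linear_add[OF linear_dF] linear_cmul[OF linear_dF] scaleR_right_distrib)
  show "mink (dF x y g (y *\<^sub>R gframe g v)) (dF x y g (y *\<^sub>R gframe g w)) = v \<bullet> w" for v w
  proof -
    have "(y *\<^sub>R gframe g v) \<bullet> (y *\<^sub>R gframe g w) + (g \<bullet> (y *\<^sub>R gframe g v)) * (g \<bullet> (y *\<^sub>R gframe g w))
        = y\<^sup>2 * (gframe g v \<bullet> gframe g w + (g \<bullet> gframe g v) * (g \<bullet> gframe g w))"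
      by (simp add: power2_eq_square algebra_simps)
    then show ?thesis unfolding mink_dF_dF[OF y0] gframe_orthonormal using y0 by simp
  qed
  show "mink (\<Psi> x y) (dF x y g (y *\<^sub>R gframe g v)) = 0" for v by (rule mink_point_dF[OF y0])
  show "mink (graph_normal x y g) (dF x y g (y *\<^sub>R gframe g v)) = 0" for v
    by (simp add: graph_normal_def mink_simps mink_Z(3)[OF y0])
qed

lemma horo_graph_derivative:
  assumes u: "(u has_derivative (\<lambda>h. g \<bullet> h)) (at x)" and ux: "u x \<noteq> 0"
  shows "((\<lambda>x. \<Psi> x (u x)) has_derivative dF x (u x) g) (at x)"
proof -
  define V where "V = (\<lambda>x. b + e x + (x \<bullet> x + (u x)\<^sup>2) *\<^sub>R a)"
  have be: "bounded_linear e" using e_linear linear_conv_bounded_linear by blast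
  have dV: "(V has_derivative (\<lambda>\<xi>. e \<xi> + (2 * (x \<bullet> \<xi>) + 2 * u x * (g \<bullet> \<xi>)) *\<^sub>R a)) (at x)"
    unfolding V_def
    by (auto intro!: derivative_eq_intros u bounded_linear_imp_has_derivative[OF be]
        simp: inner_commute algebra_simps)
  have di: "((\<lambda>x. inverse (u x)) has_derivative (\<lambda>\<xi>. - (inverse (u x) * (g \<bullet> \<xi>) * inverse (u x)))) (at x)"
    by (rule Deriv.has_derivative_inverse[OF ux u])
  have "((\<lambda>x. inverse (u x) *\<^sub>R V x) has_derivative dF x (u x) g) (at x)"
    by (rule has_derivative_eq_rhs[OF has_derivative_scaleR[OF di dV]])
      (simp add: fun_eq_iff dF_def horo_def V_def divide_inverse mult.commute mult.left_commute)
  then show ?thesis by (simp add: horo_def V_def inverse_eq_divide)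
qed

lemma Z_derivative:
  assumes u: "(u has_derivative (\<lambda>h. G x \<bullet> h)) (at x)" and ux: "u x \<noteq> 0"
    and G: "(G has_derivative H) (at x)"
  shows "((\<lambda>x. Z x (u x) (G x)) has_derivative
    (\<lambda>\<eta>. e (H \<eta>) + (2 * (x \<bullet> H \<eta>)) *\<^sub>R a + dF x (u x) (G x) \<eta>)) (at x)"
proof -
  have be: "bounded_linear e" using e_linear linear_conv_bounded_linear by blast
  have eG: "((\<lambda>x. e (G x)) has_derivative (\<lambda>\<eta>. e (H \<eta>))) (at x)"
    by (rule bounded_linear.has_derivative[OF be G])
  have s: "((\<lambda>x. 2 * (x \<bullet> G x) - 2 * u x) has_derivative (\<lambda>\<eta>. 2 * (x \<bullet> H \<eta>))) (at x)"
    by (auto intro!: derivative_eq_intros u G simp: inner_commute)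
  have sa: "((\<lambda>x. (2 * (x \<bullet> G x) - 2 * u x) *\<^sub>R a) has_derivative (\<lambda>\<eta>. (2 * (x \<bullet> H \<eta>)) *\<^sub>R a)) (at x)"
    by (rule has_derivative_scaleR_left[OF s])
  have "((\<lambda>x. e (G x) + \<Psi> x (u x) + (2 * (x \<bullet> G x) - 2 * u x) *\<^sub>R a) has_derivative
      (\<lambda>\<eta>. e (H \<eta>) + dF x (u x) (G x) \<eta> + (2 * (x \<bullet> H \<eta>)) *\<^sub>R a)) (at x)"
    by (intro has_derivative_add eG sa horo_graph_derivative[OF u ux])
  then show ?thesis unfolding Z_def by (rule has_derivative_eq_rhs) (simp add: fun_eq_iff algebra_simps)
qed

end

context closed_hypersurface
begin

lemma graph_tangent:
  assumes fr: "hyp_frame q \<nu> e" and gb: "graph_box q \<nu> e r \<delta> u" and x: "x \<in> ball 0 r"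
    and u: "(u has_derivative (\<lambda>h. g \<bullet> h)) (at x)"
  shows "hyp_frame.dF q \<nu> e x (u x) g \<xi> \<in> tangent_space M (horo q \<nu> e x (u x))"
proof -
  interpret hyp_frame q \<nu> e by (rule fr)
  note gg = graph_boxD[OF gb]
  obtain s where s: "0 < s" "ball x s \<subseteq> ball 0 r" using x openE[OF open_ball] by metis
  define \<epsilon> where "\<epsilon> = s / (norm \<xi> + 1)"
  have \<epsilon>: "0 < \<epsilon>" unfolding \<epsilon>_def using s(1) by (simp add: add_nonneg_pos)
  have inb: "x + t *\<^sub>R \<xi> \<in> ball 0 r" if t: "t \<in> {-\<epsilon><..<\<epsilon>}" for t
  proof -
    have "\<bar>t\<bar> * norm \<xi> \<le> \<bar>t\<bar> * (norm \<xi> + 1)" by (simp add: mult_left_mono)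
    also have "\<dots> < \<epsilon> * (norm \<xi> + 1)" using t by (intro mult_strict_right_mono) (auto simp: add_nonneg_pos)
    also have "\<dots> = s" unfolding \<epsilon>_def by (smt (verit) nonzero_eq_divide_eq norm_ge_zero)
    finally have "x + t *\<^sub>R \<xi> \<in> ball x s" by (simp add: dist_norm)
    then show ?thesis using s(2) by blast
  qed
  define \<gamma> where "\<gamma> = (\<lambda>t. \<Psi> (x + t *\<^sub>R \<xi>) (u (x + t *\<^sub>R \<xi>)))"
  have "smooth_on {-\<epsilon><..<\<epsilon>} \<gamma>"
    unfolding smooth_on_def
  proof
    fix k
    have I: "open {-\<epsilon><..<\<epsilon>}" by simp
    have l: "Ck_on k {-\<epsilon><..<\<epsilon>} (\<lambda>t. x + t *\<^sub>R \<xi>)"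
      by (intro Ck_add Ck_const Ck_linear I) (auto intro!: linearI simp: scaleR_left_distrib)
    have lu: "Ck_on k {-\<epsilon><..<\<epsilon>} (\<lambda>t. u (x + t *\<^sub>R \<xi>))"
      by (rule Ck_compose[OF I open_ball l gg(4)]) (use inb in auto)
    have oS: "open {z :: (real ^ 'n) \<times> real. 0 < snd z}" by (intro open_Collect_less continuous_intros)
    have "Ck_on k {-\<epsilon><..<\<epsilon>} (\<lambda>t. (\<lambda>z. \<Psi> (fst z) (snd z)) (x + t *\<^sub>R \<xi>, u (x + t *\<^sub>R \<xi>)))"
      by (rule Ck_compose[OF I oS Ck_Pair[OF I l lu] Ck_horo]) (use inb gg(8) in auto)
    then show "Ck_on k {-\<epsilon><..<\<epsilon>} \<gamma>" by (simp add: \<gamma>_def)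
  qed
  moreover have "\<gamma> ` {-\<epsilon><..<\<epsilon>} \<subseteq> M" unfolding \<gamma>_def using inb gg(10) by blast
  moreover have "\<gamma> 0 = \<Psi> x (u x)" by (simp add: \<gamma>_def)
  moreover have "(\<gamma> has_vector_derivative dF x (u x) g \<xi>) (at 0)"
  proof -
    have l: "((\<lambda>t. x + t *\<^sub>R \<xi>) has_derivative (\<lambda>h. h *\<^sub>R \<xi>)) (at 0)" by (auto intro!: derivative_eq_intros)
    have "((\<lambda>x. \<Psi> x (u x)) has_derivative dF x (u x) g) (at (x + 0 *\<^sub>R \<xi>))"
      using horo_graph_derivative[OF u] gg(8)[OF x] by simp
    from has_derivative_compose[OF l this] show ?thesis
      unfolding has_vector_derivative_def \<gamma>_def by (simp add: linear_cmul[OF linear_dF])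
  qed
  ultimately show ?thesis unfolding tangent_space_def using \<epsilon> by blast
qed

text \<open>The normal of the graph and \<open>N\<close> are unit vectors in the same line, so their product is a
continuous function with values \<open>\<plusminus>1\<close> on a ball, and it is 1 at the centre.\<close>

lemma graph_gradient:
  assumes q: "q \<in> M" and fr: "hyp_frame q (N q) e" and gb: "graph_box q (N q) e r \<delta> u"
    and G: "\<And>x. x \<in> ball 0 r \<Longrightarrow> (u has_derivative (\<lambda>h. G x \<bullet> h)) (at x)" "continuous_on (ball 0 r) G"
  shows "G 0 = 0"
    and "x \<in> ball 0 r \<Longrightarrow> N (horo q (N q) e x (u x)) = hyp_frame.graph_normal q (N q) e x (u x) (G x)"
proof -
  interpret hyp_frame q "N q" e by (rule fr)
  note gg = graph_boxD[OF gb]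
  have z: "0 \<in> ball (0 :: real ^ 'n) r" using gg(1) by simp
  have "mink (N q) (dF 0 1 (G 0) \<xi>) = 0" for \<xi>
    using graph_tangent[OF fr gb z G(1)[OF z]] N_normal(2)[OF q] gg(5) horo_base by metis
  moreover have "mink (N q) (dF 0 1 (G 0) \<xi>) = - (G 0 \<bullet> \<xi>)" for \<xi>
  proof -
    have "mink (N q) a = - 1 / 2" by (simp add: horo_a_def mink_simps mink_frame \<nu>_unit)
    then show ?thesis by (simp add: dF_def mink_simps horo_base \<nu>_e mink_frame)
  qed
  ultimately have "G 0 \<bullet> G 0 = 0" by (metis neg_equal_0_iff_equal)
  then show G0: "G 0 = 0" by simp
  define c where "c = (\<lambda>x. mink (N (\<Psi> x (u x))) (graph_normal x (u x) (G x)))"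
  have F: "\<Psi> x (u x) \<in> M" "0 < u x" if "x \<in> ball 0 r" for x using gg(8,10)[OF that] by auto
  have par: "N (\<Psi> x (u x)) = c x *\<^sub>R graph_normal x (u x) (G x)" if x: "x \<in> ball 0 r" for x
  proof -
    interpret f: hyp_frame "\<Psi> x (u x)" "graph_normal x (u x) (G x)" "\<lambda>v. dF x (u x) (G x) (u x *\<^sub>R gframe (G x) v)"
      by (rule graph_frame[OF F(2)[OF x]])
    have "mink (N (\<Psi> x (u x))) (\<Psi> x (u x)) = 0"
      using N_normal(1)[OF F(1)[OF x]] by (simp add: mink_commute)
    moreover have "mink (N (\<Psi> x (u x))) (dF x (u x) (G x) \<xi>) = 0" for \<xi>
      by (rule N_normal(2)[OF F(1)[OF x] graph_tangent[OF fr gb x G(1)[OF x]]])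
    ultimately show ?thesis
      using f.expand[of "N (\<Psi> x (u x))"] linear_0[OF f.e_linear] unfolding c_def by (simp add: zero_vec_def[symmetric])
  qed
  have c1: "c x \<in> {1, -1}" if x: "x \<in> ball 0 r" for x
  proof -
    interpret f: hyp_frame "\<Psi> x (u x)" "graph_normal x (u x) (G x)" "\<lambda>v. dF x (u x) (G x) (u x *\<^sub>R gframe (G x) v)"
      by (rule graph_frame[OF F(2)[OF x]])
    have "mink (N (\<Psi> x (u x))) (N (\<Psi> x (u x))) = c x * c x"
      unfolding par[OF x] mink_simps f.\<nu>_unit by simp
    then have "c x * c x = 1" using N_unit[OF F(1)[OF x]] by simp
    then show ?thesis using square_eq_1_iff[of "c x"] by auto
  qed
  have contF: "continuous_on (ball 0 r) (\<lambda>x. \<Psi> x (u x))"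
    using F(2) gg(6) by (intro continuous_on_horo continuous_intros) auto
  have contE: "continuous_on (ball 0 r) (\<lambda>x. e (G x))"
    using bounded_linear.continuous_on[OF _ G(2)] e_linear linear_conv_bounded_linear by blast
  have "continuous_on (ball 0 r) (\<lambda>x. graph_normal x (u x) (G x))"
    unfolding graph_normal_def Z_def slope_def
    by (intro continuous_intros contF contE G(2) gg(6)) (auto simp: add_nonneg_eq_0_iff)
  moreover have "continuous_on (ball 0 r) (\<lambda>x. N (\<Psi> x (u x)))"
    by (rule continuous_on_compose2[OF continuous_on_N contF]) (use F in auto)
  ultimately have "continuous_on (ball 0 r) c" unfolding c_def by (rule mink_continuous_on[rotated])
  moreover have "c ` ball 0 r \<subseteq> {1, -1}" using c1 by blast
  then have "finite (c ` ball 0 r)" by (rule finite_subset) simp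
  ultimately obtain k where k: "\<And>x. x \<in> ball 0 r \<Longrightarrow> c x = k"
    using continuous_finite_range_constant[of "ball 0 r" c] unfolding constant_on_def by auto
  have "graph_normal 0 (u 0) (G 0) = N q"
  proof -
    have "Z 0 1 0 = q - 2 *\<^sub>R a" by (simp add: Z_def horo_base linear_0[OF e_linear])
    also have "\<dots> = N q" by (simp add: horo_a_def)
    finally show ?thesis by (simp add: graph_normal_def slope_def G0 gg(5))
  qed
  then have "c 0 = 1" unfolding c_def gg(5) horo_base using \<nu>_unit by simp
  then have "k = 1" using k[OF z] by simp
  then show "N (\<Psi> x (u x)) = graph_normal x (u x) (G x)" if "x \<in> ball 0 r"
    using par[OF that] k[OF that] by simp
qed

text \<open>Differentiate the explicit normal of the graph.  As \<open>Z\<close> is orthogonal to the graph, the derivative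
of its length drops out when the result is paired with tangent vectors, and what remains is the
bilinear form \<open>B\<close>; the principal directions, pulled back through the adapted frame, diagonalise
it.\<close>

lemma graph_curvature:
  assumes q: "q \<in> M" and fr: "hyp_frame q (N q) e" and gb: "graph_box q (N q) e r \<delta> u"
    and G: "\<And>x. x \<in> ball 0 r \<Longrightarrow> (u has_derivative (\<lambda>h. G x \<bullet> h)) (at x)"
      "\<And>x. x \<in> ball 0 r \<Longrightarrow> (G has_derivative H x) (at x)"
    and x: "x \<in> ball 0 r"
  shows "diag_form (graph_form (u x) (G x) (H x)) (\<chi> i. \<kappa> (horo q (N q) e x (u x)) $ i - 1)"
proof -
  interpret hyp_frame q "N q" e by (rule fr)
  note gg = graph_boxD[OF gb]
  define p where "p = \<Psi> x (u x)"
  define y where "y = u x"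
  define g where "g = G x"
  define P where "P = gframe g"
  have y: "0 < y" and pM: "p \<in> M" using gg(8,10)[OF x] by (auto simp: y_def p_def)
  have S: "0 < slope g" by (rule slope_pos)
  have contG: "continuous_on (ball 0 r) G"
    by (intro continuous_at_imp_continuous_on ballI) (rule has_derivative_continuous[OF G(2)])
  have normal: "N (\<Psi> x (u x)) = graph_normal x (u x) (G x)" if "x \<in> ball 0 r" for x
    by (rule graph_gradient(2)[OF q fr gb _ contG that]) (rule G(1))
  obtain D and d :: "'n \<Rightarrow> 'n minkowski" where D: "(N has_derivative D) (at p within M)"
    and d: "\<And>i. d i \<in> tangent_space M p" "\<And>i j. mink (d i) (d j) = (if i = j then 1 else 0)"
    "\<And>i. hyp_proj p (D (d i)) = (\<kappa> p $ i) *\<^sub>R d i"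
    by (rule N_derivative[OF pM]) (rule that)
  define e' where "e' = (\<lambda>v. dF x y g (y *\<^sub>R P v))"
  interpret f: hyp_frame p "graph_normal x y g" e'
    unfolding p_def y_def[symmetric] e'_def P_def by (rule graph_frame[OF y])
  define v where "v = (\<lambda>i. \<chi> j. mink (d i) (e' (axis j 1)))"
  have dv: "d i = e' (v i)" for i
  proof -
    have "mink (d i) p = 0" using tangent_space_subset[OF M_sub d(1)[of i]] by (simp add: mink_commute)
    moreover have "mink (d i) (graph_normal x y g) = 0"
      using N_normal(2)[OF pM d(1)[of i]] normal[OF x] unfolding p_def y_def g_def by (simp add: mink_commute)
    ultimately show ?thesis using f.expand[of "d i"] unfolding v_def by simp
  qed
  have orth: "orthonormal_family v"
    unfolding orthonormal_family_def using d(2) dv f.e_iso by metis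
  define B where "B = (\<lambda>v w. (y / slope g) * (H x (P v) \<bullet> P w) + (1 / slope g) * (v \<bullet> w))"
  have linH: "linear (H x)" using has_derivative_linear[OF G(2)[OF x]] .
  have linP: "linear P" unfolding P_def by (rule linear_gframe)
  note lins = linear_add[OF linP] linear_cmul[OF linP] linear_add[OF linH] linear_cmul[OF linH]
    inner_add_left inner_add_right
  have lB: "linear (B v)" "linear (\<lambda>v. B v w)" for v w
  proof -
    show "linear (B v)"
      by (rule linearI) (simp_all add: B_def lins add_divide_distrib algebra_simps)
    show "linear (\<lambda>v. B v w)"
      by (rule linearI) (simp_all add: B_def lins add_divide_distrib algebra_simps)
  qed
  have sff: "mink (D (e' v)) (e' w) = B v w" for v w
  proof -
    have Fd: "((\<lambda>x. \<Psi> x (u x)) has_derivative dF x y g) (at x within ball 0 r)"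
      using horo_graph_derivative[OF G(1)[OF x]] gg(8)[OF x] has_derivative_at_withinI
      unfolding y_def g_def by fastforce
    have "(N has_derivative D) (at (\<Psi> x (u x)) within (\<lambda>x. \<Psi> x (u x)) ` ball 0 r)"
      by (rule has_derivative_subset[OF D[unfolded p_def]]) (use gg(10) in auto)
    from has_derivative_in_compose[OF Fd this]
    have "((\<lambda>x. N (\<Psi> x (u x))) has_derivative (\<lambda>\<eta>. D (dF x y g \<eta>))) (at x)"
      unfolding at_within_open[OF x open_ball] .
    then have d1: "((\<lambda>x. graph_normal x (u x) (G x)) has_derivative (\<lambda>\<eta>. D (dF x y g \<eta>))) (at x)"
      by (rule has_derivative_transform_within_open[OF _ open_ball x]) (rule normal)
    have "\<exists>\<sigma>. ((\<lambda>x. 1 / slope (G x)) has_derivative \<sigma>) (at x)"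
    proof -
      have "((\<lambda>x. 1 + G x \<bullet> G x) has_derivative (\<lambda>\<eta>. 2 * (G x \<bullet> H x \<eta>))) (at x)"
        by (auto intro!: derivative_eq_intros G(2)[OF x] simp: inner_commute)
      moreover have pos: "0 < 1 + G x \<bullet> G x" by (simp add: add_pos_nonneg)
      ultimately have "((\<lambda>x. sqrt (1 + G x \<bullet> G x)) has_derivative
          (\<lambda>\<eta>. 2 * (G x \<bullet> H x \<eta>) * (inverse (sqrt (1 + G x \<bullet> G x)) / 2))) (at x)"
        by (intro has_derivative_real_sqrt) auto
      then show ?thesis unfolding slope_def inverse_eq_divide[symmetric]
        using Deriv.has_derivative_inverse[of "\<lambda>x. sqrt (1 + G x \<bullet> G x)" x] pos by fastforce
    qed
    then obtain \<sigma> where \<sigma>: "((\<lambda>x. 1 / slope (G x)) has_derivative \<sigma>) (at x)" by blast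
    have dZ: "((\<lambda>x. Z x (u x) (G x)) has_derivative
        (\<lambda>\<eta>. e (H x \<eta>) + (2 * (x \<bullet> H x \<eta>)) *\<^sub>R a + dF x y g \<eta>)) (at x)"
      using Z_derivative[OF G(1)[OF x] _ G(2)[OF x]] gg(8)[OF x] unfolding y_def g_def by simp
    have "(\<lambda>\<eta>. D (dF x y g \<eta>)) = (\<lambda>\<eta>. (1 / slope (G x)) *\<^sub>R (e (H x \<eta>) + (2 * (x \<bullet> H x \<eta>)) *\<^sub>R a + dF x y g \<eta>)
        + \<sigma> \<eta> *\<^sub>R Z x (u x) (G x))"
      by (rule has_derivative_unique[OF d1[unfolded graph_normal_def] has_derivative_scaleR[OF \<sigma> dZ]])
    from fun_cong[OF this, of "y *\<^sub>R P v"]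
    have "D (e' v) = (1 / slope g) *\<^sub>R (e (H x (y *\<^sub>R P v)) + (2 * (x \<bullet> H x (y *\<^sub>R P v))) *\<^sub>R a + e' v)
        + \<sigma> (y *\<^sub>R P v) *\<^sub>R Z x y g" unfolding e'_def y_def g_def .
    then have "mink (D (e' v)) (e' w) = (1 / slope g) *
        (mink (e (H x (y *\<^sub>R P v)) + (2 * (x \<bullet> H x (y *\<^sub>R P v))) *\<^sub>R a) (e' w) + mink (e' v) (e' w))
        + \<sigma> (y *\<^sub>R P v) * mink (Z x y g) (e' w)"
      by (simp only: mink_add_left mink_scaleR_left)
    also have "mink (Z x y g) (e' w) = 0" unfolding e'_def using mink_Z(3) y by simp
    also have "mink (e' v) (e' w) = v \<bullet> w" by (rule f.e_iso)
    also have "mink (e (H x (y *\<^sub>R P v)) + (2 * (x \<bullet> H x (y *\<^sub>R P v))) *\<^sub>R a) (e' w)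
        = (H x (y *\<^sub>R P v) \<bullet> (y *\<^sub>R P w)) / y"
      unfolding e'_def using y by (intro mink_Z(4)) simp
    also have "\<dots> = y * (H x (P v) \<bullet> P w)" using y by (simp add: linear_cmul[OF linH])
    finally show ?thesis unfolding B_def by (simp add: algebra_simps)
  qed
  have Bv: "B (v i) (v j) = (if i = j then \<kappa> p $ i else 0)" for i j
  proof -
    have "mink p (d j) = 0" using tangent_space_subset[OF M_sub d(1)] .
    then have "mink (D (d i)) (d j) = mink (hyp_proj p (D (d i))) (d j)"
      by (simp add: hyp_proj_def mink_simps)
    also have "\<dots> = (if i = j then \<kappa> p $ i else 0)" unfolding d(3) by (simp add: mink_simps d(2))
    finally show ?thesis unfolding dv sff .
  qed
  have "graph_form y g (H x) w = (\<Sum>i\<in>UNIV. (\<kappa> p $ i - 1) * (w \<bullet> v i)\<^sup>2)" for w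
  proof -
    have "graph_form y g (H x) w = B w w - w \<bullet> w"
      unfolding graph_form_def B_def P_def by (simp add: algebra_simps)
    also have "\<dots> = (\<Sum>i\<in>UNIV. \<kappa> p $ i * (w \<bullet> v i)\<^sup>2) - (\<Sum>i\<in>UNIV. (w \<bullet> v i)\<^sup>2)"
      unfolding bilinear_diagonal[OF lB orth Bv] orthonormal_parseval[OF orth] ..
    finally show ?thesis by (simp add: sum_subtractf left_diff_distrib)
  qed
  then show ?thesis unfolding diag_form_def p_def y_def g_def using orth by auto
qed

lemma graph_solves:
  assumes q: "q \<in> M" and fr: "hyp_frame q (N q) e" and gb: "graph_box q (N q) e r \<delta> u"
    and f: "\<And>p. p \<in> M \<Longrightarrow> f (\<chi> i. \<kappa> p $ i - 1) = C"
  obtains G H where "graph_solution f C (ball 0 r) u G H" "G 0 = 0"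
    "\<And>x. x \<in> ball 0 r \<Longrightarrow> N (horo q (N q) e x (u x)) = hyp_frame.graph_normal q (N q) e x (u x) (G x)"
proof -
  note gg = graph_boxD[OF gb]
  obtain G H where G: "\<And>x. x \<in> ball 0 r \<Longrightarrow> (u has_derivative (\<lambda>h. G x \<bullet> h)) (at x)"
    "\<And>x. x \<in> ball 0 r \<Longrightarrow> (G has_derivative H x) (at x)"
    "\<And>v. continuous_on (ball 0 r) (\<lambda>x. H x v)"
    by (rule gradient_and_hessian[OF open_ball gg(4)]) (rule that, assumption+)
  have contG: "continuous_on (ball 0 r) G"
    by (intro continuous_at_imp_continuous_on ballI) (rule has_derivative_continuous[OF G(2)])
  have "graph_solution f C (ball 0 r) u G H"
    unfolding graph_solution_def
  proof (intro conjI ballI allI open_ball G gg(8))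
    fix x assume x: "x \<in> ball (0 :: real ^ 'n) r"
    let ?l = "\<chi> i. \<kappa> (horo q (N q) e x (u x)) $ i - 1"
    have pM: "horo q (N q) e x (u x) \<in> M" using gg(10)[OF x] .
    have "?l \<in> pos_cone" using hconvex pM \<kappa>[OF pM] unfolding strictly_h_convex_def pos_cone_def by simp
    then show "\<exists>l\<in>pos_cone. f l = C \<and> diag_form (graph_form (u x) (G x) (H x)) l"
      using f[OF pM] graph_curvature[OF q fr gb G(1,2) x] by blast
  qed
  then show ?thesis
  proof (rule that)
    show "G 0 = 0" by (rule graph_gradient(1)[OF q fr gb _ contG]) (rule G(1))
    show "N (horo q (N q) e x (u x)) = hyp_frame.graph_normal q (N q) e x (u x) (G x)"
      if "x \<in> ball 0 r" for x
      by (rule graph_gradient(2)[OF q fr gb _ contG that]) (rule G(1))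
  qed
qed

end

section \<open>Local comparison with the mirror image\<close>

lemma (in hyp_frame) reflect_graph_normal:
  assumes "0 < mink w w"
  shows "reflect w (graph_normal x y g)
    = hyp_frame.graph_normal (reflect w q) (reflect w \<nu>) (\<lambda>x. reflect w (e x)) x y g"
proof -
  interpret f: hyp_frame "reflect w q" "reflect w \<nu>" "\<lambda>x. reflect w (e x)"
    by (rule hyp_frame_reflect[OF assms])
  have "reflect w a = horo_a (reflect w q) (reflect w \<nu>)"
    by (simp add: horo_a_def linear_cmul[OF linear_reflect] linear_diff[OF linear_reflect])
  then show ?thesis
    unfolding graph_normal_def f.graph_normal_def Z_def f.Z_def
    by (simp add: linear_add[OF linear_reflect] linear_cmul[OF linear_reflect] reflect_horo)
qed

locale curvature_hypersurface = closed_hypersurface M \<kappa>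
  for M :: "'n::finite minkowski set" and \<kappa> +
  fixes f :: "real ^ 'n \<Rightarrow> real" and C :: real
  assumes f_smooth: "smooth_on pos_cone f" and f_symmetric: "symmetric_fun f"
    and f_increasing: "increasing_fun f"
    and curvature_eq: "\<And>p. p \<in> M \<Longrightarrow> f (\<chi> i. \<kappa> p $ i - 1) = C"
begin

text \<open>The compact body bounded by \<open>M\<close>.\<close>

definition K :: "'n minkowski set" where
  "K = hyp_space - E"

lemma M_subset_K: "M \<subseteq> K"
  using M_sub exterior_subset unfolding K_def by blast

text \<open>In the coordinates at \<open>q\<close> and in the mirrored coordinates at the image, \<open>M\<close> is given by two
functions \<open>u1\<close> and \<open>u2\<close> over one ball, and \<open>cap\<close> says \<open>u2 \<le> u1\<close> over the points on the
positive side.  If \<open>q\<close> is off the hyperplane this holds near the centre and the strong maximum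
principle applies.  If \<open>q\<close> lies on it, then \<open>u2\<close> is \<open>u1\<close> composed with a Euclidean reflection and the inequality
holds on a half ball; there both gradients vanish at the centre, a boundary point, and Hopf's lemma
leaves only equality.\<close>

lemma local_reflection:
  assumes w: "0 < mink w w" and q: "q \<in> M" "reflect w q \<in> M" and Nq: "N (reflect w q) = reflect w (N q)"
    and side: "0 \<le> mink q w"
    and cap: "\<And>z. z \<in> K \<Longrightarrow> 0 < mink z w \<Longrightarrow> reflect w z \<in> K"
  obtains W where "open W" "q \<in> W"
    "\<And>z. z \<in> W \<inter> hyp_space \<Longrightarrow> z \<in> M \<longleftrightarrow> reflect w z \<in> M"
    "\<And>z. z \<in> W \<inter> hyp_space \<Longrightarrow> z \<in> M \<Longrightarrow> N (reflect w z) = reflect w (N z)"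
proof -
  let ?R = "reflect w"
  obtain e where fr: "hyp_frame q (N q) e" by (rule frame_at[OF q(1)])
  interpret hyp_frame q "N q" e by (rule fr)
  have fr': "hyp_frame (?R q) (N (?R q)) (\<lambda>x. ?R (e x))" unfolding Nq by (rule hyp_frame_reflect[OF w])
  obtain r1 \<delta>1 u1 where gb1: "graph_box q (N q) e r1 \<delta>1 u1"
    by (rule graph_box_exists[OF fr q(1) outward_N[OF q(1)]])
  obtain r2 \<delta>2 u2 where gb2: "graph_box (?R q) (N (?R q)) (\<lambda>x. ?R (e x)) r2 \<delta>2 u2"
    by (rule graph_box_exists[OF fr' q(2) outward_N[OF q(2)]])
  note g1 = graph_boxD[OF gb1] and g2 = graph_boxD[OF gb2]
  obtain G1 H1 where sol1: "graph_solution f C (ball 0 r1) u1 G1 H1" and G10: "G1 0 = 0"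
    and n1: "\<And>x. x \<in> ball 0 r1 \<Longrightarrow> N (\<Psi> x (u1 x)) = graph_normal x (u1 x) (G1 x)"
    by (rule graph_solves[where f = f and C = C, OF q(1) fr gb1]) (erule curvature_eq, rule that, assumption+)
  obtain G2 H2 where sol2: "graph_solution f C (ball 0 r2) u2 G2 H2" and G20: "G2 0 = 0"
    and n2: "\<And>x. x \<in> ball 0 r2 \<Longrightarrow> N (horo (?R q) (N (?R q)) (\<lambda>x. ?R (e x)) x (u2 x))
        = hyp_frame.graph_normal (?R q) (N (?R q)) (\<lambda>x. ?R (e x)) x (u2 x) (G2 x)"
    by (rule graph_solves[where f = f and C = C, OF q(2) fr' gb2]) (erule curvature_eq, rule that, assumption+)
  have RP: "?R (\<Psi> x y) = horo (?R q) (N (?R q)) (\<lambda>x. ?R (e x)) x y" for x y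
    unfolding Nq by (rule reflect_horo)
  define s where "s = min r1 r2"
  have s: "0 < s" "ball (0 :: real ^ 'n) s \<subseteq> ball 0 r1" "ball (0 :: real ^ 'n) s \<subseteq> ball 0 r2"
    unfolding s_def using g1(1) g2(1) by auto
  have cu1: "continuous_on (ball 0 s) u1" "continuous_on (ball 0 s) u2"
    using continuous_on_subset g1(6) g2(6) s by blast+
  have up: "0 < u1 x" if "x \<in> ball 0 s" for x using g1(8) s(2) that by blast
  have cP: "continuous_on (ball 0 s) (\<lambda>x. \<Psi> x (u1 x))"
    using up by (intro continuous_on_horo continuous_intros cu1) auto
  \<comment> \<open>positive where both graphs lie in both boxes and, if \<open>q\<close> is off the hyperplane, \<open>M\<close> is on its positive side\<close>
  define h where "h = (\<lambda>x. min (min (\<delta>2 - \<bar>u1 x - 1\<bar>) (\<delta>1 - \<bar>u2 x - 1\<bar>))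
      (if mink q w = 0 then 1 else mink (\<Psi> x (u1 x)) w))"
  have ch: "continuous_on (ball 0 s) h"
    unfolding h_def using cu1 cP by (cases "mink q w = 0") (auto intro!: continuous_intros mink_continuous_on)
  have "0 < h 0" unfolding h_def using g1(2,5) g2(2,5) side horo_base by auto
  then have "0 \<in> ball 0 s \<inter> h -` {0<..}" using s(1) by simp
  moreover have "open (ball 0 s \<inter> h -` {0<..})" by (rule continuous_open_preimage[OF ch]) auto
  ultimately obtain r where r: "0 < r" "ball 0 r \<subseteq> ball 0 s \<inter> h -` {0<..}" using openE by blast
  have b1: "x \<in> ball 0 r1" and b2: "x \<in> ball 0 r2" if "x \<in> ball 0 r" for x :: "real ^ 'n"
    using r(2) s(2,3) that by blast+
  have hr: "\<bar>u1 x - 1\<bar> < \<delta>2" "\<bar>u2 x - 1\<bar> < \<delta>1" "mink q w \<noteq> 0 \<Longrightarrow> 0 < mink (\<Psi> x (u1 x)) w"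
    if x: "x \<in> ball 0 r" for x
  proof -
    have "0 < h x" using r(2) x by auto
    then show "\<bar>u1 x - 1\<bar> < \<delta>2" "\<bar>u2 x - 1\<bar> < \<delta>1" "mink q w \<noteq> 0 \<Longrightarrow> 0 < mink (\<Psi> x (u1 x)) w"
      unfolding h_def by auto
  qed
  have above: "u2 x \<le> u1 x" if x: "x \<in> ball 0 r" and pos: "0 < mink (\<Psi> x (u1 x)) w" for x
  proof (rule ccontr)
    assume "\<not> u2 x \<le> u1 x"
    then have "?R (\<Psi> x (u1 x)) \<in> E" unfolding RP using g2(11)[OF b2[OF x] hr(1)[OF x]] by simp
    moreover have "\<Psi> x (u1 x) \<in> K" using g1(10)[OF b1[OF x]] M_subset_K by blast
    ultimately show False using cap[OF _ pos] unfolding K_def by blast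
  qed
  have br: "open (ball (0 :: real ^ 'n) r)" "ball (0 :: real ^ 'n) r \<subseteq> ball 0 r1" "ball (0 :: real ^ 'n) r \<subseteq> ball 0 r2"
    using b1 b2 by auto
  note s1 = graph_solution_subset[OF sol1 br(1,2)] and s2 = graph_solution_subset[OF sol2 br(1,3)]
  have eq: "u1 x = u2 x" if x: "x \<in> ball 0 r" for x
  proof (cases "mink q w = 0")
    case False
    show ?thesis
    proof (rule strong_maximum_principle[OF f_smooth f_symmetric f_increasing s1 s2, where V = "ball 0 r" and a = 0])
      show "u2 x \<le> u1 x" if "x \<in> ball 0 r" for x using above[OF that hr(3)[OF that False]] .
    qed (use x r(1) g1(5) g2(5) in auto)
  next
    case True
    have Rq: "?R q = q" by (rule reflect_fixed[OF True])
    have wN: "mink (N q) w = 0"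
    proof -
      have "?R (N q) = N q" using Nq Rq by simp
      then have "mink (N q) w = - mink (N q) w" using mink_reflect[of w "N q"] w by simp
      then show ?thesis by simp
    qed
    have RN: "?R (N q) = N q" by (rule reflect_fixed[OF wN])
    define \<omega> where "\<omega> = (\<chi> i. mink w (e (axis i 1)))"
    have we: "w = e \<omega>" using expand[of w] True wN unfolding \<omega>_def by (simp add: mink_commute[of w])
    define m where "m = \<omega> \<bullet> \<omega>"
    have m: "0 < m" "mink w w = m" using w unfolding m_def we e_iso by simp_all
    \<comment> \<open>the reflection seen in the coordinates: \<open>w\<close> is horizontal, so only \<open>x\<close> changes\<close>
    define \<rho> where "\<rho> = (\<lambda>x. x - (2 * (x \<bullet> \<omega>) / m) *\<^sub>R \<omega>)"
    have \<rho>: "\<rho> x = x - (2 * (x \<bullet> \<omega>) / m) *\<^sub>R \<omega>" for x by (simp add: \<rho>_def)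
    have \<rho>\<omega>: "\<rho> x \<bullet> \<omega> = - (x \<bullet> \<omega>)" for x
      using m(1) by (simp add: \<rho>_def inner_diff_left m_def[symmetric])
    have \<rho>\<rho>: "\<rho> (\<rho> x) = x" for x
    proof -
      have "\<rho> (\<rho> x) = \<rho> x + (2 * (x \<bullet> \<omega>) / m) *\<^sub>R \<omega>" unfolding \<rho>[of "\<rho> x"] \<rho>\<omega> by simp
      then show ?thesis by (simp add: \<rho>_def)
    qed
    have "\<rho> x \<bullet> \<rho> x = x \<bullet> x" for x
    proof -
      have "\<rho> x \<bullet> \<rho> x = \<rho> x \<bullet> x - (2 * (x \<bullet> \<omega>) / m) * (\<rho> x \<bullet> \<omega>)"
        by (subst (2) \<rho>) (simp add: inner_diff_right)
      also have "\<dots> = x \<bullet> x - (2 * (x \<bullet> \<omega>) / m) * (x \<bullet> \<omega>) + (2 * (x \<bullet> \<omega>) / m) * (x \<bullet> \<omega>)"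
        unfolding \<rho>\<omega> by (simp add: \<rho> inner_diff_left inner_diff_right inner_commute)
      finally show ?thesis by simp
    qed
    then have \<rho>b: "\<rho> x \<in> ball 0 r" if "x \<in> ball 0 r" for x using that by (simp add: norm_eq_sqrt_inner)
    have Re: "?R (e x) = e (\<rho> x)" for x
      unfolding reflect_def m(2) we e_iso \<rho>_def
      by (simp add: linear_diff[OF e_linear] linear_cmul[OF e_linear] m_def)
    have RP': "?R (\<Psi> x y) = \<Psi> (\<rho> x) y" for x y
    proof -
      have "\<rho> x \<bullet> \<rho> x = x \<bullet> x" by fact
      moreover have "?R (\<Psi> x y) = horo q (N q) (\<lambda>x. e (\<rho> x)) x y" unfolding RP Rq Re ..
      ultimately show ?thesis by (simp add: horo_def)
    qed
    have u21: "u2 x = u1 (\<rho> x)" if x: "x \<in> ball 0 r" for x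
    proof -
      have "\<Psi> (\<rho> x) (u2 x) \<in> M" using g2(10)[OF b2[OF x]] unfolding RP[symmetric] RP' .
      then show ?thesis using g1(9)[OF b1[OF \<rho>b[OF x]] hr(2)[OF x]] by simp
    qed
    define V where "V = ball 0 r \<inter> {x. 0 < x \<bullet> \<omega>}"
    have V: "open V" "connected V" "V \<subseteq> ball 0 r"
    proof -
      have "open {x. 0 < x \<bullet> \<omega>}" by (intro open_Collect_less continuous_intros)
      then show "open V" unfolding V_def by auto
      have "convex {x. 0 < x \<bullet> \<omega>}" using convex_halfspace_gt[of 0 \<omega>] by (simp add: inner_commute)
      then show "connected V" unfolding V_def by (intro convex_connected convex_Int) auto
      show "V \<subseteq> ball 0 r" unfolding V_def by blast
    qed
    have aboveV: "u2 x \<le> u1 x" if "x \<in> V" for x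
    proof (rule above)
      show x: "x \<in> ball 0 r" using that V(3) by blast
      have "mink (\<Psi> x (u1 x)) w = (x \<bullet> \<omega>) / u1 x"
        unfolding we using g1(8)[OF b1[OF x]] by (intro mink_point) simp
      then show "0 < mink (\<Psi> x (u1 x)) w" using that g1(8)[OF b1[OF x]] unfolding V_def by simp
    qed
    have eqV: "u1 x = u2 x" if xV: "x \<in> V" for x
    proof (rule ccontr)
      assume ne: "u1 x \<noteq> u2 x"
      have strict: "u2 y < u1 y" if y: "y \<in> V" for y
      proof (rule ccontr)
        assume "\<not> u2 y < u1 y"
        then have "u1 y = u2 y" using aboveV[OF y] by simp
        then have "u1 x = u2 x"
          using strong_maximum_principle[OF f_smooth f_symmetric f_increasing s1 s2 V aboveV y _ xV] by blast
        then show False using ne by simp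
      qed
      define t where "t = r / (4 * norm \<omega>)"
      have n\<omega>: "0 < norm \<omega>" using m(1) unfolding m_def by simp
      have t: "0 < t" "t * norm \<omega> = r / 4" unfolding t_def using r(1) n\<omega> by simp_all
      \<comment> \<open>centre of a ball in the half ball that touches its flat side at 0\<close>
      define c where "c = t *\<^sub>R \<omega>"
      have nc: "norm c = r / 4" unfolding c_def using t by simp
      have cb: "cball c (r / 4) \<subseteq> ball 0 r"
      proof
        fix y assume "y \<in> cball c (r / 4)"
        then have "norm (y - c) \<le> r / 4" by (simp add: dist_norm norm_minus_commute)
        moreover have "norm y \<le> norm (y - c) + norm c" using norm_triangle_ineq[of "y - c" c] by simp
        ultimately show "y \<in> ball 0 r" using nc r(1) by simp
      qed
      have cV: "y \<in> V" if y: "y \<in> cball c (r / 4) - {0}" for y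
      proof -
        have "(norm (y - c))\<^sup>2 \<le> (norm c)\<^sup>2"
          using y nc by (intro power_mono) (auto simp: dist_norm norm_minus_commute)
        then have "y \<bullet> y \<le> 2 * (y \<bullet> c)"
          unfolding power2_norm_eq_inner by (simp add: inner_diff_left inner_diff_right inner_commute)
        moreover have "0 < y \<bullet> y" using y by simp
        ultimately have "0 < y \<bullet> c" by linarith
        then have "0 < t * (y \<bullet> \<omega>)" unfolding c_def by simp
        then have "0 < y \<bullet> \<omega>" using t(1) by (simp add: zero_less_mult_iff)
        then show ?thesis unfolding V_def using y cb by blast
      qed
      have "G1 0 \<noteq> G2 0"
        by (rule hopf_boundary_gradient[OF f_smooth f_symmetric f_increasing s1 s2 _ cb])
          (use r(1) nc g1(5) g2(5) strict cV in auto)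
      then show False using G10 G20 by simp
    qed
    show ?thesis
    proof -
      consider "x \<in> V" | "x \<bullet> \<omega> = 0" | "x \<bullet> \<omega> < 0" using x unfolding V_def by force
      then show ?thesis
      proof cases
        case 1 then show ?thesis by (rule eqV)
      next
        case 2 then show ?thesis using u21[OF x] by (simp add: \<rho>_def)
      next
        case 3
        have "\<rho> x \<in> V" unfolding V_def using \<rho>b[OF x] 3 \<rho>\<omega>[of x] by simp
        from eqV[OF this] show ?thesis using u21[OF \<rho>b[OF x]] u21[OF x] \<rho>\<rho>[of x] by simp
      qed
    qed
  qed
  define \<delta> where "\<delta> = min \<delta>1 \<delta>2"
  have \<delta>: "0 < \<delta>" unfolding \<delta>_def using g1(2) g2(2) by simp
  obtain W where W: "open W" "q \<in> W" "W \<inter> hyp_space = {p \<in> hyp_space. horo_x q (N q) e p \<in> ball 0 r \<and> \<bar>horo_y q (N q) p - 1\<bar> < \<delta>}"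
    by (rule chart_box[OF r(1) \<delta>])
  have Gx: "G1 x = G2 x" if x: "x \<in> ball 0 r" for x
  proof -
    have "(u2 has_derivative (\<lambda>h. G1 x \<bullet> h)) (at x)"
      by (rule has_derivative_transform_within_open[OF graph_solutionD(2)[OF sol1 b1[OF x]] open_ball x]) (rule eq)
    then have "(\<lambda>h. G1 x \<bullet> h) = (\<lambda>h. G2 x \<bullet> h)"
      using has_derivative_unique graph_solutionD(2)[OF sol2 b2[OF x]] by blast
    then show ?thesis by (metis vector_eq_rdot)
  qed
  have main: "(z \<in> M \<longleftrightarrow> ?R z \<in> M) \<and> (z \<in> M \<longrightarrow> N (?R z) = ?R (N z))" if z: "z \<in> W \<inter> hyp_space" for z
  proof -
    define x y where "x = horo_x q (N q) e z" and "y = horo_y q (N q) z"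
    have zH: "z \<in> hyp_space" using z by blast
    have xy: "x \<in> ball 0 r" "\<bar>y - 1\<bar> < \<delta>1" "\<bar>y - 1\<bar> < \<delta>2" and zP: "z = \<Psi> x y"
      using z horo_chart[OF zH] unfolding W(3) x_def y_def \<delta>_def by auto
    have 1: "z \<in> M \<longleftrightarrow> y = u1 x" unfolding zP using g1(9)[OF b1[OF xy(1)] xy(2)] .
    have 2: "?R z \<in> M \<longleftrightarrow> y = u2 x" unfolding zP RP using g2(9)[OF b2[OF xy(1)] xy(3)] .
    have "N (?R z) = ?R (N z)" if "z \<in> M"
    proof -
      have y: "y = u1 x" "y = u2 x" using that 1 eq[OF xy(1)] by simp_all
      have "N z = graph_normal x y (G1 x)" unfolding zP y(1) using n1[OF b1[OF xy(1)]] .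
      moreover have "N (?R z) = hyp_frame.graph_normal (?R q) (N (?R q)) (\<lambda>x. ?R (e x)) x y (G1 x)"
        unfolding zP RP Gx[OF xy(1)] y(2) using n2[OF b2[OF xy(1)]] .
      ultimately show ?thesis using reflect_graph_normal[OF w, of x y "G1 x"] unfolding Nq by simp
    qed
    then show ?thesis using 1 2 eq[OF xy(1)] by simp
  qed
  show ?thesis using that[OF W(1,2)] main by blast
qed

end

section \<open>The body bounded by the hypersurface\<close>

lemma hyp_space_snd_gt: "p \<in> hyp_space \<Longrightarrow> norm (fst p) < snd p"
  by (simp add: hyp_space_iff real_less_rsqrt)

lemma hyp_mink_lower:
  assumes "c \<in> hyp_space" "x \<in> hyp_space"
  shows "snd x * (snd c - norm (fst c)) \<le> - mink c x"
proof -
  have "fst c \<bullet> fst x \<le> norm (fst c) * norm (fst x)" by (rule norm_cauchy_schwarz)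
  also have "\<dots> \<le> norm (fst c) * snd x"
    using hyp_space_snd_gt[OF assms(2)] by (intro mult_left_mono) auto
  finally show ?thesis unfolding mink_def by (simp add: algebra_simps)
qed

lemma closed_hyp_space: "closed (hyp_space :: 'n::finite minkowski set)"
proof -
  have "hyp_space = {p :: 'n minkowski. snd p = sqrt (1 + (norm (fst p))\<^sup>2)}" using hyp_space_iff by blast
  moreover have "closed {p :: 'n minkowski. snd p = sqrt (1 + (norm (fst p))\<^sup>2)}"
    by (intro closed_Collect_eq continuous_intros)
  ultimately show ?thesis by simp
qed

lemma bounded_hyp_ball:
  assumes "c \<in> hyp_space"
  shows "bounded {x \<in> hyp_space. - mink c x \<le> T}"
proof -
  define k where "k = snd c - norm (fst c)"
  have k: "0 < k" using hyp_space_snd_gt[OF assms] by (simp add: k_def)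
  have "norm x \<le> 2 * (T / k)" if x: "x \<in> hyp_space" "- mink c x \<le> T" for x
  proof -
    have "snd x * k \<le> T" using hyp_mink_lower[OF assms x(1)] x(2) unfolding k_def by linarith
    then have s: "snd x \<le> T / k" using k by (simp add: field_simps)
    have "norm x \<le> norm (fst x) + norm (snd x)" using norm_Pair_le[of "fst x" "snd x"] by simp
    moreover have "norm (fst x) < snd x" by (rule hyp_space_snd_gt[OF x(1)])
    moreover have "0 \<le> norm (fst x)" by simp
    ultimately have "norm x \<le> snd x + snd x" unfolding real_norm_def by linarith
    then show ?thesis using s by linarith
  qed
  then show ?thesis unfolding bounded_iff by blast
qed

text \<open>The orthogonal complement of a timelike vector is positive definite: the time component of \<open>r\<close>
is controlled by the Cauchy-Schwarz inequality.\<close>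

lemma spacelike:
  assumes c: "c \<in> hyp_space" and r: "mink r c = 0"
  shows "0 \<le> mink r r" and "r \<noteq> 0 \<Longrightarrow> 0 < mink r r"
proof -
  define k where "k = snd c"
  define n where "n = fst r \<bullet> fst r"
  have k: "0 < k" using c by (simp add: k_def hyp_space_def)
  have kk: "fst c \<bullet> fst c = k\<^sup>2 - 1" using c by (simp add: hyp_space_def mink_def k_def power2_eq_square)
  have "(snd r * k)\<^sup>2 = (fst r \<bullet> fst c)\<^sup>2" using r by (simp add: mink_def k_def)
  also have "\<dots> \<le> n * (k\<^sup>2 - 1)" unfolding n_def kk[symmetric] by (rule Cauchy_Schwarz_ineq)
  finally have "n \<le> k\<^sup>2 * (n - (snd r)\<^sup>2)" by (simp add: power_mult_distrib algebra_simps)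
  moreover have "mink r r = n - (snd r)\<^sup>2" by (simp add: mink_def n_def power2_eq_square)
  ultimately have le: "n \<le> k\<^sup>2 * mink r r" by simp
  moreover have n: "0 \<le> n" by (simp add: n_def)
  moreover have k2: "0 < k\<^sup>2" using k by simp
  ultimately have "0 \<le> k\<^sup>2 * mink r r" by linarith
  then show ge: "0 \<le> mink r r" using k2 by (simp add: zero_le_mult_iff)
  show "0 < mink r r" if "r \<noteq> 0"
  proof (rule ccontr)
    assume "\<not> 0 < mink r r"
    then have z: "mink r r = 0" using ge by simp
    then have "n = 0" using le n by simp
    then have "fst r = 0" by (simp add: n_def)
    moreover from this z have "snd r = 0" by (simp add: mink_def)
    ultimately show False using that by (simp add: prod_eq_iff)
  qed
qed

text \<open>Strict bound for the position parameter of the hyperplane through \<open>z\<close>: the component of \<open>z\<close>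
orthogonal to \<open>c\<close> and \<open>w\<close> is spacelike.\<close>

lemma axis_component_less:
  assumes c: "c \<in> hyp_space" and w: "mink w w = 1" "mink w c = 0" and z: "z \<in> hyp_space"
  shows "\<bar>mink z w\<bar> < - mink z c"
proof -
  define \<alpha> where "\<alpha> = - mink z c"
  define \<beta> where "\<beta> = mink z w"
  define r where "r = z - \<alpha> *\<^sub>R c - \<beta> *\<^sub>R w"
  have cc: "mink c c = -1" and zz: "mink z z = -1" using c z by (simp_all add: hyp_space_def)
  have "mink r c = 0" unfolding r_def by (simp add: mink_simps cc w \<alpha>_def)
  then have "0 \<le> mink r r" by (rule spacelike(1)[OF c])
  moreover have "mink r r = -1 + \<alpha>\<^sup>2 - \<beta>\<^sup>2"
    unfolding r_def
    by (simp add: mink_simps cc w zz mink_commute[of c w] mink_commute[of c z] mink_commute[of w z]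
        \<alpha>_def \<beta>_def power2_eq_square algebra_simps)
  ultimately have "\<beta>\<^sup>2 < \<alpha>\<^sup>2" by linarith
  then have "\<bar>\<beta>\<bar> < \<bar>\<alpha>\<bar>" using power2_less_imp_less[of "\<bar>\<beta>\<bar>" "\<bar>\<alpha>\<bar>"] by simp
  moreover have "1 \<le> \<alpha>" using hyp_mink_le[OF z c] by (simp add: \<alpha>_def)
  ultimately show ?thesis unfolding \<alpha>_def \<beta>_def by simp
qed

context closed_hypersurface
begin

text \<open>Outside a large ball hyperbolic space is connected, unbounded and disjoint from \<open>M\<close>.\<close>

lemma exterior_far:
  obtains B where "\<And>z. z \<in> hyp_space \<Longrightarrow> B < norm (fst z) \<Longrightarrow> z \<in> E"
proof -
  define \<iota> :: "(real ^ 'n) \<times> real \<Rightarrow> 'n minkowski" where "\<iota> = (\<lambda>X. (X, sqrt (1 + (norm X)\<^sup>2)))"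
  have \<iota>H: "\<iota> X \<in> hyp_space" for X unfolding hyp_space_iff \<iota>_def by simp
  obtain B where B: "\<And>p. p \<in> M \<Longrightarrow> norm p \<le> B" using compact_imp_bounded[OF compact_M] unfolding bounded_iff by blast
  define S where "S = \<iota> ` (- cball 0 B)"
  have S1: "connected S"
  proof -
    have "2 \<le> DIM((real ^ 'n) \<times> real)" by (simp add: Suc_leI)
    then have "connected (- cball (0 :: (real ^ 'n) \<times> real) B)"
      by (intro connected_complement_bounded_convex) auto
    then show ?thesis unfolding S_def \<iota>_def by (intro connected_continuous_image continuous_intros)
  qed
  have S2: "S \<subseteq> hyp_space - M"
  proof
    fix p assume "p \<in> S"
    then obtain X where X: "p = \<iota> X" "B < norm X" unfolding S_def by auto
    have "norm X \<le> norm p" unfolding X(1) \<iota>_def by (rule norm_fst_le)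
    then have "p \<notin> M" using B[of p] X(2) by linarith
    then show "p \<in> hyp_space - M" using X(1) \<iota>H by blast
  qed
  have "z \<in> E" if z: "z \<in> hyp_space" "B < norm (fst z)" for z
  proof -
    have "z = \<iota> (fst z)" using z(1) unfolding \<iota>_def hyp_space_iff by (simp add: prod_eq_iff)
    then have zS: "z \<in> S" using z(2) unfolding S_def by force
    have sub: "S \<subseteq> connected_component_set (hyp_space - M) z"
      using connected_component_maximal[OF zS S1 S2] .
    have "\<not> hyp_bounded (connected_component_set (hyp_space - M) z)"
    proof
      assume "hyp_bounded (connected_component_set (hyp_space - M) z)"
      then obtain c R where c: "c \<in> hyp_space" and R: "\<And>x. x \<in> S \<Longrightarrow> hyp_dist c x \<le> R"
        using sub unfolding hyp_bounded_def by blast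
      have le: "- mink c x \<le> cosh R" if x: "x \<in> S" for x
      proof -
        have "x \<in> hyp_space" using x S2 by blast
        then have m: "1 \<le> - mink c x" using hyp_mink_le[OF c] by fastforce
        then have "0 \<le> arcosh (- mink c x)" by simp
        then have "cosh (arcosh (- mink c x)) \<le> cosh R"
          using R[OF x] unfolding hyp_dist_def by (subst cosh_real_nonneg_le_iff) auto
        then show ?thesis using m by simp
      qed
      then have "S \<subseteq> {x \<in> hyp_space. - mink c x \<le> cosh R}" using S2 by blast
      then have "bounded S" using bounded_hyp_ball[OF c] bounded_subset by blast
      then obtain b where b: "\<And>x. x \<in> S \<Longrightarrow> norm x \<le> b" unfolding bounded_iff by blast
      define X :: "(real ^ 'n) \<times> real" where "X = (0, \<bar>B\<bar> + \<bar>b\<bar> + 1)"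
      have nX: "norm X = \<bar>B\<bar> + \<bar>b\<bar> + 1" unfolding X_def by (simp add: norm_Pair)
      then have "\<iota> X \<in> S" unfolding S_def by auto
      then have "norm (\<iota> X) \<le> b" by (rule b)
      moreover have "norm X \<le> norm (\<iota> X)" unfolding \<iota>_def by (rule norm_fst_le)
      ultimately show False using nX by linarith
    qed
    then show ?thesis using zS S2 unfolding exterior_region_def by blast
  qed
  then show ?thesis using that by blast
qed

lemma exterior_accumulates:
  assumes p: "p \<in> M" and W: "open W" "p \<in> W"
  obtains z where "z \<in> W" "z \<in> E"
proof -
  have "((\<lambda>t. hyp_geodesic p (N p) t) \<longlongrightarrow> hyp_geodesic p (N p) 0) (at_right 0)"
    unfolding hyp_geodesic_def by (intro tendsto_intros)
  then have "\<forall>\<^sub>F t in at_right 0. hyp_geodesic p (N p) t \<in> W"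
    using W by (intro topological_tendstoD) (auto simp: hyp_geodesic_def)
  moreover have "\<forall>\<^sub>F t in at_right 0. hyp_geodesic p (N p) t \<in> E"
    using outward_N[OF p] unfolding outward_unit_normal_def by blast
  ultimately have "\<forall>\<^sub>F t in at_right 0. hyp_geodesic p (N p) t \<in> W \<and> hyp_geodesic p (N p) t \<in> E"
    by eventually_elim simp
  then show ?thesis using that eventually_happens'[OF trivial_limit_at_right_real] by blast
qed

lemma local_defining_function:
  assumes x: "x \<in> M"
  obtains V \<phi> where "open V" "x \<in> V" "smooth_on V \<phi>"
    "\<And>z. z \<in> V \<inter> hyp_space \<Longrightarrow> z \<in> E \<longleftrightarrow> 0 < (\<phi> z :: real)"
    "\<And>z. z \<in> V \<inter> hyp_space \<Longrightarrow> z \<in> M \<longleftrightarrow> \<phi> z = 0"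
    "\<And>v. mink x v = 0 \<Longrightarrow> 0 < mink v (N x) \<Longrightarrow> 0 < frechet_derivative \<phi> (at x) v"
proof -
  obtain e where fr: "hyp_frame x (N x) e" by (rule frame_at[OF x])
  interpret hyp_frame x "N x" e by (rule fr)
  obtain U \<phi> r \<delta> u where l: "open U" "x \<in> U" "smooth_on U \<phi>" "M \<inter> U = {z \<in> hyp_space \<inter> U. \<phi> z = (0::real)}"
    "0 < frechet_derivative \<phi> (at x) (N x)"
    "\<And>v. mink x v = 0 \<Longrightarrow> frechet_derivative \<phi> (at x) v = mink v (N x) * frechet_derivative \<phi> (at x) (N x)"
    "0 < r" "0 < \<delta>" "\<delta> < 1" "\<And>k. Ck_on k (ball 0 r) u" "u 0 = 1"
    "\<And>x. x \<in> ball 0 r \<Longrightarrow> \<bar>u x - 1\<bar> < \<delta>"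
    "\<And>z y. z \<in> ball 0 r \<Longrightarrow> \<bar>y - 1\<bar> < \<delta> \<Longrightarrow> horo x (N x) e z y \<in> U \<and>
      (horo x (N x) e z y \<in> M \<longleftrightarrow> y = u z) \<and> (0 < \<phi> (horo x (N x) e z y) \<longleftrightarrow> y < u z)"
    "\<And>z y. z \<in> ball 0 r \<Longrightarrow> \<bar>y - 1\<bar> < \<delta> \<Longrightarrow> y < u z \<Longrightarrow> horo x (N x) e z y \<in> E"
    by (rule local_graph[OF fr x outward_N[OF x]]) (rule that, assumption+)
  have gb: "graph_box x (N x) e r \<delta> u"
    unfolding graph_box_def by (intro conjI ballI allI impI; simp add: l)
  obtain W where W: "open W" "x \<in> W" "W \<inter> hyp_space = {p \<in> hyp_space. horo_x x (N x) e p \<in> ball 0 r \<and> \<bar>horo_y x (N x) p - 1\<bar> < \<delta>}"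
    by (rule chart_box[OF l(7,8)])
  show ?thesis
  proof (rule that[of "U \<inter> W" \<phi>])
    show "open (U \<inter> W)" using l(1) W(1) by blast
    show "x \<in> U \<inter> W" using l(2) W(2) by simp
    show "smooth_on (U \<inter> W) \<phi>" using l(3) Ck_subset unfolding smooth_on_def by blast
    show "z \<in> E \<longleftrightarrow> 0 < \<phi> z" if z: "z \<in> U \<inter> W \<inter> hyp_space" for z
    proof -
      have zH: "z \<in> hyp_space" and "z \<in> W \<inter> hyp_space" using z by auto
      then have b: "horo_x x (N x) e z \<in> ball 0 r" "\<bar>horo_y x (N x) z - 1\<bar> < \<delta>" unfolding W(3) by auto
      show ?thesis using exterior_iff_below_graph[OF fr gb b] l(13)[OF b] unfolding horo_chart[OF zH] by blast
    qed
    show "z \<in> M \<longleftrightarrow> \<phi> z = 0" if z: "z \<in> U \<inter> W \<inter> hyp_space" for z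
    proof -
      have "z \<in> M \<inter> U \<longleftrightarrow> z \<in> {z \<in> hyp_space \<inter> U. \<phi> z = 0}" unfolding l(4) ..
      then show ?thesis using z by simp
    qed
    show "0 < frechet_derivative \<phi> (at x) v" if "mink x v = 0" "0 < mink v (N x)" for v
      using l(5) l(6)[OF that(1)] that(2) by simp
  qed
qed

end

context curvature_hypersurface
begin

lemma K_interior:
  assumes "p \<in> K - M"
  obtains W where "open W" "p \<in> W" "W \<inter> hyp_space \<subseteq> K - M"
proof -
  have p: "p \<in> hyp_space - M" "p \<notin> E" using assms unfolding K_def by auto
  obtain W where "open W" "p \<in> W" "W \<inter> hyp_space \<subseteq> E \<or> W \<inter> hyp_space \<inter> E = {}" "W \<inter> hyp_space \<inter> M = {}"
    by (rule exterior_locally_constant[OF closed_M p(1)])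
  then show ?thesis using that p unfolding K_def by blast
qed

lemma closed_K: "closed K"
proof -
  have "\<exists>W. open W \<and> p \<in> W \<and> W \<inter> K = {}" if p: "p \<notin> K" for p
  proof (cases "p \<in> hyp_space")
    case False
    then show ?thesis using closed_hyp_space unfolding K_def by (intro exI[of _ "- hyp_space"]) auto
  next
    case True
    then have pE: "p \<in> E" "p \<in> hyp_space - M" using p exterior_subset unfolding K_def by auto
    obtain W where "open W" "p \<in> W" "W \<inter> hyp_space \<subseteq> E \<or> W \<inter> hyp_space \<inter> E = {}"
      by (rule exterior_locally_constant[OF closed_M pE(2)])
    then show ?thesis using pE unfolding K_def by (intro exI[of _ W]) blast
  qed
  have "open (- K)"
    unfolding open_subopen[of "- K"]
  proof
    fix p assume "p \<in> - K"
    then obtain W where "open W" "p \<in> W" "W \<inter> K = {}" using \<open>\<And>p. p \<notin> K \<Longrightarrow> _\<close> by blast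
    then show "\<exists>T. open T \<and> p \<in> T \<and> T \<subseteq> - K" by blast
  qed
  then show ?thesis by (simp add: closed_def)
qed

lemma compact_K: "compact K"
proof -
  obtain B where B: "\<And>z. z \<in> hyp_space \<Longrightarrow> B < norm (fst z) \<Longrightarrow> z \<in> E"
    by (rule exterior_far) (rule that, assumption+)
  have "norm z \<le> B + sqrt (1 + B\<^sup>2)" if z: "z \<in> K" for z
  proof -
    have zH: "z \<in> hyp_space" and f: "norm (fst z) \<le> B" using z B[of z] unfolding K_def by force+
    have "snd z \<le> sqrt (1 + B\<^sup>2)" using zH f unfolding hyp_space_iff by (simp add: power_mono)
    moreover have "0 < snd z" using zH by (simp add: hyp_space_def)
    moreover have "norm z \<le> norm (fst z) + norm (snd z)" using norm_Pair_le[of "fst z" "snd z"] by simp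
    ultimately show ?thesis using f by simp
  qed
  then have "bounded K" unfolding bounded_iff by blast
  then show ?thesis using closed_K compact_eq_bounded_closed by blast
qed

text \<open>A defining function increases strictly along all directions near \<open>w0\<close>, at all points near \<open>x\<close>, so
moving a point of \<open>K\<close> backwards along such a direction takes it off the exterior and off \<open>M\<close>.  The
direction may vary with the points, which is needed when the hyperplane moves.\<close>

lemma inward_monotone:
  assumes x: "x \<in> M" and w0: "mink x w0 = 0" "0 < mink w0 (N x)"
  obtains \<epsilon> where "0 < \<epsilon>"
    "\<And>z z' w c. z \<in> ball x \<epsilon> \<Longrightarrow> z' \<in> ball x \<epsilon> \<Longrightarrow> w \<in> ball w0 \<epsilon> \<Longrightarrow> 0 < c \<Longrightarrow> z = z' + c *\<^sub>R w \<Longrightarrow>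
      z \<in> K \<Longrightarrow> z' \<in> hyp_space \<Longrightarrow> z' \<in> K - M"
proof -
  obtain V \<phi> where V: "open V" "x \<in> V" "smooth_on V \<phi>"
    and VE: "\<And>z. z \<in> V \<inter> hyp_space \<Longrightarrow> z \<in> E \<longleftrightarrow> 0 < (\<phi> z :: real)"
    and VM: "\<And>z. z \<in> V \<inter> hyp_space \<Longrightarrow> z \<in> M \<longleftrightarrow> \<phi> z = 0"
    and D: "\<And>v. mink x v = 0 \<Longrightarrow> 0 < mink v (N x) \<Longrightarrow> 0 < frechet_derivative \<phi> (at x) v"
    by (rule local_defining_function[OF x]) (rule that, assumption+)
  have d\<phi>: "(\<phi> has_derivative frechet_derivative \<phi> (at z)) (at z)" if "z \<in> V" for z
    using smooth_on_has_derivative[OF V(3) that] .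
  define g where "g = (\<lambda>z. \<Sum>b\<in>Basis. (snd z \<bullet> b) * frechet_derivative \<phi> (at (fst z)) b)"
  have g: "frechet_derivative \<phi> (at z) v = g (z, v)" if "z \<in> V" for z v
  proof -
    have lin: "linear (frechet_derivative \<phi> (at z))" using has_derivative_linear[OF d\<phi>[OF that]] .
    have "frechet_derivative \<phi> (at z) v = frechet_derivative \<phi> (at z) (\<Sum>b\<in>Basis. (v \<bullet> b) *\<^sub>R b)"
      by (simp only: euclidean_representation)
    then show ?thesis by (simp add: g_def linear_sum[OF lin] linear_cmul[OF lin])
  qed
  have cb: "continuous_on V (\<lambda>z. frechet_derivative \<phi> (at z) b)" for b
    using Ck_SucD(2)[OF smooth_onD[OF V(3), of "Suc 0"]] by simp
  have "continuous_on (V \<times> UNIV) g"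
    unfolding g_def by (intro continuous_intros continuous_on_compose2[OF cb]) auto
  then have "open (V \<times> UNIV \<inter> g -` {0<..})"
    by (intro continuous_open_preimage open_Times V(1)) auto
  moreover have "(x, w0) \<in> V \<times> UNIV \<inter> g -` {0<..}" using V(2) D[OF w0] g[OF V(2)] by simp
  ultimately obtain A B where AB: "open A" "open B" "(x, w0) \<in> A \<times> B" "A \<times> B \<subseteq> V \<times> UNIV \<inter> g -` {0<..}"
    by (rule open_prod_elim)
  obtain e1 where e1: "0 < e1" "ball x e1 \<subseteq> A" using AB(1,3) openE by blast
  obtain e2 where e2: "0 < e2" "ball w0 e2 \<subseteq> B" using AB(2,3) openE by blast
  show ?thesis
  proof (rule that[of "min e1 e2"])
    show "0 < min e1 e2" using e1 e2 by simp
    fix z z' w c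
    assume z: "z \<in> ball x (min e1 e2)" "z' \<in> ball x (min e1 e2)" "w \<in> ball w0 (min e1 e2)" "0 < (c :: real)"
      "z = z' + c *\<^sub>R w" "z \<in> K" "z' \<in> hyp_space"
    have AV: "p \<in> V" if "p \<in> A" for p using AB(3,4) that by blast
    have bV: "p \<in> V" if "p \<in> ball x (min e1 e2)" for p
    proof -
      have "p \<in> ball x e1" using that by simp
      then show ?thesis using e1(2) AV by blast
    qed
    have pos: "0 < frechet_derivative \<phi> (at p) w" if p: "p \<in> ball x (min e1 e2)" for p
    proof -
      have "(p, w) \<in> A \<times> B" using p z(3) e1 e2 by auto
      then have "p \<in> V" "0 < g (p, w)" using AB(4) by auto
      then show ?thesis using g by simp
    qed
    have seg: "z' + t *\<^sub>R (c *\<^sub>R w) \<in> ball x (min e1 e2)" if t: "0 \<le> t" "t \<le> 1" for t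
    proof -
      have "z' + t *\<^sub>R (c *\<^sub>R w) = (1 - t) *\<^sub>R z' + t *\<^sub>R z" unfolding z(5) by (simp add: algebra_simps)
      then show ?thesis using convexD_alt[OF convex_ball z(2,1) t] by simp
    qed
    have der: "((\<lambda>t. \<phi> (z' + t *\<^sub>R (c *\<^sub>R w))) has_real_derivative
        c * frechet_derivative \<phi> (at (z' + t *\<^sub>R (c *\<^sub>R w))) w) (at t)" if t: "0 \<le> t" "t \<le> 1" for t
    proof -
      let ?p = "z' + t *\<^sub>R (c *\<^sub>R w)"
      have pV: "?p \<in> V" by (rule bV[OF seg[OF t]])
      have "((\<lambda>t. z' + t *\<^sub>R (c *\<^sub>R w)) has_derivative (\<lambda>h. h *\<^sub>R (c *\<^sub>R w))) (at t)"
        by (auto intro!: derivative_eq_intros)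
      from has_derivative_compose[OF this d\<phi>[OF pV]]
      have "((\<lambda>t. \<phi> (z' + t *\<^sub>R (c *\<^sub>R w))) has_derivative (\<lambda>h. frechet_derivative \<phi> (at ?p) (h *\<^sub>R (c *\<^sub>R w)))) (at t)" .
      moreover have "(\<lambda>h. frechet_derivative \<phi> (at ?p) (h *\<^sub>R (c *\<^sub>R w))) = (*) (c * frechet_derivative \<phi> (at ?p) w)"
        using linear_cmul[OF has_derivative_linear[OF d\<phi>[OF pV]]] by (simp add: fun_eq_iff)
      ultimately show ?thesis unfolding has_field_derivative_def by (simp only:)
    qed
    have "\<exists>t. 0 < t \<and> t < 1 \<and> \<phi> (z' + 1 *\<^sub>R (c *\<^sub>R w)) - \<phi> (z' + 0 *\<^sub>R (c *\<^sub>R w))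
        = (1 - 0) * (c * frechet_derivative \<phi> (at (z' + t *\<^sub>R (c *\<^sub>R w))) w)"
      by (rule MVT2[of 0 1 "\<lambda>t. \<phi> (z' + t *\<^sub>R (c *\<^sub>R w))"
            "\<lambda>t. c * frechet_derivative \<phi> (at (z' + t *\<^sub>R (c *\<^sub>R w))) w"]) (simp, rule der)
    then obtain t where t: "0 < t" "t < 1"
      "\<phi> z - \<phi> z' = c * frechet_derivative \<phi> (at (z' + t *\<^sub>R (c *\<^sub>R w))) w" unfolding z(5) by auto
    have "0 < c * frechet_derivative \<phi> (at (z' + t *\<^sub>R (c *\<^sub>R w))) w"
      using pos[OF seg[of t]] t z(4) by simp
    then have lt: "\<phi> z' < \<phi> z" using t(3) by linarith
    have zz: "z \<in> V \<inter> hyp_space" "z' \<in> V \<inter> hyp_space"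
      using bV[OF z(1)] bV[OF z(2)] z(6,7) unfolding K_def by blast+
    have "\<not> 0 < \<phi> z" using VE[OF zz(1)] z(6) unfolding K_def by blast
    then have "\<not> 0 < \<phi> z'" "\<phi> z' \<noteq> 0" using lt by linarith+
    then show "z' \<in> K - M" using VE[OF zz(2)] VM[OF zz(2)] z(7) unfolding K_def by blast
  qed
qed

text \<open>Points near an interior point of the cap are reflected into \<open>K\<close>, whereas every neighbourhood of a
point of \<open>M\<close> contains exterior points.\<close>

lemma interior_image:
  assumes w: "0 < mink w w" and cap: "\<And>z. z \<in> K \<Longrightarrow> 0 < mink z w \<Longrightarrow> reflect w z \<in> K"
    and y: "y \<in> K - M" "0 < mink y w"
  shows "reflect w y \<notin> M"
proof
  assume RM: "reflect w y \<in> M"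
  obtain V where V: "open V" "y \<in> V" "V \<inter> hyp_space \<subseteq> K - M" by (rule K_interior[OF y(1)])
  define A where "A = (\<lambda>z. reflect w z) -` (V \<inter> {z. 0 < mink z w})"
  have "open {z. 0 < mink z w}"
    by (intro open_Collect_less mink_continuous_on continuous_intros)
  then have oA: "open A"
    unfolding A_def using V(1) w by (intro open_vimage) (auto intro!: continuous_intros)
  have "reflect w y \<in> A" unfolding A_def using V(2) y(2) w by (simp add: reflect_reflect)
  then obtain z where z: "z \<in> A" "z \<in> E" using exterior_accumulates[OF RM oA] by blast
  have "z \<in> hyp_space" using z(2) exterior_subset by blast
  then have "reflect w z \<in> hyp_space" by (rule reflect_hyp_space[OF w])
  moreover have "reflect w z \<in> V" "0 < mink (reflect w z) w" using z(1) by (simp_all add: A_def)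
  ultimately have "reflect w z \<in> K" "0 < mink (reflect w z) w" using V(3) by blast+
  then have "reflect w (reflect w z) \<in> K" by (rule cap)
  then show False using z(2) w unfolding K_def by (simp add: reflect_reflect)
qed

end

section \<open>Moving planes\<close>

text \<open>For \<open>-1 < s < 1\<close> the vectors \<open>w + s c\<close> are normal to the hyperplanes orthogonal to the geodesic
through \<open>c\<close> in direction \<open>w\<close>.  With this affine parameter the side on which \<open>z\<close> lies is decided by
comparing \<open>s\<close> with the ratio of two products.\<close>

definition tilt :: "'n::finite minkowski \<Rightarrow> 'n minkowski \<Rightarrow> real \<Rightarrow> 'n minkowski" where
  "tilt c w s = w + s *\<^sub>R c"

lemma tilt_norm:
  assumes "c \<in> hyp_space" "mink w w = 1" "mink w c = 0"
  shows "mink (tilt c w s) (tilt c w s) = 1 - s\<^sup>2"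
  using assms by (simp add: tilt_def mink_simps mink_commute[of c w] hyp_space_def power2_eq_square)

lemma tilt_pos:
  assumes "c \<in> hyp_space" "mink w w = 1" "mink w c = 0" "- 1 < s" "s < 1"
  shows "0 < mink (tilt c w s) (tilt c w s)"
proof -
  have "s\<^sup>2 < 1" using assms(4,5) by (simp add: abs_square_less_1 abs_less_iff)
  then show ?thesis using tilt_norm[OF assms(1-3)] by simp
qed

lemma mink_tilt: "mink z (tilt c w s) = mink z w + s * mink z c"
  by (simp add: tilt_def mink_simps)

lemma tendsto_tilt: "(t \<longlongrightarrow> s) F \<Longrightarrow> ((\<lambda>n. tilt c w (t n)) \<longlongrightarrow> tilt c w s) F"
  unfolding tilt_def by (intro tendsto_intros)

lemma tendsto_reflect:
  assumes "(w \<longlongrightarrow> w0) F" "(p \<longlongrightarrow> p0) F" "mink w0 w0 \<noteq> 0"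
  shows "((\<lambda>n. reflect (w n) (p n)) \<longlongrightarrow> reflect w0 p0) F"
  unfolding reflect_def using assms by (intro tendsto_intros mink_tendsto) auto

context curvature_hypersurface
begin

definition admissible :: "'n minkowski \<Rightarrow> bool" where
  "admissible w \<longleftrightarrow> (\<forall>z\<in>K. 0 < mink z w \<longrightarrow> reflect w z \<in> K)"

lemma K_hyp: "z \<in> K \<Longrightarrow> z \<in> hyp_space"
  by (simp add: K_def)

lemma K_eventually_interior:
  assumes "p \<in> K - M" "(y \<longlongrightarrow> p) F" "\<forall>\<^sub>F n in F. y n \<in> hyp_space"
  shows "\<forall>\<^sub>F n in F. y n \<in> K - M"
proof -
  obtain W where W: "open W" "p \<in> W" "W \<inter> hyp_space \<subseteq> K - M" by (rule K_interior[OF assms(1)])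
  have "\<forall>\<^sub>F n in F. y n \<in> W" by (rule topological_tendstoD[OF assms(2) W(1,2)])
  then show ?thesis using assms(3) by eventually_elim (use W(3) in blast)
qed

text \<open>For \<open>s\<close> near 1 the cap is empty, and for \<open>s\<close> near -1 it is all of \<open>K\<close>, which the reflection would
push across the hyperplane.  The infimum \<open>s\<close> of the positions from which on all reflected caps stay
in \<open>K\<close> is itself such a position because \<open>K\<close> is closed, and it is approached from below by positions that fail, with
witnesses in the compact set \<open>K\<close>.\<close>

lemma critical_plane:
  assumes c: "c \<in> hyp_space" and w: "mink w w = 1" "mink w c = 0"
  obtains s t x p where "- 1 < s" "s < 1" "\<And>r. s \<le> r \<Longrightarrow> r < 1 \<Longrightarrow> admissible (tilt c w r)"
    "t \<longlonglongrightarrow> s" "x \<longlonglongrightarrow> p" "\<And>n. - 1 < t n \<and> t n < s"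
    "\<And>n. x n \<in> K" "\<And>n::nat. 0 < mink (x n) (tilt c w (t n))" "\<And>n. reflect (tilt c w (t n)) (x n) \<notin> K"
proof -
  define \<rho> where "\<rho> = (\<lambda>z. mink z w / (- mink z c))"
  have neg: "0 < - mink z c" if "z \<in> K" for z using hyp_mink_le[OF K_hyp[OF that] c] by linarith
  have side: "0 < mink z (tilt c w s) \<longleftrightarrow> s < \<rho> z" if "z \<in> K" for z s
    unfolding mink_tilt \<rho>_def pos_less_divide_eq[OF neg[OF that]] mult_minus_right by linarith
  have \<rho>1: "\<bar>\<rho> z\<bar> < 1" if "z \<in> K" for z
    using axis_component_less[OF c w K_hyp[OF that]] neg[OF that] unfolding \<rho>_def abs_divide abs_of_pos[OF neg[OF that]]
    by (subst pos_divide_less_eq) auto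
  have Kne: "K \<noteq> {}" using M_ne M_subset_K by blast
  have cont: "continuous_on K \<rho>"
    unfolding \<rho>_def using neg by (intro continuous_intros mink_continuous_on) fastforce
  obtain z1 where z1: "z1 \<in> K" "\<And>z. z \<in> K \<Longrightarrow> \<rho> z \<le> \<rho> z1"
    using continuous_attains_sup[OF compact_K Kne cont] by blast
  obtain z2 where z2: "z2 \<in> K" "\<And>z. z \<in> K \<Longrightarrow> \<rho> z2 \<le> \<rho> z"
    using continuous_attains_inf[OF compact_K Kne cont] by blast
  define A where "A = {s. - 1 < s \<and> s < 1 \<and> (\<forall>r. s \<le> r \<longrightarrow> r < 1 \<longrightarrow> admissible (tilt c w r))}"
  have sA: "\<rho> z1 \<in> A"
  proof -
    have "admissible (tilt c w r)" if "\<rho> z1 \<le> r" for r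
      unfolding admissible_def using side z1(2) that by (meson leD le_less_trans)
    then show ?thesis using \<rho>1[OF z1(1)] unfolding A_def by auto
  qed
  have lower: "\<rho> z2 \<le> s" if s: "s \<in> A" for s
  proof (rule ccontr)
    assume "\<not> \<rho> z2 \<le> s"
    then have lt: "s < \<rho> z" if "z \<in> K" for z using z2(2)[OF that] by linarith
    have pos: "0 < mink (tilt c w s) (tilt c w s)" using s tilt_pos[OF c w] unfolding A_def by blast
    have p2: "0 < mink z2 (tilt c w s)" using side lt z2(1) by blast
    moreover have "admissible (tilt c w s)" using s unfolding A_def by blast
    ultimately have "reflect (tilt c w s) z2 \<in> K" using z2(1) unfolding admissible_def by blast
    then have "0 < mink (reflect (tilt c w s) z2) (tilt c w s)" using side lt by blast
    then show False using p2 pos by (simp add: mink_reflect)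
  qed
  define s where "s = Inf A"
  have bdd: "bdd_below A" using lower by (meson bdd_belowI)
  have Ane: "A \<noteq> {}" using sA by blast
  have s1: "- 1 < s" "s < 1"
  proof -
    have "\<rho> z2 \<le> s" unfolding s_def by (rule cInf_greatest[OF Ane lower])
    then show "- 1 < s" using \<rho>1[OF z2(1)] by linarith
    have "s \<le> \<rho> z1" unfolding s_def by (rule cInf_lower[OF sA bdd])
    then show "s < 1" using \<rho>1[OF z1(1)] by linarith
  qed
  have adm_gt: "admissible (tilt c w r)" if sr: "s < r" "r < 1" for r
  proof -
    obtain s' where "s' \<in> A" "s' < r" using cInf_lessD[OF Ane sr(1)[unfolded s_def]] by blast
    then have "s' \<le> r" "\<And>r. s' \<le> r \<Longrightarrow> r < 1 \<Longrightarrow> admissible (tilt c w r)" unfolding A_def by simp_all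
    then show ?thesis using sr(2) by blast
  qed
  have pos_s: "mink (tilt c w s) (tilt c w s) \<noteq> 0" using tilt_pos[OF c w s1] by simp
  have adm_s: "admissible (tilt c w s)"
    unfolding admissible_def
  proof (intro ballI impI)
    fix z assume z: "z \<in> K" "0 < mink z (tilt c w s)"
    have id: "((\<lambda>r. r) \<longlongrightarrow> s) (at_right s)" by (rule tendsto_ident_at)
    have lim: "((\<lambda>r. reflect (tilt c w r) z) \<longlongrightarrow> reflect (tilt c w s) z) (at_right s)"
      by (rule tendsto_reflect[OF tendsto_tilt[OF id] tendsto_const pos_s])
    have "((\<lambda>r. mink z (tilt c w r)) \<longlongrightarrow> mink z (tilt c w s)) (at_right s)"
      by (intro mink_tendsto tendsto_tilt[OF id] tendsto_const)
    then have "\<forall>\<^sub>F r in at_right s. 0 < mink z (tilt c w r)" using z(2) by (rule order_tendstoD(1))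
    moreover have "\<forall>\<^sub>F r in at_right s. s < r" by (rule eventually_at_right_less)
    moreover have "\<forall>\<^sub>F r in at_right s. r < 1" using order_tendstoD(2)[OF id s1(2)] .
    ultimately have "\<forall>\<^sub>F r in at_right s. reflect (tilt c w r) z \<in> K"
      by eventually_elim (use adm_gt z(1) in \<open>auto simp: admissible_def\<close>)
    then show "reflect (tilt c w s) z \<in> K"
      using Lim_in_closed_set[OF closed_K _ trivial_limit_at_right_real lim] by blast
  qed
  have adm: "admissible (tilt c w r)" if "s \<le> r" "r < 1" for r
    using adm_s adm_gt that by (cases "s = r") auto
  have bad: "\<exists>t z. s - \<epsilon> < t \<and> - 1 < t \<and> t < s \<and> z \<in> K \<and> 0 < mink z (tilt c w t) \<and> reflect (tilt c w t) z \<notin> K"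
    if \<epsilon>: "0 < \<epsilon>" for \<epsilon>
  proof -
    \<comment> \<open>a position below \<open>s\<close>, within \<open>\<epsilon>\<close> and above -1\<close>
    define l where "l = max (s - \<epsilon> / 2) ((s - 1) / 2)"
    have "- 1 < (s - 1) / 2" using s1 by simp
    then have l: "s - \<epsilon> < l" "- 1 < l" "l < s"
      using \<epsilon> s1 unfolding l_def by (simp_all add: less_max_iff_disj)
    have "l \<notin> A"
    proof
      assume "l \<in> A"
      then have "s \<le> l" unfolding s_def by (rule cInf_lower[OF _ bdd])
      then show False using l(3) by simp
    qed
    moreover have "l < 1" using l(3) s1(2) by simp
    ultimately obtain t where t: "l \<le> t" "t < 1" "\<not> admissible (tilt c w t)"
      using l(2) unfolding A_def by blast
    have "t < s"
    proof (rule ccontr)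
      assume "\<not> t < s"
      then show False using adm[of t] t by simp
    qed
    moreover obtain z where "z \<in> K" "0 < mink z (tilt c w t)" "reflect (tilt c w t) z \<notin> K"
      using t(3) unfolding admissible_def by blast
    moreover have "s - \<epsilon> < t" "- 1 < t" using t(1) l by linarith+
    ultimately show ?thesis by blast
  qed
  define P where "P = (\<lambda>(n::nat) y. s - inverse (real (Suc n)) < fst y \<and> - 1 < fst y \<and> fst y < s \<and> snd y \<in> K \<and>
      0 < mink (snd y) (tilt c w (fst y)) \<and> reflect (tilt c w (fst y)) (snd y) \<notin> K)"
  have "\<exists>y. P n y" for n
  proof -
    have "0 < inverse (real (Suc n))" by simp
    from bad[OF this] obtain t z where "P n (t, z)" unfolding P_def by auto
    then show ?thesis by blast
  qed
  then obtain y where y: "\<And>n. P n (y n)" by metis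
  define t z where "t = (\<lambda>n. fst (y n))" and "z = (\<lambda>n. snd (y n))"
  have tz: "\<And>n::nat. s - inverse (real (Suc n)) < t n" "\<And>n. - 1 < t n \<and> t n < s"
    "\<And>n. z n \<in> K" "\<And>n. 0 < mink (z n) (tilt c w (t n))" "\<And>n. reflect (tilt c w (t n)) (z n) \<notin> K"
    using y unfolding P_def t_def z_def by blast+
  have "(\<lambda>n. s - inverse (real (Suc n))) \<longlonglongrightarrow> s - 0"
    by (intro tendsto_intros LIMSEQ_inverse_real_of_nat)
  then have "t \<longlonglongrightarrow> s"
    by (intro tendsto_sandwich[of "\<lambda>n. s - inverse (real (Suc n))" t _ "\<lambda>_. s"])
      (use tz(1,2) in \<open>auto intro!: always_eventually less_imp_le\<close>)
  moreover obtain p r where r: "p \<in> K" "strict_mono (r :: nat \<Rightarrow> nat)" "(z \<circ> r) \<longlonglongrightarrow> p"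
    using compact_K tz(3) unfolding compact_def by blast
  ultimately have "(t \<circ> r) \<longlonglongrightarrow> s" by (intro LIMSEQ_subseq_LIMSEQ)
  then show ?thesis
    using that[of s "t \<circ> r" "z \<circ> r" p] s1 adm r(3) tz by simp
qed

text \<open>On the hyperplane itself every point is its own image; the condition on the normals is what makes
the set open there.\<close>

definition symmetric_points :: "'n minkowski \<Rightarrow> 'n minkowski set" where
  "symmetric_points w = {p \<in> M. reflect w p \<in> M \<and> N (reflect w p) = reflect w (N p)}"

text \<open>If the normals differ, their difference \<open>v\<close> points outward at the image point \<open>y\<close>, while its
reflection points inward at \<open>x\<close>.  A curve from \<open>y\<close> with velocity \<open>v\<close> then leaves \<open>K\<close> although
its mirror image runs inside the cap.\<close>

lemma interior_touching_normal:
  assumes w: "0 < mink w w" and cap: "admissible w"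
    and x: "x \<in> M" "0 < mink x w" "reflect w x \<in> M"
  shows "N (reflect w x) = reflect w (N x)"
proof (rule ccontr)
  assume ne: "N (reflect w x) \<noteq> reflect w (N x)"
  define y where "y = reflect w x"
  define v where "v = N y - reflect w (N x)"
  have w0: "mink w w \<noteq> 0" using w by simp
  have yM: "y \<in> M" using x(3) by (simp add: y_def)
  have yH: "y \<in> hyp_space" and xH: "x \<in> hyp_space" using yM x(1) M_sub by auto
  have Ry: "reflect w y = x" by (simp add: y_def reflect_reflect[OF w0])
  define k where "k = mink (N y) (reflect w (N x))"
  have yN: "mink y (reflect w (N x)) = 0"
    using reflect_isometry[OF w0, of x "N x"] N_normal(1)[OF x(1)] by (simp add: y_def)
  then have yv: "mink v y = 0" using N_normal(1)[OF yM] by (simp add: v_def mink_simps mink_commute[of _ y])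
  have RR: "mink (reflect w (N x)) (reflect w (N x)) = 1" using reflect_isometry[OF w0] N_unit[OF x(1)] by simp
  have vv: "mink v v = 2 - 2 * k"
    by (simp add: v_def mink_simps N_unit[OF yM] RR k_def mink_commute[of "reflect w (N x)" "N y"])
  have "v \<noteq> 0" using ne by (simp add: v_def y_def)
  then have m: "0 < mink v v" by (rule spacelike(2)[OF yH yv])
  have vN: "0 < mink v (N y)"
  proof -
    have "mink v (N y) = 1 - k"
      by (simp add: v_def mink_simps N_unit[OF yM] k_def mink_commute[of "reflect w (N x)" "N y"])
    then show ?thesis using m vv by simp
  qed
  have RvN: "0 < mink (- reflect w v) (N x)"
  proof -
    have "mink (reflect w v) (N x) = mink v (reflect w (N x))" by (rule reflect_adjoint[OF w0])
    also have "\<dots> = k - 1" by (simp add: v_def mink_simps RR k_def)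
    finally show ?thesis using m vv by (simp add: mink_simps)
  qed
  have xRv: "mink x (- reflect w v) = 0"
    using reflect_isometry[OF w0, of y v] yv by (simp add: Ry mink_simps mink_commute[of y v])
  obtain e1 where e1: "0 < e1" "\<And>z z' w' c. z \<in> ball y e1 \<Longrightarrow> z' \<in> ball y e1 \<Longrightarrow> w' \<in> ball v e1 \<Longrightarrow>
      0 < c \<Longrightarrow> z = z' + c *\<^sub>R w' \<Longrightarrow> z \<in> K \<Longrightarrow> z' \<in> hyp_space \<Longrightarrow> z' \<in> K - M"
    by (rule inward_monotone[OF yM _ vN]) (simp add: yv mink_commute[of y v], rule that, assumption+)
  obtain e2 where e2: "0 < e2" "\<And>z z' w' c. z \<in> ball x e2 \<Longrightarrow> z' \<in> ball x e2 \<Longrightarrow> w' \<in> ball (- reflect w v) e2 \<Longrightarrow>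
      0 < c \<Longrightarrow> z = z' + c *\<^sub>R w' \<Longrightarrow> z \<in> K \<Longrightarrow> z' \<in> hyp_space \<Longrightarrow> z' \<in> K - M"
    by (rule inward_monotone[OF x(1) xRv RvN]) (rule that, assumption+)
  define h where "h = (\<lambda>t. sqrt (1 + t\<^sup>2 * mink v v))"
  define \<gamma> where "\<gamma> = (\<lambda>t. h t *\<^sub>R y + t *\<^sub>R v)"
  \<comment> \<open>difference quotients of the curve, for use with \<open>inward_monotone\<close>\<close>
  define d where "d = (\<lambda>t. ((h t - 1) / t) *\<^sub>R y + v)"
  have \<gamma>H: "\<gamma> t \<in> hyp_space" if t: "0 < t" for t
  proof (rule hyp_spaceI_mink[OF _ yH])
    have p: "0 < 1 + t\<^sup>2 * mink v v" using m by (simp add: add_pos_nonneg)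
    then have hh: "h t * h t = 1 + t\<^sup>2 * mink v v" and h0: "0 < h t" unfolding h_def by simp_all
    have yy: "mink y y = -1" using yH by (simp add: hyp_space_def)
    have "mink (\<gamma> t) (\<gamma> t) = - (h t * h t) + t\<^sup>2 * mink v v"
      unfolding \<gamma>_def by (simp add: mink_simps yy yv mink_commute[of y v] power2_eq_square)
    then show "mink (\<gamma> t) (\<gamma> t) = -1" unfolding hh by simp
    show "mink (\<gamma> t) y < 0" unfolding \<gamma>_def using h0 by (simp add: mink_simps yy yv)
  qed
  have \<gamma>y: "\<gamma> t = y + t *\<^sub>R d t" if "0 < t" for t
  proof -
    have e: "t * ((h t - 1) / t) = h t - 1" using that by simp
    have "t *\<^sub>R d t = (t * ((h t - 1) / t)) *\<^sub>R y + t *\<^sub>R v"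
      unfolding d_def scaleR_right_distrib scaleR_scaleR ..
    then show ?thesis unfolding e \<gamma>_def by (simp add: algebra_simps)
  qed
  have dh: "(h has_real_derivative 0) (at 0)"
    unfolding h_def by (auto intro!: derivative_eq_intros)
  have "((\<lambda>t. (h (0 + t) - h 0) / t) \<longlongrightarrow> 0) (at 0)" using dh unfolding DERIV_def .
  then have "((\<lambda>t. (h t - 1) / t) \<longlongrightarrow> 0) (at_right 0)"
    by (intro tendsto_mono[OF at_le[of "{0<..}" UNIV]]) (simp_all add: h_def)
  then have "(d \<longlongrightarrow> 0 *\<^sub>R y + v) (at_right 0)" unfolding d_def by (intro tendsto_intros)
  then have dlim: "(d \<longlongrightarrow> v) (at_right 0)" by simp
  have "(\<gamma> \<longlongrightarrow> sqrt (1 + 0\<^sup>2 * mink v v) *\<^sub>R y + 0 *\<^sub>R v) (at_right 0)"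
    unfolding \<gamma>_def h_def by (intro tendsto_intros)
  then have \<gamma>lim: "(\<gamma> \<longlongrightarrow> y) (at_right 0)" by simp
  have R\<gamma>: "((\<lambda>t. reflect w (\<gamma> t)) \<longlongrightarrow> x) (at_right 0)"
    using tendsto_reflect[OF tendsto_const \<gamma>lim w0] Ry by simp
  have Rd: "((\<lambda>t. - reflect w (d t)) \<longlongrightarrow> - reflect w v) (at_right 0)"
    by (intro tendsto_minus tendsto_reflect[OF tendsto_const dlim w0])
  have "((\<lambda>t. mink (reflect w (\<gamma> t)) w) \<longlongrightarrow> mink x w) (at_right 0)"
    by (rule mink_tendsto[OF R\<gamma> tendsto_const])
  then have p1: "\<forall>\<^sub>F t in at_right 0. 0 < mink (reflect w (\<gamma> t)) w" using x(2) by (rule order_tendstoD(1))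
  have p2: "\<forall>\<^sub>F t in at_right 0. \<gamma> t \<in> ball y e1" by (rule topological_tendstoD[OF \<gamma>lim]) (use e1 in auto)
  have p3: "\<forall>\<^sub>F t in at_right 0. d t \<in> ball v e1" by (rule topological_tendstoD[OF dlim]) (use e1 in auto)
  have p4: "\<forall>\<^sub>F t in at_right 0. reflect w (\<gamma> t) \<in> ball x e2" by (rule topological_tendstoD[OF R\<gamma>]) (use e2 in auto)
  have p5: "\<forall>\<^sub>F t in at_right 0. - reflect w (d t) \<in> ball (- reflect w v) e2"
    by (rule topological_tendstoD[OF Rd]) (use e2 in auto)
  have p6: "\<forall>\<^sub>F t in at_right (0::real). 0 < t" by (rule eventually_at_right_less)
  from p1 p2 p3 p4 p5 p6 have "\<forall>\<^sub>F t in at_right 0. 0 < mink (reflect w (\<gamma> t)) w \<and> \<gamma> t \<in> ball y e1 \<and>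
      d t \<in> ball v e1 \<and> reflect w (\<gamma> t) \<in> ball x e2 \<and> - reflect w (d t) \<in> ball (- reflect w v) e2 \<and> 0 < t"
    by eventually_elim blast
  then obtain t where t: "0 < mink (reflect w (\<gamma> t)) w" "\<gamma> t \<in> ball y e1" "d t \<in> ball v e1"
      "reflect w (\<gamma> t) \<in> ball x e2" "- reflect w (d t) \<in> ball (- reflect w v) e2" "0 < t"
    using eventually_happens'[OF trivial_limit_at_right_real] by blast
  have "\<gamma> t \<notin> K"
    using e1(2)[OF t(2) _ t(3) t(6) \<gamma>y[OF t(6)]] e1(1) yM yH by auto
  moreover have "reflect w (\<gamma> t) \<in> K"
  proof -
    have "x = reflect w (\<gamma> t) + t *\<^sub>R (- reflect w (d t))"
      unfolding \<gamma>y[OF t(6)] by (simp add: linear_add[OF linear_reflect] linear_cmul[OF linear_reflect] Ry)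
    from e2(2)[OF _ t(4) t(5) t(6) this] show ?thesis
      using e2(1) x(1) M_subset_K reflect_hyp_space[OF w \<gamma>H[OF t(6)]] by auto
  qed
  then have "reflect w (reflect w (\<gamma> t)) \<in> K" using cap t(1) unfolding admissible_def by blast
  ultimately show False by (simp add: reflect_reflect[OF w0])
qed

text \<open>Let \<open>p\<close> be the limit of the witnesses at the critical hyperplane; its image is a boundary point of
\<open>K\<close>.  Off the hyperplane \<open>p\<close> is on \<open>M\<close> by \<open>interior_image\<close>, and the normals match.  On the
hyperplane \<open>p\<close> is its own image, and the normal there has to be orthogonal to \<open>w + s c\<close>: if it
made an acute angle with this vector, the witnesses would be reflected into \<open>K\<close>; if an obtuse
one, hyperplanes slightly beyond the critical one would already map an interior point to \<open>p\<close>.\<close>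

lemma symmetric_point_exists:
  assumes c: "c \<in> hyp_space" and w: "mink w w = 1" "mink w c = 0"
  obtains s where "- 1 < s" "s < 1" "admissible (tilt c w s)" "symmetric_points (tilt c w s) \<noteq> {}"
proof -
  obtain s t x p where s: "- 1 < s" "s < 1" and adm: "\<And>r. s \<le> r \<Longrightarrow> r < 1 \<Longrightarrow> admissible (tilt c w r)"
    and tlim: "t \<longlonglongrightarrow> s" and xlim: "x \<longlonglongrightarrow> p" and t: "\<And>n. - 1 < t n \<and> t n < s"
    and xK: "\<And>n. x n \<in> K" and xpos: "\<And>n::nat. 0 < mink (x n) (tilt c w (t n))"
    and xbad: "\<And>n. reflect (tilt c w (t n)) (x n) \<notin> K"
    by (rule critical_plane[OF c w]) (rule that, assumption+)
  define W where "W = tilt c w s"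
  define R where "R = reflect W"
  have Wpos: "0 < mink W W" unfolding W_def by (rule tilt_pos[OF c w s])
  then have W0: "mink W W \<noteq> 0" by simp
  have admW: "admissible W" unfolding W_def using adm s by simp
  have Wn: "0 < mink (tilt c w (t n)) (tilt c w (t n))" for n using tilt_pos[OF c w] t[of n] s by simp
  have Wlim: "(\<lambda>n. tilt c w (t n)) \<longlonglongrightarrow> W" unfolding W_def by (rule tendsto_tilt[OF tlim])
  have pK: "p \<in> K" using closed_sequentially[OF closed_K] xK xlim by blast
  have pH: "p \<in> hyp_space" using K_hyp[OF pK] .
  define y where "y = (\<lambda>n. reflect (tilt c w (t n)) (x n))"
  have ylim: "y \<longlonglongrightarrow> R p" unfolding y_def R_def by (rule tendsto_reflect[OF Wlim xlim W0])
  have yH: "y n \<in> hyp_space" for n unfolding y_def by (rule reflect_hyp_space[OF Wn K_hyp[OF xK]])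
  have side: "0 \<le> mink p W"
    using LIMSEQ_le_const[OF mink_tendsto[OF xlim Wlim]] xpos by (meson less_imp_le)
  have RpK: "R p \<in> K"
  proof (cases "mink p W = 0")
    case True then show ?thesis using reflect_fixed pK unfolding R_def by metis
  next
    case False then show ?thesis using admW pK side unfolding admissible_def R_def by simp
  qed
  have RpM: "R p \<in> M"
  proof (rule ccontr)
    assume "R p \<notin> M"
    then have "\<forall>\<^sub>F n in sequentially. y n \<in> K - M"
      using RpK by (intro K_eventually_interior[OF _ ylim]) (auto simp: yH)
    then show False using xbad unfolding y_def eventually_sequentially by blast
  qed
  have pS: "p \<in> symmetric_points W"
  proof (cases "mink p W = 0")
    case False
    then have pos: "0 < mink p W" using side by simp
    have cap: "\<And>z. z \<in> K \<Longrightarrow> 0 < mink z W \<Longrightarrow> reflect W z \<in> K" using admW unfolding admissible_def by blast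
    have pM: "p \<in> M"
      using interior_image[OF Wpos cap _ pos] RpM pK unfolding R_def by blast
    show ?thesis
      unfolding symmetric_points_def
      using pM RpM interior_touching_normal[OF Wpos admW pM pos] unfolding R_def by blast
  next
    case True
    have Rp: "R p = p" unfolding R_def by (rule reflect_fixed[OF True])
    then have pM: "p \<in> M" using RpM by simp
    have "\<not> 0 < mink W (N p)"
    proof
      assume pos: "0 < mink W (N p)"
      obtain \<epsilon> where e: "0 < \<epsilon>" "\<And>z z' w' c. z \<in> ball p \<epsilon> \<Longrightarrow> z' \<in> ball p \<epsilon> \<Longrightarrow> w' \<in> ball W \<epsilon> \<Longrightarrow>
          0 < c \<Longrightarrow> z = z' + c *\<^sub>R w' \<Longrightarrow> z \<in> K \<Longrightarrow> z' \<in> hyp_space \<Longrightarrow> z' \<in> K - M"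
        by (rule inward_monotone[OF pM True pos]) (rule that, assumption+)
      have "\<forall>\<^sub>F n in sequentially. x n \<in> ball p \<epsilon>" by (rule topological_tendstoD[OF xlim]) (use e in auto)
      moreover have "\<forall>\<^sub>F n in sequentially. y n \<in> ball p \<epsilon>"
        by (rule topological_tendstoD[OF ylim[unfolded Rp]]) (use e in auto)
      moreover have "\<forall>\<^sub>F n in sequentially. tilt c w (t n) \<in> ball W \<epsilon>"
        by (rule topological_tendstoD[OF Wlim]) (use e in auto)
      ultimately have "\<forall>\<^sub>F n in sequentially. y n \<in> K - M"
      proof eventually_elim
        case (elim n)
        have "x n = y n + (2 * mink (x n) (tilt c w (t n)) / mink (tilt c w (t n)) (tilt c w (t n))) *\<^sub>R tilt c w (t n)"
          unfolding y_def reflect_def by simp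
        moreover have "0 < 2 * mink (x n) (tilt c w (t n)) / mink (tilt c w (t n)) (tilt c w (t n))"
          using xpos[of n] Wn[of n] by simp
        ultimately show ?case using e(2)[OF elim(1,2,3)] xK yH by blast
      qed
      then show False using xbad unfolding y_def eventually_sequentially by blast
    qed
    moreover have "\<not> mink W (N p) < 0"
    proof
      assume "mink W (N p) < 0"
      then have pos: "0 < mink (- W) (N p)" by (simp add: mink_simps)
      have nW: "mink p (- W) = 0" using True by (simp add: mink_simps)
      obtain \<epsilon> where e: "0 < \<epsilon>" "\<And>z z' w' c. z \<in> ball p \<epsilon> \<Longrightarrow> z' \<in> ball p \<epsilon> \<Longrightarrow> w' \<in> ball (- W) \<epsilon> \<Longrightarrow>
          0 < c \<Longrightarrow> z = z' + c *\<^sub>R w' \<Longrightarrow> z \<in> K \<Longrightarrow> z' \<in> hyp_space \<Longrightarrow> z' \<in> K - M"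
        by (rule inward_monotone[OF pM nW pos]) (rule that, assumption+)
      have id: "((\<lambda>r. r) \<longlongrightarrow> s) (at_right s)" by (rule tendsto_ident_at)
      have lim: "((\<lambda>r. reflect (tilt c w r) p) \<longlongrightarrow> p) (at_right s)"
        using tendsto_reflect[OF tendsto_tilt[OF id, of c w] tendsto_const[of p]] W0 Rp unfolding R_def W_def by metis
      have "\<forall>\<^sub>F r in at_right s. reflect (tilt c w r) p \<in> ball p \<epsilon>"
        by (rule topological_tendstoD[OF lim]) (use e in auto)
      moreover have "((\<lambda>r. - tilt c w r) \<longlongrightarrow> - W) (at_right s)"
        unfolding W_def by (intro tendsto_minus tendsto_tilt[OF id])
      then have "\<forall>\<^sub>F r in at_right s. - tilt c w r \<in> ball (- W) \<epsilon>"
        by (rule topological_tendstoD) (use e in auto)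
      moreover have "\<forall>\<^sub>F r in at_right s. s < r" by (rule eventually_at_right_less)
      moreover have "\<forall>\<^sub>F r in at_right s. r < 1" using order_tendstoD(2)[OF id s(2)] .
      ultimately have "\<forall>\<^sub>F r in at_right s. reflect (tilt c w r) p \<in> ball p \<epsilon> \<and> - tilt c w r \<in> ball (- W) \<epsilon> \<and> s < r \<and> r < 1"
        by eventually_elim blast
      then obtain r where r: "reflect (tilt c w r) p \<in> ball p \<epsilon>" "- tilt c w r \<in> ball (- W) \<epsilon>" "s < r" "r < 1"
        using eventually_happens'[OF trivial_limit_at_right_real] by blast
      define V where "V = tilt c w r"
      have Vpos: "0 < mink V V" unfolding V_def using tilt_pos[OF c w] s r by simp
      then have V0: "mink V V \<noteq> 0" by simp
      have pV: "mink p V < 0"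
      proof -
        have "mink p V = mink p W + (r - s) * mink p c" unfolding V_def W_def mink_tilt by (simp add: algebra_simps)
        moreover have "(r - s) * mink p c < 0" using r(3) hyp_mink_le[OF pH c] by (intro mult_pos_neg) auto
        ultimately show ?thesis using True by simp
      qed
      define k where "k = - (2 * mink p V / mink V V)"
      have k: "0 < k" unfolding k_def using pV Vpos by (simp add: divide_neg_pos)
      have eqn: "p = reflect V p + k *\<^sub>R (- V)" unfolding reflect_def k_def by simp
      have int: "reflect V p \<in> K - M"
        by (rule e(2)[OF _ r(1)[folded V_def] r(2)[folded V_def] k eqn pK reflect_hyp_space[OF Vpos pH]])
          (use e(1) in simp)
      have capV: "\<And>z. z \<in> K \<Longrightarrow> 0 < mink z V \<Longrightarrow> reflect V z \<in> K"
        using adm[of r] r unfolding V_def admissible_def by simp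
      have RV: "0 < mink (reflect V p) V" using pV by (simp add: mink_reflect[OF V0])
      have "reflect V (reflect V p) \<notin> M" by (rule interior_image[OF Vpos _ int RV]) (rule capV)
      then show False using pM by (simp add: reflect_reflect[OF V0])
    qed
    ultimately have "mink (N p) W = 0" by (simp add: mink_commute)
    then have "reflect W (N p) = N p" by (rule reflect_fixed)
    then show ?thesis unfolding symmetric_points_def using pM Rp unfolding R_def by simp
  qed
  show ?thesis using that[of s] s admW pS unfolding W_def by blast
qed

text \<open>For a point on the negative side, the local symmetry is transported from its mirror image.\<close>

lemma symmetric_points_all:
  assumes w: "0 < mink w w" and adm: "admissible w" and ne: "symmetric_points w \<noteq> {}"
  shows "symmetric_points w = M"
proof -
  let ?R = "reflect w"
  have w0: "mink w w \<noteq> 0" using w by simp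
  have cap: "\<And>z. z \<in> K \<Longrightarrow> 0 < mink z w \<Longrightarrow> ?R z \<in> K" using adm unfolding admissible_def by blast
  have cR: "continuous_on S ?R" for S by (intro continuous_intros) (use w0 in auto)
  define A where "A = M \<inter> ?R -` M"
  have "closed A" unfolding A_def using continuous_closed_preimage[OF cR closed_M closed_M] .
  moreover have "continuous_on A (\<lambda>p. N (?R p) - ?R (N p))"
  proof (intro continuous_on_diff)
    show "continuous_on A (\<lambda>p. N (?R p))"
      by (rule continuous_on_compose2[OF continuous_on_N cR]) (auto simp: A_def)
    show "continuous_on A (\<lambda>p. ?R (N p))"
      by (rule continuous_on_compose2[OF cR[of UNIV] continuous_on_subset[OF continuous_on_N]]) (auto simp: A_def)
  qed
  ultimately have "closed {p \<in> A. N (?R p) - ?R (N p) = 0}"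
    by (intro continuous_closed_preimage_constant)
  moreover have "{p \<in> A. N (?R p) - ?R (N p) = 0} = symmetric_points w"
    unfolding A_def symmetric_points_def by auto
  ultimately have "closed (symmetric_points w)" by simp
  then have cl: "closedin (top_of_set M) (symmetric_points w)"
    by (intro closed_subset) (auto simp: symmetric_points_def)
  have "openin (top_of_set M) (symmetric_points w)"
    unfolding openin_subopen[of _ "symmetric_points w"]
  proof
    fix p assume p: "p \<in> symmetric_points w"
    then have pM: "p \<in> M" "?R p \<in> M" "N (?R p) = ?R (N p)" unfolding symmetric_points_def by auto
    show "\<exists>T. openin (top_of_set M) T \<and> p \<in> T \<and> T \<subseteq> symmetric_points w"
    proof (cases "0 \<le> mink p w")
      case True
      obtain W where W: "open W" "p \<in> W" "\<And>z. z \<in> W \<inter> hyp_space \<Longrightarrow> z \<in> M \<longleftrightarrow> ?R z \<in> M"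
        "\<And>z. z \<in> W \<inter> hyp_space \<Longrightarrow> z \<in> M \<Longrightarrow> N (?R z) = ?R (N z)"
        by (rule local_reflection[OF w pM True cap]) (assumption+, rule that, assumption+)
      have "M \<inter> W \<subseteq> symmetric_points w"
        unfolding symmetric_points_def using W(3,4) M_sub by blast
      then show ?thesis using W(1,2) pM(1) by (intro exI[of _ "M \<inter> W"]) (auto intro: openin_open_Int)
    next
      case False
      have q: "?R (?R p) \<in> M" "N (?R (?R p)) = ?R (N (?R p))" "0 \<le> mink (?R p) w"
        using pM False by (simp_all add: reflect_reflect[OF w0] mink_reflect[OF w0])
      obtain W where W: "open W" "?R p \<in> W" "\<And>z. z \<in> W \<inter> hyp_space \<Longrightarrow> z \<in> M \<longleftrightarrow> ?R z \<in> M"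
        "\<And>z. z \<in> W \<inter> hyp_space \<Longrightarrow> z \<in> M \<Longrightarrow> N (?R z) = ?R (N z)"
        by (rule local_reflection[OF w pM(2) q cap]) (assumption+, rule that, assumption+)
      have oV: "open (?R -` W)" using W(1) by (intro open_vimage cR)
      have "M \<inter> ?R -` W \<subseteq> symmetric_points w"
      proof
        fix z assume z: "z \<in> M \<inter> ?R -` W"
        have RzH: "?R z \<in> hyp_space" using z M_sub reflect_hyp_space[OF w] by blast
        have RzM: "?R z \<in> M" using W(3)[of "?R z"] z RzH by (simp add: reflect_reflect[OF w0])
        have "N z = ?R (N (?R z))" using W(4)[of "?R z"] z RzH RzM by (simp add: reflect_reflect[OF w0])
        then have "?R (N z) = N (?R z)" using reflect_reflect[OF w0] by metis
        then show "z \<in> symmetric_points w" using z RzM unfolding symmetric_points_def by simp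
      qed
      then show ?thesis using oV W(2) pM(1) by (intro exI[of _ "M \<inter> ?R -` W"]) (auto intro: openin_open_Int)
    qed
  qed
  then show ?thesis using M_connected cl ne unfolding connected_clopen by blast
qed

lemma reflection_symmetry:
  assumes c: "c \<in> hyp_space" and w: "mink w w = 1" "mink w c = 0"
  obtains s where "- 1 < s" "s < 1" "\<And>p. p \<in> M \<Longrightarrow> reflect (tilt c w s) p \<in> M"
proof -
  obtain s where s: "- 1 < s" "s < 1" "admissible (tilt c w s)" "symmetric_points (tilt c w s) \<noteq> {}"
    by (rule symmetric_point_exists[OF c w])
  have "symmetric_points (tilt c w s) = M" by (rule symmetric_points_all[OF tilt_pos[OF c w s(1,2)] s(3,4)])
  then show ?thesis using that[OF s(1,2)] unfolding symmetric_points_def by blast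
qed

end

section \<open>Symmetry about the circumcentre\<close>

text \<open>Existence is compactness of hyperbolic balls.  If there were two centres, the midpoint \<open>m\<close> of the
geodesic between them, which is their sum divided by \<open>L > 2\<close>, would see all of \<open>M\<close> within a smaller
radius.  Distances enter through their hyperbolic cosine \<open>- mink c p\<close>.\<close>

lemma circumcentre_exists:
  fixes M :: "'n::finite minkowski set"
  assumes M: "M \<noteq> {}" "M \<subseteq> hyp_space" "bounded M"
  obtains c t where "c \<in> hyp_space" "\<And>p. p \<in> M \<Longrightarrow> - mink c p \<le> t"
    "\<And>c'. c' \<in> hyp_space \<Longrightarrow> \<forall>p\<in>M. - mink c' p \<le> t \<Longrightarrow> c' = c"
proof -
  define A where "A = {t. \<exists>c\<in>hyp_space. \<forall>p\<in>M. - mink c p \<le> t}"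
  obtain p0 where p0: "p0 \<in> M" using M(1) by blast
  then have p0H: "p0 \<in> hyp_space" using M(2) by blast
  have A1: "1 \<le> t" if "t \<in> A" for t
  proof -
    obtain c where "c \<in> hyp_space" "- mink c p0 \<le> t" using \<open>t \<in> A\<close> p0 unfolding A_def by blast
    then show ?thesis using hyp_mink_le[of c p0] p0H by linarith
  qed
  have Ane: "A \<noteq> {}"
  proof -
    obtain B where B: "\<And>p. p \<in> M \<Longrightarrow> norm p \<le> B" using M(3) unfolding bounded_iff by blast
    obtain K where K: "\<And>a b :: 'n minkowski. norm (mink a b) \<le> norm a * norm b * K" "0 < K"
      using bounded_bilinear.pos_bounded[OF bounded_bilinear_mink] by blast
    have "- mink p0 p \<le> norm p0 * B * K" if "p \<in> M" for p
    proof -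
      have "- mink p0 p \<le> norm (mink p0 p)" by simp
      also have "\<dots> \<le> norm p0 * norm p * K" by (rule K(1))
      also have "\<dots> \<le> norm p0 * B * K" using B[OF that] K(2) by (intro mult_right_mono mult_left_mono) auto
      finally show ?thesis .
    qed
    then show ?thesis using p0H unfolding A_def by blast
  qed
  have bdd: "bdd_below A" using A1 by (meson bdd_belowI)
  define t where "t = Inf A"
  have t1: "1 \<le> t" unfolding t_def by (rule cInf_greatest[OF Ane A1])
  have t_le: "t \<le> r" if "c \<in> hyp_space" "\<And>p. p \<in> M \<Longrightarrow> - mink c p \<le> r" for c r
  proof -
    have "r \<in> A" using that unfolding A_def by blast
    then show ?thesis unfolding t_def by (rule cInf_lower[OF _ bdd])
  qed
  have ex: "\<exists>c\<in>hyp_space. \<forall>p\<in>M. - mink c p \<le> t + inverse (real (Suc n))" for n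
  proof -
    have "0 < inverse (real (Suc n))" by simp
    then have "Inf A < t + inverse (real (Suc n))" unfolding t_def by linarith
    from cInf_lessD[OF Ane this] obtain r where r: "r \<in> A" "r < t + inverse (real (Suc n))" by blast
    then obtain c where "c \<in> hyp_space" "\<forall>p\<in>M. - mink c p \<le> r" unfolding A_def by blast
    then show ?thesis using r(2) by (meson less_imp_le order_trans)
  qed
  then obtain c where c: "\<And>n. c n \<in> hyp_space" "\<And>n p. p \<in> M \<Longrightarrow> - mink (c n) p \<le> t + inverse (real (Suc n))"
    by metis
  define S where "S = {x \<in> hyp_space. - mink p0 x \<le> t + 1}"
  have "compact S"
  proof -
    have "S = hyp_space \<inter> {x. - mink p0 x \<le> t + 1}" unfolding S_def by blast
    moreover have "closed {x. - mink p0 x \<le> t + 1}"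
      by (intro closed_Collect_le continuous_intros mink_continuous_on)
    ultimately have "closed S" using closed_hyp_space by auto
    moreover have "bounded S" unfolding S_def by (rule bounded_hyp_ball[OF p0H])
    ultimately show ?thesis using compact_eq_bounded_closed by blast
  qed
  moreover have "c n \<in> S" for n
  proof -
    have "inverse (real (Suc n)) \<le> 1" using le_imp_inverse_le[of 1 "real (Suc n)"] by simp
    then show ?thesis unfolding S_def using c(1)[of n] c(2)[OF p0, of n] by (simp add: mink_commute[of p0])
  qed
  ultimately obtain c0 r where r: "c0 \<in> S" "strict_mono (r :: nat \<Rightarrow> nat)" "(c \<circ> r) \<longlonglongrightarrow> c0"
    unfolding compact_def by blast
  have c0H: "c0 \<in> hyp_space" using r(1) by (simp add: S_def)
  have c0t: "- mink c0 p \<le> t" if p: "p \<in> M" for p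
  proof -
    have 1: "(\<lambda>n. - mink ((c \<circ> r) n) p) \<longlonglongrightarrow> - mink c0 p"
      by (intro tendsto_minus mink_tendsto r(3) tendsto_const)
    have 2: "(\<lambda>n. t + inverse (real (Suc (r n)))) \<longlonglongrightarrow> t + 0"
      using LIMSEQ_subseq_LIMSEQ[OF LIMSEQ_inverse_real_of_nat r(2)] by (intro tendsto_add tendsto_const) (simp add: o_def)
    have "- mink c0 p \<le> t + 0"
      by (rule LIMSEQ_le[OF 1 2]) (use c(2)[OF p] in auto)
    then show ?thesis by simp
  qed
  have uniq: "c' = c0" if c': "c' \<in> hyp_space" "\<And>p. p \<in> M \<Longrightarrow> - mink c' p \<le> t" for c'
  proof (rule ccontr)
    assume "c' \<noteq> c0"
    then have lt: "mink c' c0 < -1" using hyp_mink_less[OF c'(1) c0H] by blast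
    \<comment> \<open>the Minkowski length of \<open>c' + c0\<close>\<close>
  define L where "L = sqrt (2 - 2 * mink c' c0)"
    have L4: "4 < 2 - 2 * mink c' c0" using lt by simp
    have L2: "2 < L" unfolding L_def using L4 by (intro real_less_rsqrt) simp
    have LL: "L * L = 2 - 2 * mink c' c0" unfolding L_def using L4 by simp
    define m where "m = (1 / L) *\<^sub>R (c' + c0)"
    have "mink m m = (1 / L) * ((1 / L) * (- (L * L)))"
      unfolding m_def LL using c'(1) c0H by (simp add: mink_simps hyp_space_def mink_commute[of c0 c'])
    then have mm: "mink m m = -1" using L2 by simp
    have "mink m c0 = (1 / L) * (mink c' c0 - 1)"
      unfolding m_def using c0H by (simp add: mink_simps hyp_space_def)
    moreover have "(1 / L) * (mink c' c0 - 1) < 0" using L2 lt by (intro mult_pos_neg) auto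
    ultimately have mH: "m \<in> hyp_space" using hyp_spaceI_mink[OF mm c0H] by simp
    have "- mink m p \<le> (2 * t) / L" if "p \<in> M" for p
    proof -
      have "- mink m p = (- mink c' p - mink c0 p) / L" unfolding m_def by (simp add: mink_simps add_divide_distrib diff_divide_distrib)
      also have "\<dots> \<le> (2 * t) / L" using c'(2)[OF that] c0t[OF that] L2 by (intro divide_right_mono) auto
      finally show ?thesis .
    qed
    then have "t \<le> (2 * t) / L" by (rule t_le[OF mH])
    moreover have "(2 * t) / L < t" using L2 t1 by (simp add: field_simps)
    ultimately show False by simp
  qed
  show ?thesis using that[OF c0H c0t] uniq by blast
qed

lemma reflect_exchanges:
  assumes "p \<in> hyp_space" "p' \<in> hyp_space" "p \<noteq> p'"
  shows "0 < mink (p - p') (p - p')" "reflect (p - p') p = p'"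
proof -
  have m: "mink (p - p') (p - p') = - 2 - 2 * mink p p'"
    using assms(1,2) by (simp add: mink_simps hyp_space_def mink_commute[of p' p])
  show pos: "0 < mink (p - p') (p - p')" unfolding m using hyp_mink_less[OF assms] by simp
  have "2 * mink p (p - p') = mink (p - p') (p - p')"
    unfolding m using assms(1) by (simp add: mink_simps hyp_space_def)
  then show "reflect (p - p') p = p'" unfolding reflect_def using pos by simp
qed

lemma reflect_scaleR: "k \<noteq> 0 \<Longrightarrow> reflect (k *\<^sub>R w) p = reflect w p"
  by (simp add: reflect_def mink_simps)

context curvature_hypersurface
begin

text \<open>Any two points at the same distance from \<open>c\<close> are exchanged by a reflection in a hyperplane through
\<open>c\<close>.  If \<open>M\<close> contained points at different distances it would contain a full neighbourhood of some
point, and no exterior points could accumulate there; and \<open>M\<close> is not just \<open>{c}\<close>, as it has nonzero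
tangent vectors.\<close>

lemma geodesic_sphere_M: "geodesic_sphere M"
proof -
  obtain c t where c: "c \<in> hyp_space" "\<And>p. p \<in> M \<Longrightarrow> - mink c p \<le> t"
    and uniq: "\<And>c'. c' \<in> hyp_space \<Longrightarrow> \<forall>p\<in>M. - mink c' p \<le> t \<Longrightarrow> c' = c"
    by (rule circumcentre_exists[OF M_ne M_sub compact_imp_bounded[OF compact_M]]) (rule that, assumption+)
  have cc: "mink c c = -1" using c(1) by (simp add: hyp_space_def)
  have sym: "reflect w p \<in> M" if w: "mink w w = 1" "mink w c = 0" and p: "p \<in> M" for w p
  proof -
    obtain s where s: "- 1 < s" "s < 1" "\<And>p. p \<in> M \<Longrightarrow> reflect (tilt c w s) p \<in> M"
      by (rule reflection_symmetry[OF c(1) w]) (rule that, assumption+)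
    have W: "0 < mink (tilt c w s) (tilt c w s)" by (rule tilt_pos[OF c(1) w s(1,2)])
    then have W0: "mink (tilt c w s) (tilt c w s) \<noteq> 0" by simp
    have "reflect (tilt c w s) c = c"
    proof (rule uniq[OF reflect_hyp_space[OF W c(1)]])
      show "\<forall>p\<in>M. - mink (reflect (tilt c w s) c) p \<le> t"
        unfolding reflect_adjoint[OF W0] using c(2) s(3) by blast
    qed
    then have "mink c (tilt c w s) = - mink c (tilt c w s)" using mink_reflect[OF W0, of c] by simp
    then have "s = 0" using w(2) by (simp add: mink_tilt cc mink_commute[of c w])
    then have "tilt c w s = w" by (simp add: tilt_def)
    then show ?thesis using s(3)[OF p] by simp
  qed
  have orbit: "p' \<in> M" if p: "p \<in> M" "p' \<in> hyp_space" "mink c p = mink c p'" for p p'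
  proof (cases "p = p'")
    case True then show ?thesis using p by simp
  next
    case False
    have pH: "p \<in> hyp_space" using p(1) M_sub by blast
    note r = reflect_exchanges[OF pH p(2) False]
    \<comment> \<open>normalises the vector, whose reflection exchanges \<open>p\<close> and \<open>p'\<close>\<close>
    define k where "k = 1 / sqrt (mink (p - p') (p - p'))"
    have k: "k \<noteq> 0" "k * (k * mink (p - p') (p - p')) = 1"
      using r(1) unfolding k_def by (simp_all add: field_simps)
    have "mink (k *\<^sub>R (p - p')) (k *\<^sub>R (p - p')) = 1"
      using k(2) by (simp only: mink_scaleR_left mink_scaleR_right)
    moreover have "mink (k *\<^sub>R (p - p')) c = 0"
      using p(3) by (simp add: mink_simps mink_commute[of _ c])
    ultimately have "reflect (k *\<^sub>R (p - p')) p \<in> M" by (rule sym[OF _ _ p(1)])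
    then show ?thesis by (simp only: reflect_scaleR[OF k(1)] r(2))
  qed
  have cont: "continuous_on S (mink c)" for S
    by (rule mink_continuous_on[OF continuous_on_const continuous_on_id])
  have const: False if p: "p1 \<in> M" "p2 \<in> M" "mink c p1 < mink c p2" for p1 p2
  proof -
    define a where "a = (mink c p1 + mink c p2) / 2"
    have a: "mink c p1 < a" "a < mink c p2" using p(3) unfolding a_def by auto
    have iv: "r \<in> mink c ` M" if "mink c p1 \<le> r" "r \<le> mink c p2" for r
      using connected_continuous_image[OF cont M_connected] p(1,2) that
      unfolding connected_iff_interval by blast
    obtain q where q: "q \<in> M" "mink c q = a" using iv[of a] a by auto
    define W where "W = {z. mink c p1 < mink c z} \<inter> {z. mink c z < mink c p2}"
    have "open W" unfolding W_def by (intro open_Int open_Collect_less cont continuous_on_const)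
    moreover have "q \<in> W" unfolding W_def using q a by simp
    ultimately obtain z where z: "z \<in> W" "z \<in> E" using exterior_accumulates[OF q(1)] by blast
    have zH: "z \<in> hyp_space" "z \<notin> M" using z(2) exterior_subset by blast+
    have "mink c z \<in> mink c ` M" using z(1) by (intro iv) (auto simp: W_def)
    then obtain q' where "q' \<in> M" "mink c q' = mink c z" by auto
    then show False using orbit[OF _ zH(1)] zH(2) by blast
  qed
  obtain p0 where p0: "p0 \<in> M" using M_ne by blast
  define d where "d = - mink c p0"
  have p0H: "p0 \<in> hyp_space" using p0 M_sub by blast
  have Meq: "M = {z \<in> hyp_space. - mink c z = d}"
  proof
    show "M \<subseteq> {z \<in> hyp_space. - mink c z = d}"
    proof
      fix z assume z: "z \<in> M"
      have "mink c z = mink c p0" using const[OF z p0] const[OF p0 z] by (metis linorder_neqE_linordered_idom)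
      then show "z \<in> {z \<in> hyp_space. - mink c z = d}" using z M_sub unfolding d_def by auto
    qed
    show "{z \<in> hyp_space. - mink c z = d} \<subseteq> M"
      using orbit[OF p0] unfolding d_def by auto
  qed
  have d1: "1 < d"
  proof (rule ccontr)
    assume "\<not> 1 < d"
    then have d: "d = 1" using hyp_mink_le[OF c(1) p0H] unfolding d_def by simp
    have single: "z = c" if "z \<in> M" for z
    proof (rule ccontr)
      assume "z \<noteq> c"
      then have "mink c z < -1" using hyp_mink_less[OF c(1), of z] that M_sub by blast
      then show False using that Meq d by auto
    qed
    obtain D and e :: "'n \<Rightarrow> 'n minkowski" where e: "\<And>i. e i \<in> tangent_space M p0"
      "\<And>i j. mink (e i) (e j) = (if i = j then 1 else 0)"
      by (rule N_derivative[OF p0]) (rule that, assumption+)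
    obtain \<gamma> \<epsilon> where \<gamma>: "0 < \<epsilon>" "\<gamma> ` {-\<epsilon><..<\<epsilon>} \<subseteq> M" "(\<gamma> has_vector_derivative e undefined) (at (0::real))"
      using e(1)[of undefined] unfolding tangent_space_def by blast
    have \<gamma>c: "c = \<gamma> s" if "s \<in> {-\<epsilon><..<\<epsilon>}" for s using \<gamma>(2) single that by blast
    have "(\<gamma> has_vector_derivative 0) (at 0)"
    proof (rule has_vector_derivative_transform_within_open[where f = "\<lambda>_. c" and S = "{-\<epsilon><..<\<epsilon>}"])
      show "c = \<gamma> s" if "s \<in> {-\<epsilon><..<\<epsilon>}" for s by (rule \<gamma>c[OF that])
    qed (use \<gamma>(1) in auto)
    then have "e undefined = 0" using vector_derivative_unique_at[OF \<gamma>(3)] by blast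
    then show False using e(2)[of undefined undefined] by (simp add: mink_simps)
  qed
  have "hyp_dist c z = arcosh d \<longleftrightarrow> - mink c z = d" if "z \<in> hyp_space" for z
  proof
    have z: "1 \<le> - mink c z" using hyp_mink_le[OF c(1) that] by simp
    assume "hyp_dist c z = arcosh d"
    then have "cosh (arcosh (- mink c z)) = cosh (arcosh d)" unfolding hyp_dist_def by simp
    then show "- mink c z = d" using z d1 by simp
  qed (simp add: hyp_dist_def)
  then have "M = {x \<in> hyp_space. hyp_dist c x = arcosh d}" unfolding Meq by blast
  moreover have "0 < arcosh d" using d1 arcosh_real_strict_mono[of 1 d] by simp
  ultimately show ?thesis unfolding geodesic_sphere_def using c(1) by blast
qed

end

theorem corollary1p8:
  fixes f :: "real ^ 'n::finite \<Rightarrow> real"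
    and M :: "'n minkowski set"
    and \<kappa> :: "'n minkowski \<Rightarrow> real ^ 'n"
    and C :: real
  assumes dim: "CARD('n) \<ge> 2"
    and f_smooth: "smooth_on pos_cone f"
    and f_symmetric: "symmetric_fun f"
    and f_increasing: "increasing_fun f"
    and f_homogeneous: "homogeneous_deg_one f"
    and f_cases: "(concave_on pos_cone f \<and> zero_on_boundary f) \<or>
       (concave_on pos_cone f \<and> inverse_concave f) \<or>
       (inverse_concave f \<and> zero_on_boundary (dual_fun f)) \<or>
       CARD('n) = 2"
    and M_hypersurface: "smooth_hypersurface M"
    and M_closed: "compact M"
    and M_convex: "strictly_h_convex M"
    and \<kappa>: "\<forall>p\<in>M. principal_curvatures M p (\<kappa> p)"
    and C_pos: "C > 0"
    and curvature_eq: "\<forall>p\<in>M. f (\<chi> i. \<kappa> p $ i - 1) = C"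
  shows "geodesic_sphere M"
proof -
  interpret curvature_hypersurface M \<kappa> f C
    by unfold_locales (use assms in auto)
  show ?thesis by (rule geodesic_sphere_M)
qed

end
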